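(* Let $t\geq 2$ and let $\pi=\{p_1,p_2,\dots,p_t\}$ be a set of $t$ distinct odd primes with $p_1<p_2<\dots<p_t$. Define $$\Omega_\pi:=p_t^{4(p_{t-1})^2},\qquad \mathcal{N}_\pi^{+}:=p_t+2^{2^{2^{\Omega_\pi}}}.$$ Let $\mathbb{N}_\pi^{\square}=\{a_1<a_2<\cdots\}$ be the set of $\pi$-numbers that are perfect squares, listed in increasing order, and let $S_\pi(x)$ be the number of elements of $\mathbb{N}_\pi^{\square}$ not exceeding $x$. Suppose $B_\pi\geq 2^{2^{40}}$ is a real number such that $$S_\pi(2x)-S_\pi(x)>2^{20}\log_2\log_2 x\quad\text{for all } x\geq B_\pi,$$ and $C_\pi\geq B_\pi$ is a real number such that $$\sum_{s=1}^{S_\pi(C_\pi)}\|a_s\theta\|^2>2\log_2 B_\pi+50\quad\text{for all } \tfrac{1}{4B_\pi}\leq\theta\leq 1-\tfrac{1}{4B_\pi},$$ where $\|x\|$ denotes the distance from $x$ to the nearest integer. Put $$\mathcal{N}_\pi^{-}:=p_t+\max\left\{C_\pi^{10},\,2^{2^{2^{400}}}\right\},\qquad N_\pi:=\min\{\mathcal{N}_\pi^{+},\mathcal{N}_\pi^{-}\}$$ (if no such $B_\pi, C_\pi$ exist, take $N_\pi:=\mathcal{N}_\pi^+$). Then for every integer $n>N_\pi$, $$K_\pi(A_n)=\mathbb{Q}\left(\sqrt{p_1^*},\sqrt{p_2^*},\dots,\sqrt{p_t^*}\right).$$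
   Context: $A_n$ denotes the alternating group on $n$ letters. For an odd integer $m$, $m^*:=(-1)^{\frac{m-1}{2}}m$. Given a finite set $\pi$ of odd primes, a $\pi$-number is a positive integer all of whose prime factors belong to $\pi$. $K_\pi(A_n)$ denotes the field generated over $\mathbb{Q}$ by all values $\chi(\sigma)$, where $\chi$ ranges over the characters of $A_n$ and $\sigma$ ranges over the elements of $A_n$ whose order is a $\pi$-number. *)

theory Defs
  imports
    Complex_Main
    "HOL-Library.Infinite_Set"
    "HOL-Computational_Algebra.Primes"
    "HOL-Algebra.Sym_Groups"
    "HOL-Algebra.Generated_Fields"
    "HOL-Algebra.Algebraic_Closure_Type"
    "Jordan_Normal_Form.Matrix"
begin

definition mat_trace :: "'a::comm_monoid_add mat \<Rightarrow> 'a" where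
  "mat_trace A = (\<Sum>i<dim_row A. A $$ (i, i))"

definition GL :: "nat \<Rightarrow> complex mat monoid" where
  "GL d = units_of (ring_mat TYPE(complex) d ())"

text \<open>Traces of finite-dimensional complex representations. Characters need not be irreducible,
  and only their values on the carrier are specified.\<close>

definition is_character :: "('g, 'r) monoid_scheme \<Rightarrow> ('g \<Rightarrow> complex) \<Rightarrow> bool" where
  "is_character G \<chi> \<longleftrightarrow>
     (\<exists>d. \<exists>\<rho> \<in> hom G (GL d). \<forall>g \<in> carrier G. \<chi> g = mat_trace (\<rho> g))"

definition rat_adjoin :: "complex set \<Rightarrow> complex set" where
  "rat_adjoin S = generate_field (ring_of_type_algebra :: complex ring) (\<rat> \<union> S)"

definition pi_number :: "nat set \<Rightarrow> nat \<Rightarrow> bool" where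
  "pi_number \<pi> m \<longleftrightarrow> m > 0 \<and> prime_factors m \<subseteq> \<pi>"

definition K :: "nat set \<Rightarrow> nat \<Rightarrow> complex set" where
  "K \<pi> n = rat_adjoin {\<chi> \<sigma> | \<chi> \<sigma>. is_character (alt_group n) \<chi> \<and>
     \<sigma> \<in> carrier (alt_group n) \<and> pi_number \<pi> (group.ord (alt_group n) \<sigma>)}"

definition odd_star :: "nat \<Rightarrow> int" where
  "odd_star m = (-1) ^ ((m - 1) div 2) * int m"

definition pi_squares :: "nat set \<Rightarrow> nat set" where
  "pi_squares \<pi> = {a. pi_number \<pi> a \<and> (\<exists>b. a = b ^ 2)}"

definition S :: "nat set \<Rightarrow> real \<Rightarrow> nat" where
  "S \<pi> x = card {a \<in> pi_squares \<pi>. real a \<le> x}"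

text \<open>The elements of \<^term>\<open>pi_squares \<pi>\<close> in increasing order, indexed from 1.\<close>

definition pi_square_seq :: "nat set \<Rightarrow> nat \<Rightarrow> nat" where
  "pi_square_seq \<pi> s = enumerate (pi_squares \<pi>) (s - 1)"

definition dist_int :: "real \<Rightarrow> real" where
  "dist_int x = \<bar>x - of_int (round x)\<bar>"

definition admissible_B :: "nat set \<Rightarrow> real \<Rightarrow> bool" where
  "admissible_B \<pi> B \<longleftrightarrow> B \<ge> 2 ^ (2 ^ 40) \<and>
     (\<forall>x \<ge> B. real (S \<pi> (2 * x)) - real (S \<pi> x) > 2 ^ 20 * log 2 (log 2 x))"

definition admissible_C :: "nat set \<Rightarrow> real \<Rightarrow> real \<Rightarrow> bool" where
  "admissible_C \<pi> B C \<longleftrightarrow> C \<ge> B \<and>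
     (\<forall>\<theta>. 1 / (4 * B) \<le> \<theta> \<and> \<theta> \<le> 1 - 1 / (4 * B) \<longrightarrow>
        (\<Sum>s = 1..S \<pi> C. (dist_int (real (pi_square_seq \<pi> s) * \<theta>))\<^sup>2) > 2 * log 2 B + 50)"

text \<open>Below, \<open>p 1 < \<dots> < p t\<close> are the elements of \<open>\<pi>\<close>.\<close>

definition Omega :: "(nat \<Rightarrow> nat) \<Rightarrow> nat \<Rightarrow> nat" where
  "Omega p t = p t ^ (4 * (p (t - 1))\<^sup>2)"

definition N_plus :: "(nat \<Rightarrow> nat) \<Rightarrow> nat \<Rightarrow> real" where
  "N_plus p t = real (p t) + 2 ^ (2 ^ (2 ^ Omega p t))"

definition N_minus :: "(nat \<Rightarrow> nat) \<Rightarrow> nat \<Rightarrow> real \<Rightarrow> real" where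
  "N_minus p t C = real (p t) + max (C ^ 10) (2 ^ (2 ^ (2 ^ 400)))"

text \<open>\<open>N\<^sub>\<pi>\<close> depends on the choice of \<open>B\<^sub>\<pi>\<close> and \<open>C\<^sub>\<pi>\<close>, so it is rendered as a relation:
  \<open>N\<close> is the value of \<open>N\<^sub>\<pi>\<close> for some admissible choice, or \<open>N_plus\<close> if there is none.\<close>

definition is_N :: "(nat \<Rightarrow> nat) \<Rightarrow> nat \<Rightarrow> real \<Rightarrow> bool" where
  "is_N p t N \<longleftrightarrow>
     (let adm = (\<lambda>B C. admissible_B (p ` {1..t}) B \<and> admissible_C (p ` {1..t}) B C) in
      (\<exists>B C. adm B C \<and> N = min (N_plus p t) (N_minus p t C)) \<or>
      ((\<nexists>B C. adm B C) \<and> N = N_plus p t))"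

end

theory Submission
  imports
    Defs
    "HOL-Number_Theory.Number_Theory"
    "Jordan_Normal_Form.Schur_Decomposition"
begin

text \<open>
  Upper bound: let \<open>\<sigma> \<in> A\<^sub>n\<close> have odd order \<open>m\<close>, and let \<open>l\<close> be coprime to \<open>m\<close>. In \<open>S\<^sub>n\<close> there is \<open>\<tau>\<close>
  with \<open>\<tau> \<sigma> \<tau>\<inverse> = \<sigma>\<^sup>l\<close>, and the even permutation \<open>\<tau>\<^sup>2\<close> conjugates \<open>\<sigma>\<close> to its \<open>l\<^sup>2\<close>-th power. Averaging
  \<open>\<chi>(\<sigma>^(l^2))\<close> over the units \<open>l\<close> modulo \<open>m\<close> writes \<open>\<chi>(\<sigma>)\<close> as a rational combination of sums of
  \<open>\<zeta>^(l^2)\<close> over these units, which are products of quadratic Gauss sums.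

  Lower bound: suppose \<open>n - p = b\<^sub>1\<^sup>2 + b\<^sub>2\<^sup>2 + \<dots>\<close> with distinct \<open>\<pi>\<close>-numbers \<open>b\<^sub>i\<close>, and let \<open>\<sigma>\<close> be a product of
  disjoint cycles of lengths \<open>p, b\<^sub>1\<^sup>2, b\<^sub>2\<^sup>2, \<dots>\<close>. As the lengths are odd and distinct, the centralizer of
  \<open>\<sigma>\<close> in \<open>S\<^sub>n\<close> lies in \<open>A\<^sub>n\<close>, so \<open>\<sigma>\<close> and \<open>\<sigma>\<^sup>k\<close> are conjugate in \<open>A\<^sub>n\<close> iff multiplication by \<open>k\<close> is an even
  permutation of the cells of the cycles. By Zolotarev's lemma (a cycle whose length is a square
  contributes an even permutation) this means that \<open>k\<close> is a square modulo \<open>p\<close>. Inducing a character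
  of order \<open>p\<close> from the cyclic group of \<open>\<sigma>\<close> gives a character whose value at \<open>\<sigma>\<close> involves the Gauss sum
  modulo \<open>p\<close>.

  It remains to write every large integer as a sum of distinct square \<open>\<pi>\<close>-numbers. This is Cassels'
  circle method: the dyadic blocks \<open>(B 2^i, B 2^(i+1)]\<close> contain enough elements that the product of
  cosines over one block is tiny, except on a set of \<open>\<theta>\<close> which within each interval of length \<open>1/(4 B 2^i)\<close>
  lies in a subinterval of half the length. For two primes \<open>p < q\<close> the hypotheses of the method
  hold for explicit constants, because some \<open>(p\<^sup>2)^u\<close> and \<open>(q\<^sup>2)^v\<close> have ratio in \<open>(1, 2]\<close>.
\<close>

section \<open>Cosines and distances to the nearest integer\<close>

text \<open>The conditions on \<open>B\<close> and \<open>C\<close> answer two losses of the circle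
  method. Block i lies near \<open>2 ^ (log 2 B + i)\<close>, so a size proportional to the
  logarithm of this exponent already gains a factor \<open>1 / (log 2 B + i) ^ 4\<close>, which is
  summable over i; this is the source of the iterated logarithm in the density condition. Far from
  the integers nothing is gained scale by scale, and each of the roughly \<open>4 * B\<close>
  intervals of length \<open>1 / (4 * B)\<close> costs a full term; there the condition on
  \<open>C\<close> makes half of the cosine product small enough to pay for them. The main term has
  a width of one over the root of the sum of squares of the elements used, so the blocks must be no
  larger than the gain requires. The circle method only reaches targets close to half of the total,
  and a doubling argument extends this window to all larger integers. Every prime of \<pi> is
  treated separately: a permutation with just one non-square cycle length isolates one square root.
  Hence \<open>n - p i\<close> must be large for each \<open>i\<close>, which explains the summand
  \<open>p t\<close> in the bounds for \<open>n\<close>.\<close>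

lemma dist_int_nonneg: "0 \<le> dist_int x"
  and dist_int_le_half: "dist_int x \<le> 1 / 2"
  using of_int_round_abs_le[of x] by (auto simp: dist_int_def abs_minus_commute)

lemma dist_int_le: "dist_int x \<le> \<bar>x - of_int k\<bar>"
  unfolding dist_int_def by (rule round_diff_minimal)

lemma dist_int_eq_abs: "\<bar>x\<bar> \<le> 1 / 2 \<Longrightarrow> dist_int x = \<bar>x\<bar>"
proof -
  assume x: "\<bar>x\<bar> \<le> 1 / 2"
  have "\<bar>x\<bar> \<le> \<bar>x - of_int (round x)\<bar>"
  proof (cases "round x = 0")
    case False
    hence "\<bar>of_int (round x) :: real\<bar> \<ge> 1" by linarith
    thus ?thesis using x by linarith
  qed simp
  moreover have "dist_int x \<le> \<bar>x\<bar>" using dist_int_le[of x 0] by simp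
  ultimately show ?thesis by (simp add: dist_int_def)
qed

lemma abs_cos_pi_dist_int: "\<bar>cos (pi * x)\<bar> = cos (pi * dist_int x)"
proof -
  define k where "k = round x"
  define r where "r = x - of_int k"
  have d: "dist_int x = \<bar>r\<bar>" by (simp add: dist_int_def r_def k_def)
  have "cos (pi * x) = cos (pi * r + of_int k * pi)"
    by (simp add: r_def algebra_simps)
  also have "\<dots> = cos (pi * r) * cos (of_int k * pi)"
    by (simp add: cos_add, metis mult.commute sin_npi_int)
  also have "\<bar>\<dots>\<bar> = \<bar>cos (pi * r)\<bar>"
  proof -
    have "sin (of_int k * pi) = 0" by (metis mult.commute sin_npi_int)
    hence "\<bar>cos (of_int k * pi)\<bar> = 1"
      using sin_zero_abs_cos_one by blast
    thus ?thesis by (simp add: abs_mult)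
  qed
  also have "\<dots> = \<bar>cos (pi * \<bar>r\<bar>)\<bar>"
    by (metis abs_mult abs_of_nonneg cos_abs_real pi_ge_zero)
  also have "\<dots> = cos (pi * \<bar>r\<bar>)"
  proof -
    have "pi * \<bar>r\<bar> \<le> pi * (1/2)"
      using dist_int_le_half[of x] pi_gt_zero unfolding d by (intro mult_left_mono) auto
    moreover have "- (pi / 2) \<le> pi * \<bar>r\<bar>"
      using pi_gt_zero by (meson abs_ge_zero mult_nonneg_nonneg neg_le_0_iff_le order_trans pi_half_ge_zero pi_ge_zero)
    ultimately have "0 \<le> cos (pi * \<bar>r\<bar>)" by (intro cos_ge_zero) auto
    thus ?thesis by simp
  qed
  finally show ?thesis by (simp add: d)
qed

lemma cos_ge_1_minus_square: "cos x \<ge> 1 - x\<^sup>2 / 2" for x :: real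
proof -
  have "cos x = 1 - 2 * (sin (x / 2))\<^sup>2" using cos_double_sin[of "x / 2"] by simp
  moreover have "(sin (x / 2))\<^sup>2 \<le> (x / 2)\<^sup>2"
    using abs_sin_x_le_abs_x[of "x / 2"] unfolding abs_le_square_iff .
  ultimately show ?thesis by (simp add: power_divide)
qed

text \<open>From \<open>cos (pi * d) = 1 - 2 * (sin (pi * d / 2))\<^sup>2\<close> and
  \<open>sin (pi * d / 2) \<ge> d\<close> for \<open>d \<le> 1 / 2\<close>. In this form a product
  of cosines is controlled by the sum of squared distances that occurs in
  \<open>admissible_C\<close>.\<close>

lemma abs_cos_pi_le: "\<bar>cos (pi * x)\<bar> \<le> exp (- (2 * (dist_int x)\<^sup>2))"
proof -
  define d where "d = dist_int x"
  have d: "0 \<le> d" "d \<le> 1/2" using dist_int_nonneg dist_int_le_half by (auto simp: d_def)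
  define y where "y = pi * d / 2"
  have y0: "0 \<le> y" using d by (simp add: y_def)
  have "pi * d \<le> 4 * (1/2)" using d pi_less_4 by (intro mult_mono) auto
  hence "y \<le> 1" by (simp add: y_def)
  hence y2: "y\<^sup>2 \<le> 1" using y0 by (simp add: power_le_one)
  have "\<bar>sin y - (\<Sum>m<3. sin_coeff m * y ^ m)\<bar> \<le> inverse (fact 3) * \<bar>y\<bar> ^ 3"
    by (rule Maclaurin_sin_bound)
  hence "\<bar>sin y - y\<bar> \<le> y ^ 3 / 6"
    using y0 by (simp add: eval_nat_numeral sin_coeff_def lessThan_Suc)
  hence "sin y \<ge> y - y ^ 3 / 6" unfolding abs_le_iff by linarith
  also have "y - y ^ 3 / 6 = y * (1 - y\<^sup>2 / 6)" by (simp add: power3_eq_cube power2_eq_square algebra_simps)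
  finally have "sin y \<ge> y * (5 / 6)"
    using mult_left_mono[of "5/6" "1 - y\<^sup>2 / 6" y] y2 y0 by linarith
  hence "(sin y)\<^sup>2 \<ge> (y * (5 / 6))\<^sup>2" using y0 by (intro power_mono) auto
  moreover have "(y * (5/6))\<^sup>2 \<ge> d\<^sup>2"
  proof (rule power_mono)
    have "pi \<ge> 3" using sin_x_le_x[of "pi / 6"] by (simp add: sin_30)
    hence "pi * d \<ge> 3 * d" using d by (intro mult_right_mono) auto
    thus "d \<le> y * (5/6)" using d by (simp add: y_def)
  qed (use d in auto)
  ultimately have "cos (pi * d) \<le> 1 - 2 * d\<^sup>2"
    using cos_double_sin[of y] by (simp add: y_def)
  also have "\<dots> \<le> exp (- (2 * d\<^sup>2))" using exp_ge_add_one_self[of "- (2 * d\<^sup>2)"] by simp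
  finally show ?thesis unfolding abs_cos_pi_dist_int d_def .
qed

text \<open>Real part of the expanded product of the factors
  \<open>1 + cis (2 * pi * a * \<theta>)\<close>, each centred at half its angle. The phase
  \<open>\<phi>\<close> is free because removing one element requires the induction hypothesis for
  \<open>\<phi>\<close> and for \<open>\<phi> + 2 * w\<close>.\<close>

lemma prod_cos_sum_subsets:
  fixes \<theta> \<phi> :: real
  assumes "finite E"
  shows "(\<Prod>a\<in>E. 2 * cos (pi * real a * \<theta>)) * cos (\<phi> + pi * \<theta> * real (\<Sum>E)) =
         (\<Sum>T\<in>Pow E. cos (\<phi> + 2 * pi * \<theta> * real (\<Sum>T)))"
  using assms
proof (induction E arbitrary: \<phi> rule: finite_induct)
  case (insert a E)
  define P where "P = (\<Prod>a\<in>E. 2 * cos (pi * real a * \<theta>))"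
  define u where "u = \<phi> + pi * \<theta> * real (\<Sum>E)"
  define w where "w = pi * real a * \<theta>"
  have fin: "finite T" if "T \<in> Pow E" for T using that insert finite_subset by auto
  have na: "a \<notin> T" if "T \<in> Pow E" for T using that insert by auto
  have "(\<Prod>a\<in>insert a E. 2 * cos (pi * real a * \<theta>)) * cos (\<phi> + pi * \<theta> * real (\<Sum>(insert a E)))
      = P * (2 * cos w * cos (u + w))"
    using insert by (simp add: P_def u_def w_def algebra_simps)
  also have "2 * cos w * cos (u + w) = cos u + cos (u + 2 * w)"
    using cos_times_cos[of "u + w" w] by (simp add: algebra_simps)
  also have "P * (cos u + cos (u + 2 * w)) = P * cos u + P * cos ((\<phi> + 2 * w) + pi * \<theta> * real (\<Sum>E))"
    by (simp add: u_def algebra_simps)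
  also have "\<dots> = (\<Sum>T\<in>Pow E. cos (\<phi> + 2 * pi * \<theta> * real (\<Sum>T))) +
      (\<Sum>T\<in>Pow E. cos ((\<phi> + 2 * w) + 2 * pi * \<theta> * real (\<Sum>T)))"
    using insert.IH[of \<phi>] insert.IH[of "\<phi> + 2 * w"] by (simp add: P_def u_def)
  also have "(\<Sum>T\<in>Pow E. cos ((\<phi> + 2 * w) + 2 * pi * \<theta> * real (\<Sum>T))) =
      (\<Sum>T\<in>Pow E. cos (\<phi> + 2 * pi * \<theta> * real (\<Sum>(insert a T))))"
    using fin na by (intro sum.cong refl) (auto simp: w_def algebra_simps)
  also have "\<dots> = (\<Sum>T\<in>insert a ` Pow E. cos (\<phi> + 2 * pi * \<theta> * real (\<Sum>T)))"
    using insert.hyps by (subst sum.reindex) (auto simp: inj_on_def)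
  also have "(\<Sum>T\<in>Pow E. cos (\<phi> + 2 * pi * \<theta> * real (\<Sum>T))) + \<dots> =
     (\<Sum>T\<in>Pow (insert a E). cos (\<phi> + 2 * pi * \<theta> * real (\<Sum>T)))"
    unfolding Pow_insert using insert.hyps by (subst sum.union_disjoint) auto
  finally show ?case .
qed simp

text \<open>Orthogonality modulo \<open>M\<close>: a full geometric sum over a root of unity other
  than 1 vanishes. The start \<open>h0\<close> is arbitrary since the sum is later taken over a
  range around 0.\<close>

lemma sum_cos_period_eq_0:
  fixes d :: int and h0 :: int and M :: nat
  assumes "\<not> int M dvd d" "M > 0"
  shows "(\<Sum>h\<in>{h0..<h0 + int M}. cos (2 * pi * (real_of_int h / M) * real_of_int d)) = 0"
proof -
  define w where "w = cis (2 * pi * real_of_int d / M)"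
  have w1: "w \<noteq> 1"
  proof
    assume "w = 1"
    hence "cos (2 * pi * real_of_int d / M) = 1" by (auto simp: w_def complex_eq_iff)
    then obtain k :: int where "2 * pi * real_of_int d / M = of_int k * 2 * pi"
      unfolding cos_one_2pi_int by blast
    hence "real_of_int d = real_of_int k * real M" using assms(2) by (simp add: field_simps)
    hence "real_of_int d = real_of_int (k * int M)" by simp
    hence "d = k * int M" by (simp only: of_int_eq_iff)
    thus False using assms(1) by simp
  qed
  have wM: "w ^ M = 1"
  proof -
    have "real M * (2 * pi * real_of_int d / real M) = 2 * pi * real_of_int d" using assms(2) by simp
    thus ?thesis unfolding w_def DeMoivre by simp
  qed
  have "(\<Sum>h\<in>{h0..<h0 + int M}. cis (2 * pi * (real_of_int h / M) * real_of_int d))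
      = (\<Sum>j<M. cis (2 * pi * (real_of_int (h0 + int j) / M) * real_of_int d))"
    by (rule sum.reindex_bij_witness[of _ "\<lambda>j. h0 + int j" "\<lambda>h. nat (h - h0)"]) auto
  also have "\<dots> = (\<Sum>j<M. cis (2 * pi * (real_of_int h0 / M) * real_of_int d) * w ^ j)"
  proof (intro sum.cong refl)
    fix j assume "j \<in> {..<M}"
    have "2 * pi * (real_of_int (h0 + int j) / M) * real_of_int d =
      2 * pi * (real_of_int h0 / M) * real_of_int d + real j * (2 * pi * real_of_int d / M)"
      using assms(2) by (simp add: field_simps)
    thus "cis (2 * pi * (real_of_int (h0 + int j) / M) * real_of_int d) =
        cis (2 * pi * (real_of_int h0 / M) * real_of_int d) * w ^ j"
      unfolding w_def DeMoivre cis_mult by simp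
  qed
  also have "\<dots> = cis (2 * pi * (real_of_int h0 / M) * real_of_int d) * (\<Sum>j<M. w ^ j)"
    by (simp add: sum_distrib_left)
  also have "(\<Sum>j<M. w ^ j) = 0" using geometric_sum[OF w1, of M] wM by simp
  finally have "Re (\<Sum>h\<in>{h0..<h0 + int M}. cis (2 * pi * (real_of_int h / M) * real_of_int d)) = 0" by simp
  thus ?thesis by simp
qed

section \<open>Dyadic blocks\<close>

lemma card_le_diam:
  fixes T :: "int set"
  assumes "finite T" "\<And>h h'. h \<in> T \<Longrightarrow> h' \<in> T \<Longrightarrow> \<bar>real_of_int h - real_of_int h'\<bar> \<le> r" "r \<ge> 0"
  shows "real (card T) \<le> r + 1"
proof (cases "T = {}")
  case False
  have "T \<subseteq> {Min T..Max T}" using assms(1) by auto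
  hence "card T \<le> card {Min T..Max T}" by (intro card_mono) auto
  also have "\<dots> = nat (Max T - Min T + 1)" by simp
  finally have "int (card T) \<le> Max T - Min T + 1"
    using Min_le_iff[OF assms(1) False, of "Max T"] Max_in[OF assms(1) False] by auto
  moreover have "\<bar>real_of_int (Max T) - real_of_int (Min T)\<bar> \<le> r"
    using assms(2)[OF Max_in[OF assms(1) False] Min_in[OF assms(1) False]] .
  ultimately show ?thesis by linarith
qed (use assms in auto)

text \<open>\<open>w i\<close> is any upper bound for the gain of block i, so that a convenient
  summable sequence can be chosen later. The \<open>M\<close> sample points \<open>h / M\<close>
  replace the integral over the circle.\<close>

locale dyadic_blocks =
  fixes D :: "nat \<Rightarrow> nat set" and B :: real and J :: nat and w :: "nat \<Rightarrow> real" and M :: nat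
  assumes B_pos: "B > 0" and M_pos: "M > 0"
    and fin_D: "\<And>i. finite (D i)"
    and D_range: "\<And>i a. a \<in> D i \<Longrightarrow> B * 2 ^ i < real a \<and> real a \<le> B * 2 ^ Suc i"
    and w_bound: "\<And>i. i < J \<Longrightarrow> exp (- real (card (D i)) / 512) \<le> w i"
begin

text \<open>The resolution of block i: \<open>a * len i \<le> 1 / 2\<close> for all \<open>a\<close>
  in \<open>D i\<close>, so multiplying a difference of this length by \<open>a\<close> cannot wrap
  around an integer.\<close>

definition len :: "nat \<Rightarrow> real" where "len i = 1 / (4 * B * 2 ^ i)"

text \<open>Square roots of the cosines: the other half of the product is kept for the \<open>\<theta>\<close> away from the
  integers, where it is estimated by the elements up to \<open>C\<close> instead of the blocks.\<close>

definition Q :: "nat \<Rightarrow> real \<Rightarrow> real" where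
  "Q i \<theta> = (\<Prod>a\<in>D i. sqrt \<bar>cos (pi * (real a * \<theta>))\<bar>)"

text \<open>With the threshold 1/16, two angles near for the same \<open>a\<close> differ by less
  than 1/8 after multiplication by \<open>a\<close>, up to an integer. Without wrapping this means a
  difference below half of \<open>len i\<close>.\<close>

definition near :: "nat \<Rightarrow> real \<Rightarrow> nat set" where
  "near i \<theta> = {a \<in> D i. dist_int (real a * \<theta>) < 1 / 16}"

text \<open>Bounds the sum of \<open>tailQ i\<close> over the sample points in an interval of length
  \<open>len i\<close>, for every \<open>i \<le> J\<close>.\<close>

definition W :: real where "W = (\<Prod>i<J. 1 + 2 * w i) * (M * len J + 1)"

lemma len_pos: "len i > 0" using B_pos by (simp add: len_def)

lemma len_Suc: "len i = 2 * len (Suc i)" using B_pos by (simp add: len_def)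

lemma w_nonneg: "i < J \<Longrightarrow> 0 \<le> w i"
  using w_bound[of i] exp_ge_zero order_trans by blast

lemma Q_nonneg: "0 \<le> Q i \<theta>" by (auto simp: Q_def intro!: prod_nonneg)

lemma sqrt_abs_cos_le: "sqrt \<bar>cos (pi * x)\<bar> \<le> exp (- (dist_int x)\<^sup>2)"
proof -
  have "sqrt \<bar>cos (pi * x)\<bar> \<le> sqrt (exp (- (2 * (dist_int x)\<^sup>2)))"
    using abs_cos_pi_le[of x] by simp
  also have "exp (- (2 * (dist_int x)\<^sup>2)) = (exp (- (dist_int x)\<^sup>2))\<^sup>2"
    using exp_double[of "- (dist_int x)\<^sup>2"] by simp
  finally show ?thesis by simp
qed

lemma Q_le_1: "Q i \<theta> \<le> 1"
  unfolding Q_def by (intro prod_le_1) auto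

text \<open>At least half of the elements have distance at least 1/16, and each of them contributes
  a factor of at most \<open>exp (- 1 / 256)\<close>; this is the 512 in
  \<open>w_bound\<close>.\<close>

lemma Q_le_w:
  assumes "i < J" "2 * card (near i \<theta>) \<le> card (D i)"
  shows "Q i \<theta> \<le> w i"
proof -
  define F where "F = D i - near i \<theta>"
  have cF: "card (D i) \<le> 2 * card F"
    using assms(2) fin_D[of i] by (simp add: F_def near_def card_Diff_subset)
  have D: "D i = F \<union> near i \<theta>" "F \<inter> near i \<theta> = {}" by (auto simp: F_def near_def)
  have fin: "finite F" "finite (near i \<theta>)" using fin_D by (auto simp: F_def near_def)
  have "Q i \<theta> = (\<Prod>a\<in>F. sqrt \<bar>cos (pi * (real a * \<theta>))\<bar>) * (\<Prod>a\<in>near i \<theta>. sqrt \<bar>cos (pi * (real a * \<theta>))\<bar>)"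
    unfolding Q_def by (subst D(1), rule prod.union_disjoint) (use fin D in auto)
  also have "\<dots> \<le> (\<Prod>a\<in>F. sqrt \<bar>cos (pi * (real a * \<theta>))\<bar>) * 1"
    by (intro mult_left_mono prod_le_1 prod_nonneg) auto
  also have "\<dots> \<le> (\<Prod>a\<in>F. exp (- (1 / 16)\<^sup>2)) * 1"
  proof (intro mult_right_mono prod_mono conjI)
    fix a assume "a \<in> F"
    hence "1 / 16 \<le> dist_int (real a * \<theta>)" by (auto simp: F_def near_def)
    hence "(1 / 16)\<^sup>2 \<le> (dist_int (real a * \<theta>))\<^sup>2" by (intro power_mono) auto
    hence "exp (- (dist_int (real a * \<theta>))\<^sup>2) \<le> exp (- (1 / 16)\<^sup>2)" by simp
    with sqrt_abs_cos_le show "sqrt \<bar>cos (pi * (real a * \<theta>))\<bar> \<le> exp (- (1 / 16)\<^sup>2)"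
      using order_trans by blast
  qed auto
  also have "\<dots> = exp (- (real (card F) / 256))"
    by (simp add: exp_of_nat_mult[symmetric] power2_eq_square)
  also have "\<dots> \<le> exp (- real (card (D i)) / 512)" using cF by simp
  also have "\<dots> \<le> w i" using w_bound assms by simp
  finally show ?thesis .
qed

text \<open>Two majorities share an element \<open>a\<close>, and \<open>a (\<theta> - \<theta>')\<close> is at most \<open>1 / 2\<close>, so it is equal to its
  distance to the integers.\<close>

lemma near_majority_close:
  assumes \<theta>: "2 * card (near i \<theta>) > card (D i)" and \<theta>': "2 * card (near i \<theta>') > card (D i)"
    and d: "\<bar>\<theta> - \<theta>'\<bar> \<le> len i"
  shows "\<bar>\<theta> - \<theta>'\<bar> \<le> len (Suc i)"
proof -
  have "card (near i \<theta> \<union> near i \<theta>') \<le> card (D i)"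
    using fin_D by (intro card_mono) (auto simp: near_def)
  moreover have "card (near i \<theta> \<union> near i \<theta>') + card (near i \<theta> \<inter> near i \<theta>') = card (near i \<theta>) + card (near i \<theta>')"
    using card_Un_Int[of "near i \<theta>" "near i \<theta>'"] fin_D[of i] by (simp add: near_def)
  ultimately have "card (near i \<theta> \<inter> near i \<theta>') > 0" using \<theta> \<theta>' by linarith
  then obtain a where a: "a \<in> near i \<theta>" "a \<in> near i \<theta>'" by (auto simp: card_gt_0_iff)
  define y where "y = real a * \<theta> - real a * \<theta>'"
  have ar: "B * 2 ^ i < real a" "real a \<le> B * 2 ^ Suc i" using a D_range by (auto simp: near_def)
  have ya: "\<bar>y\<bar> = real a * \<bar>\<theta> - \<theta>'\<bar>" by (simp add: y_def abs_mult flip: right_diff_distrib)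
  also have "\<dots> \<le> (B * 2 ^ Suc i) * len i" using ar d B_pos by (intro mult_mono) auto
  also have "\<dots> = 1 / 2" using B_pos by (simp add: len_def)
  finally have "dist_int y = \<bar>y\<bar>" by (rule dist_int_eq_abs)
  moreover have "dist_int y \<le> \<bar>y - of_int (round (real a * \<theta>) - round (real a * \<theta>'))\<bar>"
    by (rule dist_int_le)
  moreover have "\<dots> \<le> dist_int (real a * \<theta>) + dist_int (real a * \<theta>')"
    unfolding dist_int_def y_def by simp
  ultimately have "\<bar>y\<bar> \<le> 1 / 8" using a by (auto simp: near_def)
  hence "real a * \<bar>\<theta> - \<theta>'\<bar> \<le> 1 / 8" using ya by simp
  moreover have "(B * 2 ^ i) * \<bar>\<theta> - \<theta>'\<bar> \<le> real a * \<bar>\<theta> - \<theta>'\<bar>" using ar by (intro mult_right_mono) auto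
  ultimately have "(B * 2 ^ i) * \<bar>\<theta> - \<theta>'\<bar> \<le> 1 / 8" by linarith
  thus ?thesis using B_pos by (simp add: len_def field_simps)
qed

definition tailQ :: "nat \<Rightarrow> int \<Rightarrow> real" where
  "tailQ i h = (\<Prod>j\<in>{i..<J}. Q j (real_of_int h / M))"

lemma tailQ_nonneg: "0 \<le> tailQ i h" by (auto simp: tailQ_def intro!: prod_nonneg Q_nonneg)

lemma tailQ_step: "i < J \<Longrightarrow> tailQ i h = Q i (real_of_int h / M) * tailQ (Suc i) h"
  by (simp add: tailQ_def prod.atLeast_Suc_lessThan)

definition diam_le :: "int set \<Rightarrow> real \<Rightarrow> bool" where
  "diam_le T r \<longleftrightarrow> finite T \<and> (\<forall>h\<in>T. \<forall>h'\<in>T. \<bar>real_of_int h / M - real_of_int h' / M\<bar> \<le> r)"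

text \<open>Induction from the finest scale. In an interval of length \<open>len i\<close>, the
  points with a near majority fit into one interval of half the length and keep the factor 1; the
  other points fill at most two halves and gain \<open>w i\<close> in each. So every block costs a
  factor \<open>1 + 2 * w i\<close>, and at the end only the points in an interval of length
  \<open>len J\<close> are counted.\<close>

lemma sum_tailQ_le:
  assumes "i \<le> J" "diam_le T (len i)"
  shows "(\<Sum>h\<in>T. tailQ i h) \<le> (\<Prod>j\<in>{i..<J}. 1 + 2 * w j) * (M * len J + 1)"
  using assms
proof (induction i arbitrary: T rule: inc_induct)
  case base
  have "\<bar>real_of_int h - real_of_int h'\<bar> \<le> M * len J" if "h \<in> T" "h' \<in> T" for h h'
  proof -
    have "\<bar>real_of_int h / M - real_of_int h' / M\<bar> \<le> len J"
      using base that by (auto simp: diam_le_def)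
    hence "\<bar>real_of_int h - real_of_int h'\<bar> / M \<le> len J"
      by (metis abs_divide abs_of_nat diff_divide_distrib)
    thus ?thesis using M_pos by (simp add: field_simps)
  qed
  hence "real (card T) \<le> M * len J + 1"
    using base len_pos[of J] by (intro card_le_diam) (auto simp: diam_le_def)
  thus ?case by (simp add: tailQ_def)
next
  case (step i)
  define R where "R = (\<Prod>j\<in>{Suc i..<J}. 1 + 2 * w j) * (M * len J + 1)"
  have fin: "finite T" using step.prems by (simp add: diam_le_def)
  define isnear where "isnear h \<longleftrightarrow> 2 * card (near i (real_of_int h / M)) > card (D i)" for h
  define T0 where "T0 = {h\<in>T. isnear h}"
  define m where "m = real_of_int (Min T) / M"
  define T1 where "T1 = {h\<in>T. \<not> isnear h \<and> real_of_int h / M \<le> m + len (Suc i)}"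
  define T2 where "T2 = {h\<in>T. \<not> isnear h \<and> \<not> real_of_int h / M \<le> m + len (Suc i)}"
  have T: "T = T0 \<union> (T1 \<union> T2)" by (auto simp: T0_def T1_def T2_def)
  have disj: "T0 \<inter> (T1 \<union> T2) = {}" "T1 \<inter> T2 = {}" by (auto simp: T0_def T1_def T2_def)
  have fins: "finite T0" "finite T1" "finite T2" using fin by (auto simp: T0_def T1_def T2_def)
  have lo: "m \<le> real_of_int h / M" if "h \<in> T" for h
    using that fin M_pos unfolding m_def by (intro divide_right_mono) auto
  have hi: "real_of_int h / M \<le> m + len i" if "h \<in> T" for h
  proof -
    have "Min T \<in> T" using that fin by (intro Min_in) auto
    hence "\<bar>real_of_int h / M - m\<bar> \<le> len i"
      using step.prems that unfolding diam_le_def m_def by blast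
    thus ?thesis by linarith
  qed
  have d0: "diam_le T0 (len (Suc i))"
    using step.prems fins near_majority_close
    by (auto simp: diam_le_def T0_def isnear_def)
  have d1: "diam_le T1 (len (Suc i))" unfolding diam_le_def
  proof (intro conjI ballI fins)
    fix h h' assume "h \<in> T1" "h' \<in> T1"
    thus "\<bar>real_of_int h / M - real_of_int h' / M\<bar> \<le> len (Suc i)"
      using lo[of h] lo[of h'] unfolding T1_def by auto
  qed
  have d2: "diam_le T2 (len (Suc i))" unfolding diam_le_def
  proof (intro conjI ballI fins)
    fix h h' assume "h \<in> T2" "h' \<in> T2"
    thus "\<bar>real_of_int h / M - real_of_int h' / M\<bar> \<le> len (Suc i)"
      using hi[of h] hi[of h'] len_Suc[of i] unfolding T2_def by auto
  qed
  have good: "(\<Sum>h\<in>T'. tailQ i h) \<le> w i * R" if "T' \<subseteq> {h. \<not> isnear h}" "diam_le T' (len (Suc i))" for T'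
  proof -
    have "(\<Sum>h\<in>T'. tailQ i h) \<le> (\<Sum>h\<in>T'. w i * tailQ (Suc i) h)"
      unfolding tailQ_step[OF step.hyps(2)] using that(1) step.hyps(2)
      by (intro sum_mono mult_right_mono tailQ_nonneg Q_le_w) (auto simp: isnear_def)
    also have "\<dots> = w i * (\<Sum>h\<in>T'. tailQ (Suc i) h)" by (simp add: sum_distrib_left)
    also have "\<dots> \<le> w i * R" unfolding R_def
      using step.IH[OF that(2)] w_nonneg[OF step.hyps(2)] by (rule mult_left_mono)
    finally show ?thesis .
  qed
  have "(\<Sum>h\<in>T. tailQ i h) = (\<Sum>h\<in>T0. tailQ i h) + ((\<Sum>h\<in>T1. tailQ i h) + (\<Sum>h\<in>T2. tailQ i h))"
    unfolding T using fins disj by (simp add: sum.union_disjoint)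
  also have "(\<Sum>h\<in>T0. tailQ i h) \<le> (\<Sum>h\<in>T0. 1 * tailQ (Suc i) h)"
    unfolding tailQ_step[OF step.hyps(2)] by (intro sum_mono mult_right_mono tailQ_nonneg Q_le_1)
  also have "\<dots> \<le> R" unfolding R_def using step.IH[OF d0] by simp
  also have "(\<Sum>h\<in>T1. tailQ i h) \<le> w i * R" by (rule good[OF _ d1]) (auto simp: T1_def)
  also have "(\<Sum>h\<in>T2. tailQ i h) \<le> w i * R" by (rule good[OF _ d2]) (auto simp: T2_def)
  also have "R + (w i * R + w i * R) = (1 + 2 * w i) * R" by (simp add: algebra_simps)
  also have "\<dots> = (\<Prod>j\<in>{i..<J}. 1 + 2 * w j) * (M * len J + 1)"
    using step.hyps by (simp add: R_def prod.atLeast_Suc_lessThan mult.assoc)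
  finally show ?case by simp
qed

lemma sum_tailQ_le_W:
  assumes "i \<le> J" "diam_le T (len i)"
  shows "(\<Sum>h\<in>T. tailQ i h) \<le> W"
proof -
  have nn: "0 \<le> M * len J + 1" using len_pos[of J] by simp
  have "(\<Prod>j\<in>{i..<J}. 1 + 2 * w j) \<le> (\<Prod>j\<in>{..<i}. 1 + 2 * w j) * (\<Prod>j\<in>{i..<J}. 1 + 2 * w j)"
  proof -
    have "0 \<le> (\<Prod>j\<in>{i..<J}. 1 + 2 * w j)" using w_nonneg by (intro prod_nonneg) auto
    moreover have "1 \<le> (\<Prod>j\<in>{..<i}. 1 + 2 * w j)" using w_nonneg assms(1) by (intro prod_ge_1) auto
    ultimately show ?thesis using mult_right_mono by fastforce
  qed
  also have "\<dots> = (\<Prod>j<J. 1 + 2 * w j)"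
    using assms(1) prod.atLeastLessThan_concat[of 0 i J "\<lambda>j. 1 + 2 * w j"] by (simp add: atLeast0LessThan)
  finally have "(\<Prod>j\<in>{i..<J}. 1 + 2 * w j) * (M * len J + 1) \<le> W"
    unfolding W_def using nn by (rule mult_right_mono)
  with sum_tailQ_le[OF assms] show ?thesis by linarith
qed

lemma W_nonneg: "0 \<le> W"
  using sum_tailQ_le_W[of J "{}"] by (simp add: diam_le_def)

lemma finite_abs_le: "finite {h::int. \<bar>real_of_int h / M\<bar> \<le> r}"
proof (rule finite_subset)
  show "{h. \<bar>real_of_int h / M\<bar> \<le> r} \<subseteq> {- \<lceil>r * M\<rceil>..\<lceil>r * M\<rceil>}"
  proof
    fix h assume "h \<in> {h. \<bar>real_of_int h / M\<bar> \<le> r}"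
    hence "\<bar>real_of_int h\<bar> \<le> r * M" using M_pos by (simp add: field_simps)
    hence "real_of_int \<bar>h\<bar> \<le> of_int \<lceil>r * M\<rceil>" by linarith
    hence "\<bar>h\<bar> \<le> \<lceil>r * M\<rceil>" by (simp only: of_int_le_iff)
    thus "h \<in> {- \<lceil>r * M\<rceil>..\<lceil>r * M\<rceil>}" by auto
  qed
qed simp

text \<open>If \<open>len (Suc i) < \<bar>\<theta>\<bar> \<le> len i\<close>, then
  \<open>a * \<bar>\<theta>\<bar>\<close> lies between 1/8 and 1/2 for every \<open>a\<close> in
  \<open>D i\<close>, so no element of the block is near. Removing these two outer pieces scale by
  scale gives a bound proportional to the \<open>w j\<close>, without the leading 1 of the general
  estimate.\<close>

lemma sum_tailQ_centre:
  assumes "i \<le> J"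
  shows "(\<Sum>h | len J < \<bar>real_of_int h / M\<bar> \<and> \<bar>real_of_int h / M\<bar> \<le> len i. tailQ i h) \<le> (\<Sum>j\<in>{i..<J}. 2 * w j * W)"
  using assms
proof (induction i rule: inc_induct)
  case base
  have "{h. len J < \<bar>real_of_int h / M\<bar> \<and> \<bar>real_of_int h / M\<bar> \<le> len J} = {}" by force
  thus ?case by (simp only: sum.empty atLeastLessThan_empty_iff less_irrefl) simp
next
  case (step i)
  define th where "th h = real_of_int h / real M" for h
  have finI: "finite {h. \<bar>th h\<bar> \<le> r}" for r unfolding th_def by (rule finite_abs_le)
  define T0 where "T0 = {h. len J < \<bar>th h\<bar> \<and> \<bar>th h\<bar> \<le> len (Suc i)}"
  define T1 where "T1 = {h. len J < \<bar>th h\<bar> \<and> len (Suc i) < th h \<and> th h \<le> len i}"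
  define T2 where "T2 = {h. len J < \<bar>th h\<bar> \<and> len (Suc i) < - th h \<and> - th h \<le> len i}"
  have fins: "finite T0" "finite T1" "finite T2"
    by (rule finite_subset[OF _ finI[of "len i"]],
        use len_Suc[of i] len_pos[of i] len_pos[of "Suc i"] in \<open>force simp: T0_def T1_def T2_def\<close>)+
  have T: "{h. len J < \<bar>th h\<bar> \<and> \<bar>th h\<bar> \<le> len i} = T0 \<union> (T1 \<union> T2)"
    using len_Suc[of i] len_pos[of "Suc i"] by (auto simp: T0_def T1_def T2_def)
  have disj: "T0 \<inter> (T1 \<union> T2) = {}" "T1 \<inter> T2 = {}"
    using len_pos[of "Suc i"] by (auto simp: T0_def T1_def T2_def)
  have d1: "diam_le T1 (len (Suc i))" "diam_le T2 (len (Suc i))"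
    using fins len_Suc[of i] by (auto simp: diam_le_def T1_def T2_def th_def)
  have near: "near i (th h) = {}" if th: "len (Suc i) < \<bar>th h\<bar>" "\<bar>th h\<bar> \<le> len i" for h
  proof -
    have "\<not> dist_int (real a * th h) < 1 / 16" if a: "a \<in> D i" for a
    proof -
      have ar: "B * 2 ^ i < real a" "real a \<le> B * 2 ^ Suc i" using a D_range by auto
      have "real a * \<bar>th h\<bar> \<le> (B * 2 ^ Suc i) * len i" using ar \<open>\<bar>th h\<bar> \<le> len i\<close> B_pos by (intro mult_mono) auto
      also have "\<dots> = 1 / 2" using B_pos by (simp add: len_def)
      finally have "dist_int (real a * th h) = real a * \<bar>th h\<bar>" using dist_int_eq_abs[of "real a * th h"] by (simp add: abs_mult)
      moreover have "(B * 2 ^ i) * len (Suc i) \<le> real a * \<bar>th h\<bar>"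
        using ar th len_pos[of "Suc i"] B_pos by (intro mult_mono) auto
      moreover have "(B * 2 ^ i) * len (Suc i) = 1 / 8" using B_pos by (simp add: len_def)
      ultimately show ?thesis by linarith
    qed
    thus ?thesis by (auto simp: near_def)
  qed
  have good: "(\<Sum>h\<in>T'. tailQ i h) \<le> w i * W"
    if "T' \<subseteq> {h. len (Suc i) < \<bar>th h\<bar> \<and> \<bar>th h\<bar> \<le> len i}" "diam_le T' (len (Suc i))" for T'
  proof -
    have "(\<Sum>h\<in>T'. tailQ i h) \<le> (\<Sum>h\<in>T'. w i * tailQ (Suc i) h)"
    proof (rule sum_mono)
      fix h assume "h \<in> T'"
      hence "near i (real_of_int h / M) = {}" using near that(1) by (auto simp: th_def)
      hence "Q i (real_of_int h / M) \<le> w i" using step.hyps(2) by (intro Q_le_w) auto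
      thus "tailQ i h \<le> w i * tailQ (Suc i) h"
        unfolding tailQ_step[OF step.hyps(2)] by (intro mult_right_mono tailQ_nonneg)
    qed
    also have "\<dots> = w i * (\<Sum>h\<in>T'. tailQ (Suc i) h)" by (simp add: sum_distrib_left)
    also have "\<dots> \<le> w i * W"
      using sum_tailQ_le_W[OF _ that(2)] w_nonneg[OF step.hyps(2)] step.hyps(2) by (intro mult_left_mono) auto
    finally show ?thesis .
  qed
  have "(\<Sum>h\<in>{h. len J < \<bar>th h\<bar> \<and> \<bar>th h\<bar> \<le> len i}. tailQ i h) = (\<Sum>h\<in>T0. tailQ i h) + ((\<Sum>h\<in>T1. tailQ i h) + (\<Sum>h\<in>T2. tailQ i h))"
    unfolding T using fins disj by (simp add: sum.union_disjoint)
  also have "(\<Sum>h\<in>T0. tailQ i h) \<le> (\<Sum>h\<in>T0. 1 * tailQ (Suc i) h)"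
    unfolding tailQ_step[OF step.hyps(2)] by (intro sum_mono mult_right_mono tailQ_nonneg Q_le_1)
  also have "\<dots> \<le> (\<Sum>j\<in>{Suc i..<J}. 2 * w j * W)" using step.IH by (simp add: T0_def th_def)
  also have "(\<Sum>h\<in>T1. tailQ i h) \<le> w i * W" by (rule good[OF _ d1(1)]) (use len_pos[of "Suc i"] in \<open>auto simp: T1_def\<close>)
  also have "(\<Sum>h\<in>T2. tailQ i h) \<le> w i * W" by (rule good[OF _ d1(2)]) (use len_pos[of "Suc i"] in \<open>auto simp: T2_def\<close>)
  also have "(\<Sum>j\<in>{Suc i..<J}. 2 * w j * W) + (w i * W + w i * W) = (\<Sum>j\<in>{i..<J}. 2 * w j * W)"
    using step.hyps by (simp add: sum.atLeast_Suc_lessThan)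
  finally show ?case by (simp add: th_def)
qed

end

section \<open>The circle method on equally spaced points\<close>

lemma one_minus_sum_le_prod:
  fixes x :: "'a \<Rightarrow> real"
  assumes "finite A" "\<And>a. a \<in> A \<Longrightarrow> 0 \<le> x a \<and> x a \<le> 1"
  shows "1 - sum x A \<le> (\<Prod>a\<in>A. 1 - x a)"
  using assms
proof (induction A rule: finite_induct)
  case (insert a A)
  define P where "P = (\<Prod>a\<in>A. 1 - x a)"
  have "0 \<le> P" "P \<le> 1" using insert by (auto simp: P_def intro!: prod_nonneg prod_le_1)
  have "x a * P \<le> x a" using \<open>P \<le> 1\<close> \<open>0 \<le> P\<close> insert.prems[of a] by (intro mult_left_le) auto
  moreover have "1 - sum x A \<le> P" unfolding P_def using insert by auto
  ultimately show ?case using insert by (simp add: P_def[symmetric] algebra_simps)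
qed simp

lemma dist_int_minus: "dist_int (- x) = dist_int x"
proof -
  have "dist_int (- x) \<le> dist_int x" for x
    using dist_int_le[of "- x" "- round x"] by (simp add: dist_int_def)
  from this[of x] this[of "- x"] show ?thesis by simp
qed

context dyadic_blocks
begin

text \<open>Cells of length \<open>len 0 = 1 / (4 * B)\<close> cover the range from -1/2 to 1/2; at
  most \<open>4 * B + 3\<close> of them occur, and each contributes at most
  \<open>W\<close>.\<close>

lemma sum_tailQ_total:
  assumes T: "\<And>h. h \<in> T \<Longrightarrow> \<bar>real_of_int h / M\<bar> \<le> 1 / 2"
  shows "(\<Sum>h\<in>T. tailQ 0 h) \<le> (4 * B + 3) * W"
proof -
  define g where "g h = \<lfloor>(real_of_int h / M) / len 0\<rfloor>" for h
  define r where "r = \<lfloor>2 * B\<rfloor>"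
  have fT: "finite T" by (rule finite_subset[OF _ finite_abs_le[of "1/2"]]) (use T in auto)
  have gT: "g ` T \<subseteq> {- r - 1..r}"
  proof
    fix k assume "k \<in> g ` T"
    then obtain h where h: "h \<in> T" "k = g h" by auto
    have "\<bar>(real_of_int h / M) / len 0\<bar> \<le> 2 * B"
    proof -
      have "\<bar>(real_of_int h / M) / len 0\<bar> = \<bar>real_of_int h / M\<bar> * (4 * B)"
        using B_pos by (simp add: len_def abs_mult)
      also have "\<dots> \<le> 1 / 2 * (4 * B)" using T[OF h(1)] B_pos by (intro mult_right_mono) auto
      finally show ?thesis by simp
    qed
    hence "\<lfloor>(real_of_int h / M) / len 0\<rfloor> \<le> r" "- r - 1 \<le> \<lfloor>(real_of_int h / M) / len 0\<rfloor>"
      unfolding r_def by linarith+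
    thus "k \<in> {- r - 1..r}" using h by (simp add: g_def)
  qed
  have "(\<Sum>h\<in>T. tailQ 0 h) = (\<Sum>k\<in>{- r - 1..r}. \<Sum>h\<in>{h\<in>T. g h = k}. tailQ 0 h)"
    using fT gT by (intro sum.group[symmetric]) auto
  also have "\<dots> \<le> (\<Sum>k\<in>{- r - 1..r}. W)"
  proof (rule sum_mono)
    fix k
    have "\<bar>real_of_int h / M - real_of_int h' / M\<bar> \<le> len 0" if "g h = k" "g h' = k" for h h'
    proof -
      have "\<bar>(real_of_int h / M) / len 0 - (real_of_int h' / M) / len 0\<bar> \<le> 1"
        using that unfolding g_def by linarith
      hence "\<bar>real_of_int h / M - real_of_int h' / M\<bar> / len 0 \<le> 1"
        using len_pos[of 0] by (simp add: abs_divide diff_divide_distrib[symmetric])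
      thus ?thesis using len_pos[of 0] by simp
    qed
    thus "(\<Sum>h\<in>{h\<in>T. g h = k}. tailQ 0 h) \<le> W"
      using fT by (intro sum_tailQ_le_W) (auto simp: diam_le_def)
  qed
  also have "\<dots> = real (nat (2 * r + 2)) * W" by (simp add: ac_simps)
  also have "\<dots> \<le> (4 * B + 3) * W"
  proof (rule mult_right_mono[OF _ W_nonneg])
    have "0 \<le> r" using B_pos by (simp add: r_def)
    hence "real (nat (2 * r + 2)) = 2 * real_of_int r + 2" by simp
    moreover have "real_of_int r \<le> 2 * B" by (simp add: r_def)
    ultimately show "real (nat (2 * r + 2)) \<le> 4 * B + 3" by linarith
  qed
  finally show ?thesis .
qed

lemma D_disjoint: "i < j \<Longrightarrow> D i \<inter> D j = {}"
proof (rule ccontr)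
  assume ij: "i < j" and "D i \<inter> D j \<noteq> {}"
  then obtain a where a: "a \<in> D i" "a \<in> D j" by auto
  have "(2::real) ^ Suc i \<le> 2 ^ j" using ij by (intro power_increasing) auto
  hence "B * 2 ^ Suc i \<le> B * 2 ^ j" using B_pos by (intro mult_left_mono) auto
  thus False using D_range[OF a(1)] D_range[OF a(2)] by linarith
qed

lemma prod_sqrt_cos_le_tailQ:
  assumes "finite E" "\<And>i. i < J \<Longrightarrow> D i \<subseteq> E"
  shows "(\<Prod>a\<in>E. sqrt \<bar>cos (pi * (real a * (real_of_int h / M)))\<bar>) \<le> tailQ 0 h"
proof -
  define f where "f a = sqrt \<bar>cos (pi * (real a * (real_of_int h / M)))\<bar>" for a
  define U where "U = (\<Union>i\<in>{0..<J}. D i)"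
  have U: "U \<subseteq> E" using assms(2) by (fastforce simp: U_def)
  have "(\<Prod>a\<in>E. f a) = (\<Prod>a\<in>E - U. f a) * (\<Prod>a\<in>U. f a)"
    using assms U by (intro prod.subset_diff)
  also have "\<dots> \<le> 1 * (\<Prod>a\<in>U. f a)"
    by (intro mult_right_mono prod_le_1 prod_nonneg) (auto simp: f_def)
  also have "(\<Prod>a\<in>U. f a) = (\<Prod>i\<in>{0..<J}. \<Prod>a\<in>D i. f a)" unfolding U_def
    using fin_D D_disjoint by (intro prod.UNION_disjoint) (auto, metis disjoint_iff linorder_neqE_nat)
  also have "\<dots> = tailQ 0 h" by (simp add: tailQ_def Q_def f_def)
  finally show ?thesis by (simp add: f_def)
qed

text \<open>If no subset has sum \<open>n\<close>, orthogonality makes the sum of \<open>f\<close>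
  over all sample points vanish. But the major arc contributes at least
  \<open>M * \<eta> / 4\<close>, and the rest is bounded by \<open>W \<le> M / Z\<close> times the
  left side of \<open>small\<close>, which is less.\<close>

lemma subset_sum_exists:
  fixes E :: "nat set" and n :: nat and V Gm Z :: real
  assumes E: "finite E" "\<And>i. i < J \<Longrightarrow> D i \<subseteq> E" "\<And>a. a \<in> E \<Longrightarrow> real a \<le> Z"
    and Z: "Z = B * 2 ^ J"
    and V: "V \<ge> 4" "(\<Sum>a\<in>E. (real a)\<^sup>2) \<le> V * Z\<^sup>2"
    and n: "\<bar>real (\<Sum>E) / 2 - real n\<bar> \<le> Z"
    and mid: "\<And>\<theta>. 1 / (4 * B) \<le> \<theta> \<Longrightarrow> \<theta> \<le> 1 / 2 \<Longrightarrow> (\<Prod>a\<in>E. sqrt \<bar>cos (pi * (real a * \<theta>))\<bar>) \<le> Gm"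
    and small: "2 * (\<Sum>i<J. w i) + Gm * (4 * B + 3) < 1 / (16 * sqrt V)" and Gm: "Gm \<ge> 0"
    and M: "even M" "\<Sum>E < M" "n < M" "real M \<ge> 4 * Z"
  shows "\<exists>T\<subseteq>E. \<Sum>T = n"
proof (rule ccontr)
  assume none: "\<not> (\<exists>T\<subseteq>E. \<Sum>T = n)"
  have Xp: "Z > 0" using B_pos Z by simp
  define \<sigma> where "\<sigma> = \<Sum>E"
  define th where "th h = real_of_int h / M" for h
  define R where "R = {- int (M div 2)..<- int (M div 2) + int M}"
  define P where "P h = (\<Prod>a\<in>E. cos (pi * (real a * th h)))" for h
  \<comment> \<open>The product of cosines centres the subset sums at half of the total
    \<open>\<sigma>\<close>; this phase moves the centre to \<open>n\<close>.\<close>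
  define f where "f h = P h * cos (pi * th h * (real \<sigma> - 2 * real n))" for h
  define PS where "PS h = (\<Prod>a\<in>E. sqrt \<bar>cos (pi * (real a * th h))\<bar>)" for h
  have thR: "\<bar>th h\<bar> \<le> 1 / 2" if "h \<in> R" for h
  proof -
    obtain m where m: "M = 2 * m" using M(1) by auto
    have "\<bar>real_of_int h\<bar> \<le> real m" using that unfolding R_def m by auto
    thus ?thesis using M_pos m by (simp add: th_def field_simps)
  qed
  have sum0: "(\<Sum>h\<in>R. f h) = 0"
  proof -
    have "2 ^ card E * f h = (\<Sum>T\<in>Pow E. cos (2 * pi * th h * real_of_int (int (\<Sum>T) - int n)))" for h
    proof -
      have "2 ^ card E * f h = (\<Prod>a\<in>E. 2 * cos (pi * real a * th h)) *
          cos (- (2 * pi * th h * real n) + pi * th h * real (\<Sum>E))"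
        by (simp add: f_def P_def prod.distrib \<sigma>_def algebra_simps)
      also have "\<dots> = (\<Sum>T\<in>Pow E. cos (- (2 * pi * th h * real n) + 2 * pi * th h * real (\<Sum>T)))"
        by (rule prod_cos_sum_subsets[OF E(1)])
      also have "\<dots> = (\<Sum>T\<in>Pow E. cos (2 * pi * th h * real_of_int (int (\<Sum>T) - int n)))"
        by (intro sum.cong refl arg_cong[of _ _ cos]) (simp add: algebra_simps)
      finally show ?thesis .
    qed
    hence "2 ^ card E * (\<Sum>h\<in>R. f h) = (\<Sum>h\<in>R. \<Sum>T\<in>Pow E. cos (2 * pi * th h * real_of_int (int (\<Sum>T) - int n)))"
      by (simp add: sum_distrib_left)
    also have "\<dots> = (\<Sum>T\<in>Pow E. \<Sum>h\<in>R. cos (2 * pi * th h * real_of_int (int (\<Sum>T) - int n)))"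
      by (rule sum.swap)
    also have "\<dots> = 0"
    proof (rule sum.neutral, rule ballI)
      fix T assume T: "T \<in> Pow E"
      have "\<Sum>T \<le> \<Sum>E" using T E(1) by (intro sum_mono2) auto
      hence lt: "\<Sum>T < M" using M by linarith
      have ne: "\<Sum>T \<noteq> n" using none T by auto
      define s where "s = \<Sum>T"
      have "\<not> int M dvd int s - int n"
      proof
        assume "int M dvd int s - int n"
        moreover have "int s - int n \<noteq> 0" using ne by (simp add: s_def[symmetric])
        ultimately have "\<bar>int M\<bar> \<le> \<bar>int s - int n\<bar>" by (intro dvd_imp_le_int)
        thus False using lt M(3) unfolding s_def[symmetric] by linarith
      qed
      thus "(\<Sum>h\<in>R. cos (2 * pi * th h * real_of_int (int (\<Sum>T) - int n))) = 0"
        unfolding th_def R_def s_def[symmetric] by (rule sum_cos_period_eq_0[OF _ M_pos])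
    qed
    finally show ?thesis by simp
  qed
  have PS: "\<bar>P h\<bar> = PS h * PS h" for h
    by (simp add: P_def PS_def abs_prod flip: prod.distrib)
  have PS1: "0 \<le> PS h" "PS h \<le> 1" for h unfolding PS_def by (intro prod_nonneg prod_le_1; simp)+
  have PSQ: "PS h \<le> tailQ 0 h" for h
    unfolding PS_def th_def by (rule prod_sqrt_cos_le_tailQ[OF E(1,2)])
  have fP: "\<bar>f h\<bar> \<le> \<bar>P h\<bar>" for h
    unfolding f_def abs_mult using abs_cos_le_one by (intro mult_left_le) auto
  have fQ: "\<bar>f h\<bar> \<le> tailQ 0 h" for h
    using fP[of h] PS[of h] PS1[of h] PSQ[of h] mult_left_le[of "PS h" "PS h"] by linarith
  (* R0 is the major arc and gives a positive main term, R1 is treated block by block, R2 by Gm. *)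
  define R0 where "R0 = {h\<in>R. \<bar>th h\<bar> \<le> len J}"
  define R1 where "R1 = {h\<in>R. len J < \<bar>th h\<bar> \<and> \<bar>th h\<bar> \<le> len 0}"
  define R2 where "R2 = {h\<in>R. len J < \<bar>th h\<bar> \<and> len 0 < \<bar>th h\<bar>}"
  have RR: "R = R0 \<union> (R1 \<union> R2)" and dis: "R0 \<inter> (R1 \<union> R2) = {}" "R1 \<inter> R2 = {}"
  proof -
    have "len J \<le> len 0" using B_pos by (simp add: len_def field_simps)
    thus "R = R0 \<union> (R1 \<union> R2)" by (auto simp: R0_def R1_def R2_def)
  qed (auto simp: R0_def R1_def R2_def)
  have finR: "finite R" "finite R0" "finite R1" "finite R2" proof -
    show "finite R" by (simp add: R_def)
    thus "finite R0" "finite R1" "finite R2" by (auto simp: R0_def R1_def R2_def)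
  qed
  have sR: "(\<Sum>h\<in>R. f h) = (\<Sum>h\<in>R0. f h) + ((\<Sum>h\<in>R1. f h) + (\<Sum>h\<in>R2. f h))"
    by (subst RR) (use finR dis in \<open>simp add: sum.union_disjoint\<close>)
  have b1: "\<bar>\<Sum>h\<in>R1. f h\<bar> \<le> (\<Sum>i<J. 2 * w i * W)"
  proof -
    have "\<bar>\<Sum>h\<in>R1. f h\<bar> \<le> (\<Sum>h\<in>R1. \<bar>f h\<bar>)" by (rule sum_abs)
    also have "\<dots> \<le> (\<Sum>h\<in>R1. tailQ 0 h)" by (intro sum_mono fQ)
    also have "\<dots> \<le> (\<Sum>h | len J < \<bar>real_of_int h / M\<bar> \<and> \<bar>real_of_int h / M\<bar> \<le> len 0. tailQ 0 h)"
      by (rule sum_mono2[OF finite_subset[OF _ finite_abs_le[of "len 0"]]])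
         (auto simp: R1_def th_def intro: tailQ_nonneg)
    also have "\<dots> \<le> (\<Sum>j\<in>{0..<J}. 2 * w j * W)" by (rule sum_tailQ_centre) simp
    finally show ?thesis by (simp add: atLeast0LessThan)
  qed
  have b2: "\<bar>\<Sum>h\<in>R2. f h\<bar> \<le> Gm * ((4 * B + 3) * W)"
  proof -
    have "\<bar>\<Sum>h\<in>R2. f h\<bar> \<le> (\<Sum>h\<in>R2. \<bar>f h\<bar>)" by (rule sum_abs)
    also have "\<dots> \<le> (\<Sum>h\<in>R2. Gm * tailQ 0 h)"
    proof (rule sum_mono)
      fix h assume h: "h \<in> R2"
      have "PS h = (\<Prod>a\<in>E. sqrt \<bar>cos (pi * (real a * \<bar>th h\<bar>))\<bar>)"
        unfolding PS_def abs_cos_pi_dist_int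
        by (intro prod.cong refl) (cases "th h \<ge> 0"; simp add: dist_int_minus)
      also have "\<dots> \<le> Gm" using h thR[of h] by (intro mid) (auto simp: R2_def len_def)
      finally have "PS h \<le> Gm" .
      hence "PS h * PS h \<le> Gm * tailQ 0 h" using PSQ PS1 Gm by (intro mult_mono) auto
      thus "\<bar>f h\<bar> \<le> Gm * tailQ 0 h" using fP[of h] PS[of h] by linarith
    qed
    also have "\<dots> = Gm * (\<Sum>h\<in>R2. tailQ 0 h)" by (simp add: sum_distrib_left)
    also have "\<dots> \<le> Gm * ((4 * B + 3) * W)"
      using thR by (intro mult_left_mono[OF _ Gm] sum_tailQ_total) (auto simp: R2_def th_def)
    finally show ?thesis .
  qed
  \<comment> \<open>Chosen so that \<open>8 * \<eta>\<^sup>2 * (V * Z\<^sup>2) = 1 / 2\<close>; the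
    product of cosines is then at least 1/2 on \<open>\<bar>th h\<bar> \<le> \<eta>\<close>.\<close>
  define \<eta> where "\<eta> = 1 / (4 * sqrt V * Z)"
  have sV: "sqrt V \<ge> 2" using V(1) real_le_rsqrt[of 2 V] by simp
  have \<eta>: "0 < \<eta>" "\<eta> \<le> len J"
  proof -
    have "4 * 1 * Z \<le> 4 * sqrt V * Z" using sV Xp V(1) by (intro mult_right_mono mult_left_mono) auto
    hence "\<eta> \<le> 1 / (4 * 1 * Z)" using Xp unfolding \<eta>_def by (intro frac_le) auto
    thus "\<eta> \<le> len J" by (simp add: len_def Z)
    show "0 < \<eta>" using V(1) Xp by (auto simp: \<eta>_def intro!: divide_pos_pos mult_pos_pos)
  qed
  have cos_phase: "cos (pi * th h * (real \<sigma> - 2 * real n)) \<ge> cos (2 * pi * c * Z)"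
    if "\<bar>th h\<bar> \<le> c" "c \<le> len J" for h c
  proof -
    have "real \<sigma> - 2 * real n = 2 * (real \<sigma> / 2 - real n)" by simp
    hence "\<bar>pi * th h * (real \<sigma> - 2 * real n)\<bar> = pi * \<bar>th h\<bar> * (2 * \<bar>real \<sigma> / 2 - real n\<bar>)"
      by (simp only: abs_mult) simp
    also have "\<dots> \<le> pi * c * (2 * Z)" using that n \<open>Z > 0\<close> unfolding \<sigma>_def by (intro mult_mono) auto
    finally have le: "\<bar>pi * th h * (real \<sigma> - 2 * real n)\<bar> \<le> 2 * pi * c * Z" by simp
    have "c * Z \<le> len J * Z" using that(2) Xp by (intro mult_right_mono) auto
    also have "\<dots> = 1 / 4" using B_pos by (simp add: Z len_def)
    finally have "pi * (c * Z) \<le> pi * (1 / 4)" by (intro mult_left_mono) auto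
    hence "2 * pi * c * Z \<le> pi" using pi_gt_zero by (simp add: mult.assoc)
    hence "cos (2 * pi * c * Z) \<le> cos \<bar>pi * th h * (real \<sigma> - 2 * real n)\<bar>"
      by (intro cos_monotone_0_pi_le le) auto
    thus ?thesis by simp
  qed
  have cosE: "0 \<le> cos (pi * (real a * th h))" if "a \<in> E" "\<bar>th h\<bar> \<le> len J" for a h
  proof -
    have "\<bar>real a * th h\<bar> \<le> Z * len J" unfolding abs_mult using that E(3)[OF that(1)] by (intro mult_mono) auto
    also have "\<dots> = 1 / 4" using B_pos by (simp add: Z len_def)
    finally have "pi * \<bar>real a * th h\<bar> \<le> pi * (1 / 4)" by (intro mult_left_mono) auto
    hence "\<bar>pi * (real a * th h)\<bar> \<le> pi / 2" by (simp add: abs_mult)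
    thus ?thesis unfolding abs_le_iff by (intro cos_ge_zero) linarith+
  qed
  have f0: "0 \<le> f h" if "h \<in> R0" for h
  proof -
    have h: "\<bar>th h\<bar> \<le> len J" using that by (simp add: R0_def)
    have "cos (2 * pi * len J * Z) = 0" using B_pos by (simp add: Z len_def)
    hence "0 \<le> cos (pi * th h * (real \<sigma> - 2 * real n))" using cos_phase[OF h] by simp
    moreover have "0 \<le> P h" unfolding P_def using cosE h by (intro prod_nonneg) auto
    ultimately show ?thesis by (simp add: f_def)
  qed
  have f1: "1 / 4 \<le> f h" if h: "\<bar>th h\<bar> \<le> \<eta>" for h
  proof -
    have hJ: "\<bar>th h\<bar> \<le> len J" using h \<eta> by linarith
    have x: "(pi * (real a * th h))\<^sup>2 / 2 \<le> 8 * \<eta>\<^sup>2 * (real a)\<^sup>2" for a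
    proof -
      have "\<bar>th h\<bar>\<^sup>2 \<le> \<eta>\<^sup>2" using h by (intro power_mono) auto
      hence th2: "(th h)\<^sup>2 \<le> \<eta>\<^sup>2" by simp
      have "(pi * (real a * th h))\<^sup>2 = pi\<^sup>2 * (th h)\<^sup>2 * (real a)\<^sup>2" by (simp add: power_mult_distrib)
      also have "\<dots> \<le> 4\<^sup>2 * \<eta>\<^sup>2 * (real a)\<^sup>2"
      proof -
        have "pi\<^sup>2 \<le> 4\<^sup>2" using pi_less_4 by (intro power_mono) auto
        thus ?thesis using th2 by (intro mult_right_mono mult_mono) auto
      qed
      finally show ?thesis by simp
    qed
    have tot: "(\<Sum>a\<in>E. 8 * \<eta>\<^sup>2 * (real a)\<^sup>2) \<le> 1 / 2"
    proof -
      have "(\<Sum>a\<in>E. 8 * \<eta>\<^sup>2 * (real a)\<^sup>2) = 8 * \<eta>\<^sup>2 * (\<Sum>a\<in>E. (real a)\<^sup>2)" by (simp add: sum_distrib_left)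
      also have "\<dots> \<le> 8 * \<eta>\<^sup>2 * (V * Z\<^sup>2)" using V(2) by (intro mult_left_mono) auto
      also have "\<dots> = 1 / 2" using V(1) Xp by (simp add: \<eta>_def power_mult_distrib power_divide)
      finally show ?thesis .
    qed
    have each: "8 * \<eta>\<^sup>2 * (real a)\<^sup>2 \<le> 1 / 2" if "a \<in> E" for a
      using member_le_sum[of a E "\<lambda>a. 8 * \<eta>\<^sup>2 * (real a)\<^sup>2"] that E(1) tot by auto
    have "1 / 2 \<le> 1 - (\<Sum>a\<in>E. 8 * \<eta>\<^sup>2 * (real a)\<^sup>2)" using tot by simp
    also have "\<dots> \<le> (\<Prod>a\<in>E. 1 - 8 * \<eta>\<^sup>2 * (real a)\<^sup>2)"
      using each by (intro one_minus_sum_le_prod E(1)) force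
    also have "\<dots> \<le> P h" unfolding P_def
    proof (intro prod_mono conjI)
      fix a assume a: "a \<in> E"
      show "0 \<le> 1 - 8 * \<eta>\<^sup>2 * (real a)\<^sup>2" using each[OF a] by simp
      show "1 - 8 * \<eta>\<^sup>2 * (real a)\<^sup>2 \<le> cos (pi * (real a * th h))"
        using x[of a] cos_ge_1_minus_square[of "pi * (real a * th h)"] by linarith
    qed
    finally have P: "1 / 2 \<le> P h" .
    have "cos (2 * pi * \<eta> * Z) \<ge> cos (pi / 3)"
    proof (rule cos_monotone_0_pi_le)
      show "0 \<le> 2 * pi * \<eta> * Z" using \<eta> Xp by simp
      have "\<eta> * Z = 1 / (4 * sqrt V)" using Xp by (simp add: \<eta>_def)
      also have "\<dots> \<le> 1 / 8" using sV by (intro frac_le) auto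
      finally have "pi * (\<eta> * Z) \<le> pi * (1 / 8)" by (intro mult_left_mono) auto
      thus "2 * pi * \<eta> * Z \<le> pi / 3" using pi_gt_zero by (simp add: mult.assoc)
    qed auto
    hence "1 / 2 \<le> cos (pi * th h * (real \<sigma> - 2 * real n))"
      using cos_phase[OF h \<eta>(2)] by (simp add: cos_60)
    hence "1 / 2 * (1 / 2) \<le> f h" unfolding f_def using P by (intro mult_mono) auto
    thus ?thesis by simp
  qed
  have b0: "(\<Sum>h\<in>R0. f h) \<ge> M * \<eta> / 4"
  proof -
    define q where "q = \<lfloor>M * \<eta>\<rfloor>"
    have q0: "0 \<le> q" using \<eta> by (simp add: q_def)
    have qM: "real_of_int q \<le> M * \<eta>" "M * \<eta> < real_of_int q + 1" by (auto simp: q_def)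
    \<comment> \<open>Keeps \<open>{-q..q}\<close> inside \<open>R\<close>, whose last element is
      \<open>M div 2 - 1\<close>. Both \<open>\<eta>\<close> and \<open>1 / M\<close> are at most
      \<open>1 / (4 * Z)\<close>, and \<open>Z \<ge> 1\<close>.\<close>
    have eta4: "\<eta> \<le> 1 / 2 - 1 / M"
    proof -
      have "\<eta> \<le> 1 / 4 / Z" using \<eta>(2) by (simp add: len_def Z)
      moreover have "1 / M \<le> 1 / 4 / Z" using M(4) Xp M_pos by (simp add: field_simps)
      ultimately have "\<eta> + 1 / M \<le> 1 / 2 / Z" by (simp add: field_simps)
      moreover have "Z \<ge> 1"
      proof (cases "E = {} \<or> (\<forall>a\<in>E. a = 0)")
        case True
        hence "\<Sum>E = 0" by auto
        hence "real n \<le> Z" using n by simp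
        moreover have "n \<noteq> 0" using none by (metis empty_subsetI sum.empty)
        ultimately show ?thesis by simp
      next
        case False
        then obtain a where "a \<in> E" "a \<ge> 1" by (auto simp: Suc_le_eq)
        thus ?thesis using E(3)[of a] by simp
      qed
      ultimately show ?thesis using Xp by (smt (verit) divide_le_eq divide_nonneg_pos mult_le_cancel_left1 le_divide_eq_1)
    qed
    have sub: "{-q..q} \<subseteq> R0" "\<And>h. h \<in> {-q..q} \<Longrightarrow> \<bar>th h\<bar> \<le> \<eta>"
    proof -
      show th: "\<bar>th h\<bar> \<le> \<eta>" if "h \<in> {-q..q}" for h
      proof -
        have "\<bar>real_of_int h\<bar> \<le> M * \<eta>" using that qM by auto
        thus ?thesis using M_pos by (simp add: th_def field_simps)
      qed
      show "{-q..q} \<subseteq> R0"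
      proof
        fix h assume h: "h \<in> {-q..q}"
        obtain m where m: "M = 2 * m" using M(1) by auto
        have "real_of_int q \<le> M * (1 / 2 - 1 / M)"
          using qM(1) mult_left_mono[OF eta4, of "real M"] by linarith
        also have "\<dots> = real m - 1" using M_pos m by (simp add: field_simps)
        finally have "q \<le> int m - 1" by linarith
        hence "h \<in> R" using h unfolding R_def m by auto
        thus "h \<in> R0" using th[OF h] \<eta> by (simp add: R0_def)
      qed
    qed
    \<comment> \<open>There are \<open>2 * q + 1 \<ge> q + 1 > M * \<eta>\<close> such
      points.\<close>
    have "M * \<eta> / 4 \<le> (\<Sum>h\<in>{-q..q}. 1 / 4)" using qM q0 by simp
    also have "\<dots> \<le> (\<Sum>h\<in>{-q..q}. f h)" by (intro sum_mono f1 sub(2))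
    also have "\<dots> \<le> (\<Sum>h\<in>R0. f h)" using f0 by (intro sum_mono2 finR sub(1)) auto
    finally show ?thesis .
  qed
  define \<omega> where "\<omega> = (\<Sum>i<J. w i)"
  have "2 * \<omega> < 1 / 2"
  proof -
    have "0 \<le> Gm * (4 * B + 3)" using Gm B_pos by simp
    moreover have "1 / (16 * sqrt V) \<le> 1 / 32" using sV by (intro frac_le) auto
    ultimately show ?thesis using small by (simp add: \<omega>_def)
  qed
  have W: "W \<le> M / Z"
  proof -
    have "(\<Prod>i<J. 1 + 2 * w i) \<le> (\<Prod>i<J. exp (2 * w i))"
      using w_nonneg by (intro prod_mono conjI exp_ge_add_one_self) (auto intro: add_nonneg_nonneg)
    also have "\<dots> = exp (2 * \<omega>)" by (simp add: exp_sum \<omega>_def sum_distrib_left)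
    also have "\<dots> \<le> exp (1/2)" using \<open>2 * \<omega> < 1 / 2\<close> by simp
    also have "\<dots> \<le> 2" using exp_half_le2 by simp
    finally have "W \<le> 2 * (M * len J + 1)" unfolding W_def using len_pos[of J] by (intro mult_right_mono) auto
    also have "\<dots> = M / Z / 2 + 2" by (simp add: len_def Z)
    also have "\<dots> \<le> M / Z" using M(4) Xp by (simp add: field_simps)
    finally show ?thesis .
  qed
  have "M * \<eta> / 4 \<le> 2 * \<omega> * W + Gm * (4 * B + 3) * W"
  proof -
    have "(\<Sum>i<J. 2 * w i * W) = 2 * \<omega> * W"
      by (simp add: \<omega>_def sum_distrib_left sum_distrib_right mult.assoc)
    thus ?thesis using b0 b1 b2 sum0 sR by (simp only: mult.assoc)
  qed
  also have "\<dots> = (2 * \<omega> + Gm * (4 * B + 3)) * W" by (simp add: algebra_simps)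
  also have "\<dots> \<le> (2 * \<omega> + Gm * (4 * B + 3)) * (M / Z)"
    using W w_nonneg Gm B_pos by (intro mult_left_mono) (auto simp: \<omega>_def intro!: add_nonneg_nonneg sum_nonneg)
  also have "\<dots> < 1 / (16 * sqrt V) * (M / Z)"
    using small M_pos Xp by (intro mult_strict_right_mono) (auto simp: \<omega>_def)
  also have "\<dots> = M * \<eta> / 4" by (simp add: \<eta>_def)
  finally show False by simp
qed

end

section \<open>Subset sums of dense sequences\<close>

text \<open>A factor \<open>1 / L\<^sup>2\<close> is taken out of every term, and the remaining
  inverse squares telescope to at most 1.\<close>

lemma sum_inverse_pow4_le:
  fixes L :: real
  assumes "L \<ge> 2"
  shows "(\<Sum>i<J. 1 / (L + real i) ^ 4) \<le> 1 / L\<^sup>2"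
proof -
  have "(\<Sum>i<J. 1 / (L + real i)\<^sup>2) \<le> 1 / (L - 1) - 1 / (L + real J - 1)" for J
  proof (induction J)
    case (Suc J)
    define y where "y = L + real J"
    have y: "y \<ge> 2" using assms by (simp add: y_def)
    have "y * (y - 1) \<le> y\<^sup>2" using y by (simp add: power2_eq_square algebra_simps)
    hence "1 / y\<^sup>2 \<le> 1 / (y * (y - 1))" using y by (intro frac_le) auto
    also have "\<dots> = 1 / (y - 1) - 1 / y" using y by (simp add: field_simps)
    finally show ?case using Suc by (simp add: y_def algebra_simps)
  qed simp
  moreover have "0 \<le> 1 / (L + real J - 1)" "1 / (L - 1) \<le> 1"
    using assms by (auto simp: field_simps)
  ultimately have "(\<Sum>i<J. 1 / (L + real i)\<^sup>2) \<le> 1" by (meson diff_left_mono dual_order.trans diff_ge_0_iff_ge le_diff_eq add_increasing2 diff_le_eq)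
  hence "1 / L\<^sup>2 * (\<Sum>i<J. 1 / (L + real i)\<^sup>2) \<le> 1 / L\<^sup>2 * 1" by (intro mult_left_mono) auto
  moreover have "(\<Sum>i<J. 1 / (L + real i) ^ 4) \<le> 1 / L\<^sup>2 * (\<Sum>i<J. 1 / (L + real i)\<^sup>2)"
    unfolding sum_distrib_left
  proof (rule sum_mono)
    fix i
    have "L\<^sup>2 * (L + real i)\<^sup>2 \<le> (L + real i)\<^sup>2 * (L + real i)\<^sup>2" using assms by (intro mult_right_mono power_mono) auto
    also have "\<dots> = (L + real i) ^ 4" by (simp flip: power_add)
    finally have "1 / (L + real i) ^ 4 \<le> 1 / (L\<^sup>2 * (L + real i)\<^sup>2)" using assms by (intro frac_le) auto
    thus "1 / (L + real i) ^ 4 \<le> 1 / L\<^sup>2 * (1 / (L + real i)\<^sup>2)" by simp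
  qed
  ultimately show ?thesis by simp
qed

lemma ln2_bounds: "1 / 2 \<le> ln (2::real)" "ln (2::real) \<le> 1"
proof -
  show "ln (2::real) \<le> 1" using ln_le_minus_one[of 2] by simp
  have "exp (1 / 2 :: real) \<le> 2" by (rule exp_half_le2)
  thus "1 / 2 \<le> ln (2::real)" using ln_ge_iff[of 2 "1/2"] by simp
qed

text \<open>Absorbs the constant \<open>2 ^ 20\<close> of the block sizes into \<open>L\<close>.
  With \<open>L = 2 ^ 40 * z\<close> it follows from
  \<open>log 2 z \<le> 2 * (z - 1)\<close>.\<close>

lemma log2_le:
  fixes L :: real
  assumes "L \<ge> 2 ^ 40"
  shows "2 ^ 20 * log 2 L + 1 \<le> L"
proof -
  define z where "z = L / 2 ^ 40"
  have z: "z \<ge> 1" using assms by (simp add: z_def)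
  have "ln z \<le> z - 1" using z by (intro ln_le_minus_one) auto
  hence "log 2 z \<le> (z - 1) / ln 2" by (simp add: log_def divide_right_mono)
  also have "\<dots> \<le> (z - 1) / (1 / 2)" using z ln2_bounds by (intro divide_left_mono) auto
  finally have lz: "log 2 z \<le> 2 * (z - 1)" by simp
  have "log 2 L = log 2 (2 ^ 40 * z)" by (simp add: z_def)
  also have "\<dots> = log 2 (2 ^ 40) + log 2 z" by (subst log_mult) (use z in auto)
  also have "log 2 (2 ^ 40 :: real) = 40" using log_pow_cancel[of 2 40] by simp
  finally have "log 2 L \<le> 38 + 2 * z" using lz by simp
  hence "2 ^ 20 * log 2 L + 1 \<le> 2 ^ 20 * (38 + 2 * z) + 1" by simp
  also have "\<dots> \<le> 2 ^ 40 * z" using z by simp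
  also have "\<dots> = L" by (simp add: z_def)
  finally show ?thesis .
qed

lemma log2_ge_of_power_le: "2 ^ k \<le> B \<Longrightarrow> real k \<le> log 2 B"
proof -
  assume "2 ^ k \<le> B"
  hence "log 2 (2 ^ k) \<le> log 2 B" by (subst log_le_cancel_iff) (auto intro: less_le_trans[of 0 "2 ^ k"])
  thus ?thesis by simp
qed

lemma subset_sums_extend:
  fixes A :: "nat set" and Y lo :: real
  assumes Y: "Y > 0" and lo: "lo \<ge> 0"
    and two: "\<And>x. x \<ge> Y \<Longrightarrow> card {a\<in>A. x < real a \<and> real a \<le> 2 * x} \<ge> 2"
    and base: "\<And>n. lo \<le> real n \<Longrightarrow> real n \<le> lo + 2 * Y \<Longrightarrow> \<exists>T\<subseteq>A. (\<forall>a\<in>T. real a \<le> Y) \<and> finite T \<and> \<Sum>T = n"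
    and n: "lo \<le> real n"
  shows "\<exists>T\<subseteq>A. finite T \<and> \<Sum>T = n"
proof -
  have step: "\<exists>T\<subseteq>A. (\<forall>a\<in>T. real a \<le> Y * 2 ^ k) \<and> finite T \<and> \<Sum>T = n"
    if "lo \<le> real n" "real n \<le> lo + 2 * (Y * 2 ^ k)" for n k
    using that
  proof (induction k arbitrary: n)
    case 0
    thus ?case using base[of n] by simp
  next
    case (Suc k)
    define Z where "Z = Y * 2 ^ k"
    have Z: "Z \<ge> Y" "Y * 2 ^ Suc k = 2 * Z" using Y by (auto simp: Z_def)
    define F where "F = {a\<in>A. Z < real a \<and> real a \<le> 2 * Z}"
    have "2 \<le> card F" unfolding F_def using two Z by simp
    then obtain F' where F': "F' \<subseteq> F" "card F' = 2" by (meson obtain_subset_with_card_n)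
    then obtain a b where ab: "a \<noteq> b" "a \<in> F" "b \<in> F" by (auto simp: card_2_iff)
    have IH: "\<exists>T\<subseteq>A. (\<forall>c\<in>T. real c \<le> Z) \<and> finite T \<and> \<Sum>T = m" if "lo \<le> real m" "real m \<le> lo + 2 * Z" for m
      using Suc.IH[of m] that unfolding Z_def by blast
    have r: "Z < real a" "real a \<le> 2 * Z" "Z < real b" "real b \<le> 2 * Z" "a \<in> A" "b \<in> A"
      using ab by (auto simp: F_def)
    consider "real n \<le> lo + 2 * Z" | "lo + 2 * Z < real n" "real n \<le> lo + 2 * Z + real a"
      | "lo + 2 * Z + real a < real n" by linarith
    thus ?case
    proof cases
      case 1
      then obtain T where "T \<subseteq> A" "\<forall>c\<in>T. real c \<le> Z" "finite T" "\<Sum>T = n" using IH[of n] Suc.prems by auto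
      thus ?thesis using Z Y by (intro exI[of _ T]) force
    next
      case 2
      have "a \<le> n" using 2 r lo by linarith
      obtain T where T: "T \<subseteq> A" "\<forall>c\<in>T. real c \<le> Z" "finite T" "\<Sum>T = n - a"
        using IH[of "n - a"] 2 r \<open>a \<le> n\<close> by (auto simp: of_nat_diff)
      have "a \<notin> T" using T r by force
      thus ?thesis using T r \<open>a \<le> n\<close> Z Y
        by (intro exI[of _ "insert a T"]) force
    next
      case 3
      have "a + b \<le> n" using 3 r lo by linarith
      obtain T where T: "T \<subseteq> A" "\<forall>c\<in>T. real c \<le> Z" "finite T" "\<Sum>T = n - (a + b)"
        using IH[of "n - (a + b)"] 3 r \<open>a + b \<le> n\<close> Suc.prems Z by (auto simp: of_nat_diff)
      have "a \<notin> T" "b \<notin> T" using T r by force+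
      thus ?thesis using T r \<open>a + b \<le> n\<close> Z Y ab
        by (intro exI[of _ "insert a (insert b T)"]) force
    qed
  qed
  obtain k :: nat where "real n / Y < 2 ^ k" using real_arch_pow[of 2 "real n / Y"] by auto
  hence "real n \<le> Y * 2 ^ k" using Y by (simp add: field_simps)
  hence "real n \<le> lo + 2 * (Y * 2 ^ k)" using lo Y by (smt (verit) zero_less_mult_iff zero_less_power)
  from step[OF n this] show ?thesis by blast
qed

text \<open>The circle method is run with all elements up to \<open>C\<close> and one block for each
  scale from \<open>B\<close> to \<open>Z\<close>. Taking \<open>Z\<close> of size
  \<open>C\<^sup>2\<close> ensures that the elements up to \<open>C\<close>, whatever their number,
  add at most \<open>Z\<^sup>2\<close> to the sum of squares. This covers a window of length
  \<open>2 * Z\<close> around half of the total, from which \<open>subset_sums_extend\<close>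
  continues.\<close>

theorem subset_sums_cover:
  fixes A :: "nat set" and B C :: real and n :: nat
  assumes B: "B \<ge> 2 ^ (2 ^ 40)"
    and dens: "\<And>x. x \<ge> B \<Longrightarrow> real (card {a\<in>A. x < real a \<and> real a \<le> 2 * x}) > 2 ^ 20 * log 2 (log 2 x)"
    and C: "C \<ge> B"
    and theta: "\<And>\<theta>. 1 / (4 * B) \<le> \<theta> \<Longrightarrow> \<theta> \<le> 1 - 1 / (4 * B) \<Longrightarrow>
       (\<Sum>a | a \<in> A \<and> real a \<le> C. (dist_int (real a * \<theta>))\<^sup>2) > 2 * log 2 B + 50"
    and n: "real n > C ^ 10"
  shows "\<exists>T\<subseteq>A. finite T \<and> \<Sum>T = n"
proof -
  define L where "L = log 2 B"
  have "real (2 ^ 40) \<le> L" unfolding L_def by (rule log2_ge_of_power_le[OF B])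
  hence L: "L \<ge> 2 ^ 40" by simp
  have "(1::real) \<le> 2 ^ (2 ^ 40)" by (rule one_le_power) simp
  hence B1: "B \<ge> 1" using B by (rule order_trans)
  have B2: "B = 2 powr L" using B1 by (simp add: L_def)
  have L1: "L \<ge> 1000" using L by simp
  have "(2::real) powr 2 \<le> 2 powr L" using L1 by (intro powr_mono) auto
  hence B4: "B \<ge> 4" by (simp add: B2)
  hence C4: "C \<ge> 4" using C by simp
  have expB: "B \<le> exp L"
  proof -
    have "B = exp (L * ln 2)" by (simp add: B2 powr_def)
    also have "\<dots> \<le> exp L" using L ln2_bounds by (simp add: mult_left_le)
    finally show ?thesis .
  qed
  obtain J0 :: nat where J0: "C\<^sup>2 / B < 2 ^ J0" using real_arch_pow[of 2 "C\<^sup>2 / B"] by auto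
  define J where "J = (LEAST j. C\<^sup>2 \<le> B * 2 ^ j)"
  have J: "C\<^sup>2 \<le> B * 2 ^ J" unfolding J_def
    by (rule LeastI[of _ J0]) (use J0 B4 in \<open>simp add: field_simps\<close>)
  have J_pos: "J > 0"
  proof (rule ccontr)
    assume "\<not> J > 0"
    hence "C\<^sup>2 \<le> B" using J by simp
    moreover have "C * 1 < C * C" using C4 by (intro mult_strict_left_mono) auto
    ultimately show False using C by (simp add: power2_eq_square)
  qed
  have "\<not> C\<^sup>2 \<le> B * 2 ^ (J - 1)" unfolding J_def
    by (rule not_less_Least) (use J_pos in \<open>simp add: J_def\<close>)
  moreover have "(2::real) ^ J = 2 * 2 ^ (J - 1)" using J_pos by (cases J) auto
  ultimately have J2: "B * 2 ^ J \<le> 2 * C\<^sup>2" by simp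
  define Z where "Z = B * 2 ^ J"
  have Z: "C\<^sup>2 \<le> Z" "Z \<le> 2 * C\<^sup>2" "Z > 0" "B \<le> Z"
    using J J2 B4 by (auto simp: Z_def mult_le_cancel_left1)
  have CC: "C \<le> C\<^sup>2" using C4 by (simp add: power2_eq_square mult_le_cancel_left1)
  hence CZ: "C \<le> Z" using Z by linarith
  define m where "m i = min (L + real i) (L + real (J - i))" for i
  have mL: "m i \<ge> L" for i by (simp add: m_def)
  (* Block sizes decrease again towards the top block: with k i growing up to i = J, the sum of the
     squares would contain log J, and the main term would be too small for large C. *)
  define k where "k i = nat \<lceil>2 ^ 20 * log 2 (m i)\<rceil>" for i
  have log_m: "40 \<le> log 2 (m i)" for i
  proof -
    have "log 2 (2 ^ 40) \<le> log 2 (m i)" using L mL[of i] by (subst log_le_cancel_iff) auto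
    moreover have "log 2 (2 ^ 40 :: real) = 40" using log_pow_cancel[of 2 40] by simp
    ultimately show ?thesis by simp
  qed
  have k_ge: "2 ^ 20 * log 2 (m i) \<le> real (k i)" for i unfolding k_def by linarith
  have k_le: "real (k i) \<le> 2 ^ 20 * log 2 (m i) + 1" for i
  proof -
    have "real (nat \<lceil>y\<rceil>) \<le> y + 1" if "0 \<le> y" for y :: real using that by linarith
    thus ?thesis unfolding k_def using log_m[of i] by simp
  qed
  define F where "F i = {a\<in>A. B * 2 ^ i < real a \<and> real a \<le> 2 * (B * 2 ^ i)}" for i
  have finF: "finite (F i)" for i
    by (rule finite_subset[of _ "{..nat \<lfloor>2 * (B * 2 ^ i)\<rfloor>}"]) (auto simp: F_def le_nat_floor)
  have "k i \<le> card (F i)" if "i < J" for i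
  proof -
    have "B \<le> B * 2 ^ i" using B4 by (simp add: mult_le_cancel_left1)
    hence "2 ^ 20 * log 2 (log 2 (B * 2 ^ i)) < real (card (F i))" unfolding F_def by (rule dens)
    moreover have "log 2 (B * 2 ^ i) = L + real i" using B4 by (simp add: L_def log_mult log_nat_power)
    moreover have "log 2 (m i) \<le> log 2 (L + real i)"
      using L mL[of i] by (subst log_le_cancel_iff) (auto simp: m_def)
    ultimately have "2 ^ 20 * log 2 (m i) < real (card (F i))" by simp
    thus ?thesis unfolding k_def by linarith
  qed
  hence "\<exists>D. D \<subseteq> F i \<and> card D = k i" if "i < J" for i using that by (meson obtain_subset_with_card_n)
  then obtain D0 where D0: "\<And>i. i < J \<Longrightarrow> D0 i \<subseteq> F i \<and> card (D0 i) = k i" by metis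
  define D where "D i = (if i < J then D0 i else {})" for i
  \<comment> \<open>The fourth power gives a sum of order \<open>1 / L\<^sup>2\<close>, well below
    the size \<open>1 / (16 * L)\<close> of the main term for \<open>V = L\<^sup>2\<close>.\<close>
  define w where "w i = 1 / m i ^ 4" for i
  define E where "E = {a\<in>A. real a \<le> C} \<union> (\<Union>i<J. D i)"
  have DF: "D i \<subseteq> F i" for i using D0 by (auto simp: D_def)
  have finC: "finite {a\<in>A. real a \<le> C}"
    by (rule finite_subset[of _ "{..nat \<lfloor>C\<rfloor>}"]) (auto simp: le_nat_floor)
  have finD: "finite (D i)" for i using finite_subset[OF DF finF] .
  have finE: "finite E" using finC finD by (auto simp: E_def)
  have EA: "E \<subseteq> A" using DF by (auto simp: E_def F_def)
  have EZ: "real a \<le> Z" if "a \<in> E" for a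
  proof -
    consider "real a \<le> C" | i where "i < J" "a \<in> D i" using \<open>a \<in> E\<close> by (auto simp: E_def)
    thus ?thesis
    proof cases
      case 1 thus ?thesis using CZ by simp
    next
      case 2
      hence "real a \<le> B * 2 ^ Suc i" using DF[of i] by (auto simp: F_def)
      also have "\<dots> \<le> B * 2 ^ J" using 2 B4 by (intro mult_left_mono power_increasing) auto
      finally show ?thesis by (simp add: Z_def)
    qed
  qed
  \<comment> \<open>The actual modulus depends on the target and comes later; the value 1 gives
    access to the facts that do not involve it.\<close>
  have blocks: "dyadic_blocks D B J w 1"
  proof
    show "B > 0" using B4 by simp
    show "(1::nat) > 0" by simp
    show "finite (D i)" for i by (rule finD)
    show "B * 2 ^ i < real a \<and> real a \<le> B * 2 ^ Suc i" if "a \<in> D i" for i a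
      using DF[of i] that by (auto simp: F_def)
    show "exp (- real (card (D i)) / 512) \<le> w i" if "i < J" for i
    proof -
      have c: "card (D i) = k i" using D0 \<open>i < J\<close> by (simp add: D_def)
      have mp: "m i > 0" using mL[of i] L1 by linarith
      have "4 * ln (m i) \<le> 2048 * log 2 (m i)"
      proof -
        have "ln (m i) = ln 2 * log 2 (m i)" by (simp add: log_def)
        also have "\<dots> \<le> 1 * log 2 (m i)" using log_m[of i] ln2_bounds by (intro mult_right_mono) auto
        finally show ?thesis using log_m[of i] by linarith
      qed
      also have "\<dots> \<le> real (card (D i)) / 512" using k_ge[of i] by (simp add: c)
      finally have "exp (- real (card (D i)) / 512) \<le> exp (- (4 * ln (m i)))" by simp
      also have "\<dots> = 1 / exp (real 4 * ln (m i))" by (simp add: exp_minus inverse_eq_divide)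
      also have "\<dots> = w i" unfolding exp_of_nat_mult w_def using mp by simp
      finally show ?thesis .
    qed
  qed
  have wsum: "(\<Sum>i<J. w i) \<le> 2 / L\<^sup>2"
  proof -
    have "(\<Sum>i<J. w i) \<le> (\<Sum>i<J. 1 / (L + real i) ^ 4 + 1 / (L + real (J - i)) ^ 4)"
    proof (rule sum_mono)
      fix i
      show "w i \<le> 1 / (L + real i) ^ 4 + 1 / (L + real (J - i)) ^ 4"
        using L by (auto simp: w_def m_def min_def)
    qed
    also have "\<dots> = (\<Sum>i<J. 1 / (L + real i) ^ 4) + (\<Sum>i<J. 1 / (L + real (J - i)) ^ 4)"
      by (rule sum.distrib)
    also have "(\<Sum>i<J. 1 / (L + real (J - i)) ^ 4) \<le> (\<Sum>i<J. 1 / (L + real (J - Suc i)) ^ 4)"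
      using L by (intro sum_mono frac_le power_mono) auto
    also have "\<dots> = (\<Sum>i<J. 1 / (L + real i) ^ 4)" by (rule sum.nat_diff_reindex)
    finally show ?thesis using sum_inverse_pow4_le[of L J] L by simp
  qed
  \<comment> \<open>The bound for half of the cosine product supplied by the condition on
    \<open>C\<close>. Since \<open>B \<le> exp L\<close>, its product with \<open>4 * B + 3\<close>
    is at most \<open>exp (- L)\<close>.\<close>
  define Gm where "Gm = exp (- (2 * L + 50))"
  have Gm: "Gm * (4 * B + 3) \<le> 4 / L\<^sup>2"
  proof -
    have "(1 + L / 2) ^ 2 \<le> (exp (L / 2)) ^ 2" using L exp_ge_add_one_self[of "L / 2"] by (intro power_mono) auto
    also have "\<dots> = exp L" using exp_double[of "L / 2"] by simp
    finally have eL: "L\<^sup>2 / 4 \<le> exp L" using L by (simp add: power2_eq_square field_simps)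
    have e50: "7 \<le> exp (50::real)" using exp_ge_add_one_self[of 50] by simp
    have "4 * B + 3 \<le> 7 * exp L" using expB B4 by linarith
    also have "\<dots> \<le> exp 50 * exp L" using e50 by (intro mult_right_mono) auto
    finally have "Gm * (4 * B + 3) \<le> Gm * (exp 50 * exp L)" by (intro mult_left_mono) (auto simp: Gm_def)
    also have "\<dots> = exp (- L)" by (simp add: Gm_def flip: exp_add)
    also have "\<dots> = 1 / exp L" by (simp add: exp_minus inverse_eq_divide)
    also have "\<dots> \<le> 1 / (L\<^sup>2 / 4)" using eL L by (intro divide_left_mono) auto
    finally show ?thesis by simp
  qed
  have small: "2 * (\<Sum>i<J. w i) + Gm * (4 * B + 3) < 1 / (16 * sqrt (L\<^sup>2))"
  proof -
    have "2 * (\<Sum>i<J. w i) + Gm * (4 * B + 3) \<le> 2 * (2 / L\<^sup>2) + 4 / L\<^sup>2"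
      using wsum Gm by linarith
    also have "\<dots> = 8 / (L * L)" by (simp add: power2_eq_square)
    also have "\<dots> < 1 / (16 * L)" using L by (simp add: field_simps)
    finally show ?thesis using L by simp
  qed
  have mid: "(\<Prod>a\<in>E. sqrt \<bar>cos (pi * (real a * \<theta>))\<bar>) \<le> Gm"
    if th: "1 / (4 * B) \<le> \<theta>" "\<theta> \<le> 1 / 2" for \<theta>
  proof -
    have "1 / (4 * B) \<le> 1 / 2" using B4 by (simp add: field_simps)
    hence "2 * L + 50 < (\<Sum>a | a \<in> A \<and> real a \<le> C. (dist_int (real a * \<theta>))\<^sup>2)"
      unfolding L_def using th by (intro theta) linarith+
    also have "\<dots> \<le> (\<Sum>a\<in>E. (dist_int (real a * \<theta>))\<^sup>2)"
      by (rule sum_mono2[OF finE]) (auto simp: E_def)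
    finally have s: "2 * L + 50 \<le> (\<Sum>a\<in>E. (dist_int (real a * \<theta>))\<^sup>2)" by simp
    have "(\<Prod>a\<in>E. sqrt \<bar>cos (pi * (real a * \<theta>))\<bar>) \<le> (\<Prod>a\<in>E. exp (- (dist_int (real a * \<theta>))\<^sup>2))"
      using dyadic_blocks.sqrt_abs_cos_le[OF blocks] by (intro prod_mono) auto
    also have "\<dots> = exp (- (\<Sum>a\<in>E. (dist_int (real a * \<theta>))\<^sup>2))"
      by (simp add: exp_sum[OF finE] flip: sum_negf)
    also have "\<dots> \<le> Gm" using s by (simp add: Gm_def)
    finally show ?thesis .
  qed
  have sq: "(\<Sum>a\<in>E. (real a)\<^sup>2) \<le> L\<^sup>2 * Z\<^sup>2"
  proof -
    have "(\<Sum>a\<in>E. (real a)\<^sup>2) \<le> (\<Sum>a | a\<in>A \<and> real a \<le> C. (real a)\<^sup>2) + (\<Sum>a\<in>(\<Union>i<J. D i). (real a)\<^sup>2)"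
      unfolding E_def using finC finD by (subst sum_Un) (auto intro!: sum_nonneg)
    also have "(\<Sum>a | a\<in>A \<and> real a \<le> C. (real a)\<^sup>2) \<le> Z\<^sup>2"
    proof -
      have "(\<Sum>a | a\<in>A \<and> real a \<le> C. (real a)\<^sup>2) \<le> (\<Sum>a | a\<in>A \<and> real a \<le> C. C\<^sup>2)"
        by (intro sum_mono power_mono) auto
      also have "\<dots> = real (card {a\<in>A. real a \<le> C}) * C\<^sup>2" by simp
      also have "\<dots> \<le> (C + 1) * C\<^sup>2"
      proof (rule mult_right_mono)
        have "card {a\<in>A. real a \<le> C} \<le> card {..nat \<lfloor>C\<rfloor>}"
          by (intro card_mono) (auto simp: le_nat_floor)
        also have "\<dots> = nat \<lfloor>C\<rfloor> + 1" by simp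
        finally show "real (card {a\<in>A. real a \<le> C}) \<le> C + 1" using C4 by linarith
      qed simp
      also have "\<dots> \<le> C\<^sup>2 * C\<^sup>2"
      proof (rule mult_right_mono)
        have "4 * C \<le> C * C" using C4 by (intro mult_right_mono) auto
        thus "C + 1 \<le> C\<^sup>2" unfolding power2_eq_square using C4 by linarith
      qed simp
      also have "\<dots> \<le> Z * Z" using Z C4 by (intro mult_mono) auto
      finally show ?thesis by (simp add: power2_eq_square)
    qed
    also have "(\<Sum>a\<in>(\<Union>i<J. D i). (real a)\<^sup>2) = (\<Sum>i<J. \<Sum>a\<in>D i. (real a)\<^sup>2)"
      using finD dyadic_blocks.D_disjoint[OF blocks]
      by (intro sum.UNION_disjoint) (auto, metis disjoint_iff linorder_neqE_nat)
    \<comment> \<open>With \<open>e = J - i\<close>, each square in block i is at most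
      \<open>4 * Z\<^sup>2 / 4 ^ e\<close> and there are at most \<open>L * 2 ^ e\<close> of them,
      which leaves a geometric series.\<close>
    also have "\<dots> \<le> (\<Sum>i<J. 4 * L * Z\<^sup>2 * (1 / 2) ^ (J - i))"
    proof (rule sum_mono)
      fix i assume i: "i \<in> {..<J}"
      define e where "e = J - i"
      have Ze: "Z = B * 2 ^ i * 2 ^ e" using i by (simp add: Z_def e_def flip: power_add)
      have "(\<Sum>a\<in>D i. (real a)\<^sup>2) \<le> (\<Sum>a\<in>D i. (2 * (B * 2 ^ i))\<^sup>2)"
        using DF[of i] by (intro sum_mono power_mono) (auto simp: F_def)
      also have "\<dots> = real (k i) * (2 * (B * 2 ^ i))\<^sup>2" using D0 i by (simp add: D_def)
      also have "\<dots> \<le> (L * 2 ^ e) * (2 * (B * 2 ^ i))\<^sup>2"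
      proof (rule mult_right_mono)
        have e1: "real e + 1 \<le> 2 ^ e"
        proof -
          have "e + 1 \<le> 2 ^ e" using Suc_leI[OF less_exp[of e]] by (simp only: Suc_eq_plus1)
          hence "real (e + 1) \<le> real (2 ^ e)" by (simp only: of_nat_le_iff)
          thus ?thesis by simp
        qed
        have "L + real e \<le> L * (real e + 1)" using L by (simp add: algebra_simps mult_le_cancel_right1)
        also have "\<dots> \<le> L * 2 ^ e" using e1 L by (intro mult_left_mono) auto
        finally have "log 2 (L + real e) \<le> log 2 (L * 2 ^ e)" using L by (subst log_le_cancel_iff) auto
        also have "\<dots> = log 2 L + real e" using L by (simp add: log_mult log_nat_power)
        finally have "log 2 (L + real e) \<le> log 2 L + real e" .
        moreover have "log 2 (m i) \<le> log 2 (L + real e)"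
          using L mL[of i] by (subst log_le_cancel_iff) (auto simp: m_def e_def)
        ultimately have "2 ^ 20 * log 2 (m i) \<le> 2 ^ 20 * (log 2 L + real e)" by (intro mult_left_mono) auto
        hence "real (k i) \<le> (2 ^ 20 * log 2 L + 1) + 2 ^ 20 * real e" using k_le[of i] by (simp add: distrib_left)
        also have "\<dots> \<le> L + L * real e"
        proof (rule add_mono[OF log2_le[OF L] mult_right_mono])
          show "2 ^ 20 \<le> L" using L by simp
        qed simp
        also have "\<dots> = L * (real e + 1)" by (simp add: algebra_simps)
        also have "\<dots> \<le> L * 2 ^ e" using e1 L by (intro mult_left_mono) auto
        finally show "real (k i) \<le> L * 2 ^ e" .
      qed simp
      also have "\<dots> = 4 * L * Z\<^sup>2 * (1 / 2) ^ e"
        by (simp add: Ze power2_eq_square power_one_over field_simps)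
      finally show "(\<Sum>a\<in>D i. (real a)\<^sup>2) \<le> 4 * L * Z\<^sup>2 * (1 / 2) ^ (J - i)" by (simp add: e_def)
    qed
    also have "\<dots> = 4 * L * Z\<^sup>2 * (\<Sum>i<J. (1 / 2) ^ (J - i))" by (simp add: sum_distrib_left)
    also have "4 * L * Z\<^sup>2 * (\<Sum>i<J. (1 / 2 :: real) ^ (J - i)) \<le> 4 * L * Z\<^sup>2 * 1"
    proof (rule mult_left_mono)
      have "(\<Sum>i<J. (1 / 2 :: real) ^ (J - i)) = (\<Sum>i<J. 1 / 2 * (1 / 2) ^ (J - Suc i))"
        by (intro sum.cong refl) (simp add: Suc_diff_Suc flip: power_Suc)
      also have "\<dots> = (\<Sum>i<J. 1 / 2 * (1 / 2) ^ i)" by (rule sum.nat_diff_reindex)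
      also have "\<dots> = 1 / 2 * (\<Sum>i<J. (1 / 2) ^ i)" by (simp add: sum_distrib_left)
      also have "(\<Sum>i<J. (1 / 2 :: real) ^ i) = 2 * (1 - (1 / 2) ^ J)" by (subst sum_gp_strict) auto
      finally show "(\<Sum>i<J. (1 / 2 :: real) ^ (J - i)) \<le> 1" by simp
    qed (use L1 in auto)
    finally have "(\<Sum>a\<in>E. (real a)\<^sup>2) \<le> Z\<^sup>2 + 4 * L * Z\<^sup>2 * 1" by simp
    also have "\<dots> = (1 + 4 * L) * Z\<^sup>2" by (simp add: algebra_simps)
    also have "\<dots> \<le> L\<^sup>2 * Z\<^sup>2"
    proof (rule mult_right_mono)
      have "5 * L \<le> L * L" using L by (intro mult_right_mono) auto
      thus "1 + 4 * L \<le> L\<^sup>2" unfolding power2_eq_square using L1 by linarith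
    qed simp
    finally show ?thesis .
  qed
  define lo where "lo = real (\<Sum>E) / 2 - Z"
  have E_le: "real (\<Sum>E) \<le> Z * (Z + 1)"
  proof -
    have "real (\<Sum>E) = (\<Sum>a\<in>E. real a)" by simp
    also have "\<dots> \<le> (\<Sum>a\<in>E. Z)" by (intro sum_mono EZ)
    also have "\<dots> = real (card E) * Z" by simp
    also have "\<dots> \<le> (Z + 1) * Z"
    proof (rule mult_right_mono)
      have "card E \<le> card {..nat \<lfloor>Z\<rfloor>}" using EZ by (intro card_mono) (auto simp: le_nat_floor)
      thus "real (card E) \<le> Z + 1" using Z by simp linarith
    qed (use Z in auto)
    finally show ?thesis by (simp add: mult.commute)
  qed
  \<comment> \<open>The top block alone has at least four elements above \<open>Z / 2\<close>, so
    the total is at least \<open>2 * Z\<close>.\<close>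
  have lo0: "lo \<ge> 0"
  proof -
    define j where "j = J - 1"
    have j: "j < J" "Z = 2 * (B * 2 ^ j)" using J_pos by (auto simp: j_def Z_def power_eq_if)
    have "4 * (Z / 2) \<le> real (k j) * (Z / 2)"
      using k_ge[of j] log_m[of j] Z by (intro mult_right_mono) auto
    also have "\<dots> = (\<Sum>a\<in>D j. Z / 2)" using D0[OF j(1)] j by (simp add: D_def)
    also have "\<dots> \<le> (\<Sum>a\<in>D j. real a)" using DF[of j] j by (intro sum_mono) (auto simp: F_def)
    also have "\<dots> \<le> (\<Sum>a\<in>E. real a)" using j by (intro sum_mono2 finE) (auto simp: E_def)
    finally show ?thesis by (simp add: lo_def)
  qed
  show ?thesis
  proof (rule subset_sums_extend[of Z lo])
    show "Z > 0" "lo \<ge> 0" using Z lo0 by auto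
    show "2 \<le> card {a\<in>A. x < real a \<and> real a \<le> 2 * x}" if x: "x \<ge> Z" for x
    proof -
      have xB: "x \<ge> B" using x Z by simp
      have "L \<le> log 2 x" unfolding L_def using xB B4 by (subst log_le_cancel_iff) auto
      hence "log 2 L \<le> log 2 (log 2 x)" using L by (subst log_le_cancel_iff) auto
      moreover have "1 \<le> log 2 L" using L by (simp add: le_log_iff)
      ultimately have "1 \<le> log 2 (log 2 x)" by linarith
      hence "2 ^ 20 * 1 \<le> 2 ^ 20 * log 2 (log 2 x)" by (intro mult_left_mono) auto
      hence "2 \<le> 2 ^ 20 * log 2 (log 2 x)" by simp
      hence "2 \<le> real (card {a\<in>A. x < real a \<and> real a \<le> 2 * x})" by (rule order_trans[OF _ less_imp_le[OF dens[OF xB]]])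
      thus ?thesis by linarith
    qed
    show "\<exists>T\<subseteq>A. (\<forall>a\<in>T. real a \<le> Z) \<and> finite T \<and> \<Sum>T = n'"
      if n': "lo \<le> real n'" "real n' \<le> lo + 2 * Z" for n'
    proof -
      define M where "M = 2 * (\<Sum>E + n' + nat \<lceil>4 * Z\<rceil> + 1)"
      have b': "dyadic_blocks D B J w M"
        using blocks by (simp add: dyadic_blocks_def M_def)
      have "\<exists>T\<subseteq>E. \<Sum>T = n'"
      proof (rule dyadic_blocks.subset_sum_exists[OF b' finE _ EZ Z_def _ sq _ mid small])
        show "D i \<subseteq> E" if "i < J" for i using that by (auto simp: E_def)
        show "\<bar>real (\<Sum>E) / 2 - real n'\<bar> \<le> Z" using n' unfolding lo_def by linarith
        show "4 \<le> L\<^sup>2" using power_mono[of 2 L 2] L by simp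
        show "even M" "\<Sum>E < M" "n' < M" by (auto simp: M_def)
        have "c \<le> 2 * (a + b + c + 1)" for a b c :: nat by simp
        hence "nat \<lceil>4 * Z\<rceil> \<le> M" unfolding M_def .
        thus "4 * Z \<le> real M" by linarith
        show "0 \<le> Gm" by (simp add: Gm_def)
      qed
      then obtain T where T: "T \<subseteq> E" "\<Sum>T = n'" by blast
      moreover have "finite T" using T(1) finE by (rule finite_subset)
      ultimately show ?thesis using EZ EA by blast
    qed
    show "lo \<le> real n"
    proof -
      have "lo \<le> Z * Z" using E_le Z mult_nonneg_nonneg[of Z Z] unfolding lo_def distrib_left by linarith
      also have "\<dots> \<le> (2 * C\<^sup>2) * (2 * C\<^sup>2)" using Z by (intro mult_mono) auto
      also have "\<dots> = 4 * C ^ 4" by (simp flip: power_add)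
      also have "\<dots> \<le> C * C ^ 4" using C4 by (intro mult_right_mono) auto
      also have "\<dots> = C ^ 5" by (simp flip: power_Suc)
      also have "\<dots> \<le> C ^ 10" using C4 by (intro power_increasing) auto
      finally show ?thesis using n by simp
    qed
  qed
qed

section \<open>Products of powers of two coprime numbers\<close>

lemma coprime_power_mult_inj:
  fixes P Q :: nat
  assumes "coprime P Q" "P \<ge> 2" "Q \<ge> 2" "P ^ a * Q ^ b = P ^ a' * Q ^ b'"
  shows "a = a'" "b = b'"
proof -
  have less: False if "P ^ a * Q ^ b = P ^ a' * Q ^ b'" "a < a'" for a b a' b'
  proof -
    have "P ^ a' = P ^ a * P ^ (a' - a)" using that(2) by (simp flip: power_add)
    hence "Q ^ b = P ^ (a' - a) * Q ^ b'" using that(1) assms(2) by simp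
    hence "P dvd Q ^ b" using that(2) by (metis dvd_mult2 dvd_power zero_less_diff)
    moreover have "coprime P (Q ^ b)" using assms(1) by simp
    ultimately have "P dvd 1" by (meson coprime_common_divisor dvd_refl)
    thus False using assms(2) by simp
  qed
  show "a = a'" using less[of a b a' b'] less[of a' b' a b] assms(4) by (cases a a' rule: linorder_cases) auto
  with assms(2,3,4) show "b = b'" by simp
qed

lemma two_power_ge: "(Q::nat) \<le> 2 ^ Q"
  using less_exp[of Q] by simp

text \<open>Starting from \<open>Q ^ (b - c)\<close>, each step trades \<open>Q ^ v\<close> for
  \<open>P ^ u\<close>, a ratio greater than 1 and at most 2; so the first value above
  \<open>x\<close> is at most \<open>2 * x\<close>. The bound on \<open>c\<close> guarantees that
  enough factors \<open>Q\<close> are available for all steps.\<close>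

lemma coprime_powers_walk:
  fixes P Q u v b c :: nat and x :: real
  assumes PQ: "P \<ge> 2" "Q \<ge> 2" and v: "v \<ge> 1" and uv: "Q ^ v < P ^ u" "P ^ u \<le> 2 * Q ^ v"
    and x: "real (Q ^ b) \<le> x" "x < real (Q ^ Suc b)"
    and c: "(c + 1) * (v * Q ^ Suc v) + c \<le> b"
  shows "\<exists>s. s * v \<le> b - c \<and> x < real (P ^ (u * s) * Q ^ (b - c - s * v)) \<and>
    real (P ^ (u * s) * Q ^ (b - c - s * v)) \<le> 2 * x"
proof -
  define \<rho> where "\<rho> = real (P ^ u) / real (Q ^ v)"
  have Qv: "real (Q ^ v) > 0" using PQ by simp
  have \<rho>2: "\<rho> \<le> 2"
  proof -
    have "real (P ^ u) \<le> real (2 * Q ^ v)" using uv(2) by (simp only: of_nat_le_iff)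
    thus ?thesis using Qv by (simp add: \<rho>_def divide_le_eq)
  qed
  have \<rho>1: "1 + 1 / real (Q ^ v) \<le> \<rho>"
  proof -
    have "real (Q ^ v + 1) \<le> real (P ^ u)" using uv(1) by (simp only: of_nat_le_iff)
    hence "(real (Q ^ v) + 1) / real (Q ^ v) \<le> \<rho>" unfolding \<rho>_def using Qv by (intro divide_right_mono) auto
    thus ?thesis using PQ by (simp add: add_divide_distrib)
  qed
  hence \<rho>0: "\<rho> \<ge> 1" using Qv by (smt (verit) divide_nonneg_pos)
  define f where "f s = real (Q ^ (b - c)) * \<rho> ^ s" for s
  \<comment> \<open>By Bernoulli's inequality \<open>Q ^ v\<close> steps at least double the value,
    and \<open>Q \<le> 2 ^ Q\<close>; so \<open>N\<close> steps make up for \<open>c + 1\<close>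
    factors \<open>Q\<close>.\<close>
  define N where "N = Q ^ v * (Q * (c + 1))"
  have cb: "c \<le> b" using c by simp
  have fN: "x < f N"
  proof -
    have "1 + real (Q ^ v) * (1 / real (Q ^ v)) \<le> (1 + 1 / real (Q ^ v)) ^ (Q ^ v)"
      by (rule Bernoulli_inequality) (use Qv in \<open>auto intro: order_trans[of _ 0]\<close>)
    also have "\<dots> \<le> \<rho> ^ (Q ^ v)" using \<rho>1 Qv by (intro power_mono) auto
    finally have "2 \<le> \<rho> ^ (Q ^ v)" using PQ by simp
    hence "2 ^ (Q * (c + 1)) \<le> (\<rho> ^ (Q ^ v)) ^ (Q * (c + 1))" by (intro power_mono) auto
    hence "(2 ^ Q) ^ (c + 1) \<le> \<rho> ^ N" by (simp only: N_def power_mult)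
    moreover have "real Q ^ (c + 1) \<le> (2 ^ Q) ^ (c + 1)"
    proof (rule power_mono)
      have "real Q \<le> real (2 ^ Q)" using two_power_ge by (simp only: of_nat_le_iff)
      thus "real Q \<le> 2 ^ Q" by simp
    qed simp
    ultimately have "real Q ^ (c + 1) \<le> \<rho> ^ N" by linarith
    hence "real (Q ^ (b - c)) * real Q ^ (c + 1) \<le> f N" unfolding f_def by (intro mult_left_mono) auto
    also have "real (Q ^ (b - c)) * real Q ^ (c + 1) = real (Q ^ Suc b)"
      using cb by (simp flip: power_add of_nat_power of_nat_mult)
    finally show ?thesis using x by linarith
  qed
  define s where "s = (LEAST s. x < f s)"
  have s: "x < f s" unfolding s_def by (rule LeastI[of _ N]) (rule fN)
  have sN: "s \<le> N" unfolding s_def by (rule Least_le) (rule fN)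
  have "f 0 \<le> x"
  proof -
    have "Q ^ (b - c) \<le> Q ^ b" using PQ by (intro power_increasing) auto
    hence "real (Q ^ (b - c)) \<le> real (Q ^ b)" by (simp only: of_nat_le_iff)
    thus ?thesis using x by (simp add: f_def)
  qed
  hence s0: "s \<noteq> 0" using s by (metis not_less)
  have "\<not> x < f (s - 1)" unfolding s_def by (rule not_less_Least) (use s0 in \<open>simp add: s_def\<close>)
  hence "f (s - 1) * \<rho> \<le> x * 2" using \<rho>0 \<rho>2 by (intro mult_mono) (auto intro: order_trans[OF _ x(1)])
  moreover have "f s = f (s - 1) * \<rho>" using s0 by (cases s) (auto simp: f_def)
  ultimately have s2: "f s \<le> 2 * x" by simp
  have sv: "s * v \<le> b - c"
  proof -
    have "s * v \<le> N * v" using sN by simp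
    also have "\<dots> = (c + 1) * (v * Q ^ Suc v)" by (simp add: N_def algebra_simps)
    also have "\<dots> \<le> b - c" using c by simp
    finally show ?thesis .
  qed
  have "f s = real (P ^ (u * s) * Q ^ (b - c - s * v))"
  proof -
    have "real (Q ^ (b - c)) = real Q ^ (b - c - s * v) * (real Q ^ v) ^ s"
      unfolding power_mult[symmetric] power_add[symmetric] mult.commute[of v s] le_add_diff_inverse2[OF sv] by simp
    thus ?thesis using PQ by (simp add: f_def \<rho>_def power_divide power_mult)
  qed
  thus ?thesis using s s2 sv by (intro exI[of _ s]) auto
qed

lemma nat_power_bracket:
  fixes Q :: nat and x :: real
  assumes "Q \<ge> 2" "x \<ge> 1"
  shows "\<exists>b. real (Q ^ b) \<le> x \<and> x < real (Q ^ Suc b)"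
proof -
  obtain N where N: "x < real Q ^ N" using real_arch_pow[of "real Q" x] assms by auto
  define m where "m = (LEAST m. x < real Q ^ m)"
  have m: "x < real Q ^ m" unfolding m_def by (rule LeastI[of _ N]) (rule N)
  have m0: "m \<noteq> 0" using m assms by (intro notI) simp
  have "\<not> x < real Q ^ (m - 1)" unfolding m_def by (rule not_less_Least) (use m0 in \<open>simp add: m_def\<close>)
  thus ?thesis using m m0 by (intro exI[of _ "m - 1"]) simp
qed

text \<open>Each start \<open>Q ^ (b - c)\<close> of the walk yields one element. The exponent of
  \<open>P\<close> determines the number of steps, and then that of \<open>Q\<close> determines
  \<open>c\<close>, so the elements are distinct. There are \<open>b div D\<close> starts, where
  \<open>b + 1 \<ge> log 2 x / Q\<close>.\<close>

lemma coprime_powers_count: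
  fixes P Q u v :: nat and x :: real and A :: "nat set"
  assumes PQ: "P \<ge> 2" "Q \<ge> 2" "coprime P Q" and v: "v \<ge> 1" "u \<ge> 1" and uv: "Q ^ v < P ^ u" "P ^ u \<le> 2 * Q ^ v"
    and A: "\<And>i j. P ^ i * Q ^ j \<in> A" and x: "x \<ge> 1"
  shows "real (card {a\<in>A. x < real a \<and> real a \<le> 2 * x}) \<ge> log 2 x / (Q * (v * Q ^ Suc v + 1)) - 2"
proof -
  define D where "D = v * Q ^ Suc v + 1"
  have Dp: "D > 0" by (simp add: D_def)
  obtain b where b: "real (Q ^ b) \<le> x" "x < real (Q ^ Suc b)" using nat_power_bracket[OF PQ(2) x] by auto
  define t where "t = b div D"
  have c: "(c + 1) * (v * Q ^ Suc v) + c \<le> b" if "c < t" for c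
  proof -
    have "(c + 1) * D \<le> t * D" using that by (intro mult_right_mono) auto
    also have "\<dots> \<le> b" by (simp add: t_def)
    finally show ?thesis by (simp add: D_def algebra_simps)
  qed
  have "\<exists>s. s * v \<le> b - c \<and> x < real (P ^ (u * s) * Q ^ (b - c - s * v)) \<and>
    real (P ^ (u * s) * Q ^ (b - c - s * v)) \<le> 2 * x" if "c < t" for c
    by (rule coprime_powers_walk[OF PQ(1,2) v(1) uv b c[OF that]])
  then obtain s where s: "\<And>c. c < t \<Longrightarrow> s c * v \<le> b - c \<and> x < real (P ^ (u * s c) * Q ^ (b - c - s c * v)) \<and>
    real (P ^ (u * s c) * Q ^ (b - c - s c * v)) \<le> 2 * x" by metis
  define g where "g c = P ^ (u * s c) * Q ^ (b - c - s c * v)" for c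
  have inj: "inj_on g {..<t}"
  proof
    fix c d assume cd: "c \<in> {..<t}" "d \<in> {..<t}" "g c = g d"
    have eq: "u * s c = u * s d" "b - c - s c * v = b - d - s d * v"
      using coprime_power_mult_inj[OF PQ(3,1,2)] cd(3) unfolding g_def by blast+
    hence "s c = s d" using v by simp
    moreover have "c \<le> b" "d \<le> b" using c[of c] c[of d] cd by simp_all
    moreover have "s c * v \<le> b - c" "s d * v \<le> b - d" using s cd(1,2) by auto
    moreover have "i = j" if "k \<le> b - i" "k \<le> b - j" "i \<le> b" "j \<le> b" "b - i - k = b - j - k" for i j k
      using that by arith
    ultimately show "c = d" using eq(2) by metis
  qed
  define F where "F = {a\<in>A. x < real a \<and> real a \<le> 2 * x}"
  have finF: "finite F"
    by (rule finite_subset[of _ "{..nat \<lfloor>2 * x\<rfloor>}"]) (auto simp: F_def le_nat_floor)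
  have "g ` {..<t} \<subseteq> F" using s A by (auto simp: F_def g_def)
  hence "card (g ` {..<t}) \<le> card F" using finF by (intro card_mono)
  hence "t \<le> card F" using card_image[OF inj] by simp
  moreover have "log 2 x / (Q * D) - 2 \<le> real t"
  proof -
    have "log 2 x \<le> log 2 (real (Q ^ Suc b))" using b x PQ by (subst log_le_cancel_iff) auto
    also have "\<dots> = real (Suc b) * log 2 Q" using PQ by (simp only: of_nat_power log_nat_power of_nat_0_le_iff)
    also have "log 2 Q \<le> Q"
    proof -
      have "log 2 (real Q) \<le> log 2 (real (2 ^ Q))"
        using two_power_ge[of Q] PQ by (subst log_le_cancel_iff) (auto simp del: of_nat_power simp: of_nat_le_iff)
      thus ?thesis by simp
    qed
    hence "real (Suc b) * log 2 Q \<le> real (Suc b) * Q" by (intro mult_left_mono) auto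
    finally have "log 2 x / Q \<le> real (Suc b)" using PQ by (simp add: divide_le_eq)
    moreover have "real b < (real t + 1) * D"
    proof -
      have "b < (t + 1) * D" using Dp unfolding t_def using dividend_less_div_times[of D b] by (simp add: algebra_simps)
      hence "real b < real ((t + 1) * D)" by (simp only: of_nat_less_iff)
      thus ?thesis by (simp add: algebra_simps)
    qed
    ultimately have "log 2 x / Q \<le> (real t + 1) * D + 1" by simp
    also have "\<dots> \<le> (real t + 1) * D + D" using Dp by simp
    also have "\<dots> = (real t + 2) * D" by (simp add: algebra_simps)
    finally have "log 2 x / Q / D \<le> real t + 2" using Dp by (simp only: pos_divide_le_eq of_nat_0_less_iff)
    thus ?thesis unfolding divide_divide_eq_left of_nat_mult by linarith
  qed
  ultimately show ?thesis unfolding F_def D_def by linarith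
qed

text \<open>With \<open>z = sqrt y\<close>, \<open>log 2 y \<le> 4 * z\<close> while
  \<open>y / D \<ge> 2 ^ 25 * z\<close>; this is the reason for the threshold
  \<open>2 ^ 50 * D\<^sup>2\<close>.\<close>

lemma loglog_less:
  fixes y D :: real
  assumes D: "D \<ge> 1" and y: "y \<ge> 2 ^ 50 * D\<^sup>2"
  shows "2 ^ 20 * log 2 y < y / D - 2"
proof -
  define z where "z = sqrt y"
  have "0 \<le> 2 ^ 50 * D\<^sup>2" by simp
  hence y0: "y \<ge> 0" using y by linarith
  have "sqrt (2 ^ 50 * D\<^sup>2) \<le> z" unfolding z_def using y by (rule real_sqrt_le_mono)
  moreover have "2 ^ 50 * D\<^sup>2 = (2 ^ 25 * D)\<^sup>2" by (simp add: power_mult_distrib)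
  ultimately have z: "2 ^ 25 * D \<le> z" using D by (simp only: real_sqrt_abs)
  have yz: "y = z * z" using y0 by (simp add: z_def)
  have "2 ^ 25 * 1 \<le> 2 ^ 25 * D" using D by (intro mult_left_mono) auto
  hence z1: "z \<ge> 2 ^ 25" using z by linarith
  hence z0: "z \<ge> 1" by simp
  have "ln z \<le> z - 1" using z0 by (intro ln_le_minus_one) auto
  hence "log 2 z \<le> (z - 1) / ln 2" by (simp add: log_def divide_right_mono)
  also have "\<dots> \<le> (z - 1) / (1 / 2)" using z0 ln2_bounds by (intro divide_left_mono) auto
  finally have lz: "log 2 z \<le> 2 * z" by simp
  have "log 2 y = 2 * log 2 z" using z0 by (simp add: yz log_mult)
  hence "2 ^ 20 * log 2 y \<le> 2 ^ 22 * z" using lz by simp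
  also have "\<dots> < 2 ^ 25 * z - 2" using z0 by simp
  also have "2 ^ 25 * z \<le> y / D"
  proof -
    have "2 ^ 25 * D * z \<le> z * z" using z z0 by (intro mult_right_mono) auto
    thus ?thesis using D by (simp add: yz le_divide_eq algebra_simps)
  qed
  finally show ?thesis by simp
qed

text \<open>Pigeonhole: for v = 0, ..., P the numbers \<open>log 2 (Q ^ v / P ^ e v)\<close> lie
  between 0 and \<open>P\<close>, so two of them have the same integer part. The quotient of the
  corresponding powers lies strictly between 1/2 and 2, and coprimality excludes 1. Which side is
  larger is left open, hence the disjunction.\<close>

lemma coprime_powers_close:
  fixes P Q :: nat
  assumes PQ: "P \<ge> 2" "Q \<ge> 2" "coprime P Q"
  shows "\<exists>u v. u \<ge> 1 \<and> v \<ge> 1 \<and> u \<le> P * Q + 1 \<and> v \<le> P * Q + 1 \<and>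
    (Q ^ v < P ^ u \<and> P ^ u \<le> 2 * Q ^ v \<or> P ^ u < Q ^ v \<and> Q ^ v \<le> 2 * P ^ u)"
proof -
  have "\<exists>u. real (P ^ u) \<le> real (Q ^ v) \<and> real (Q ^ v) < real (P ^ Suc u)" for v
    using PQ by (intro nat_power_bracket) auto
  then obtain e where e: "\<And>v. real (P ^ e v) \<le> real (Q ^ v) \<and> real (Q ^ v) < real (P ^ Suc (e v))" by metis
  define r where "r v = real (Q ^ v) / real (P ^ e v)" for v
  have Pp: "real (P ^ k) > 0" for k using PQ by simp
  have r: "1 \<le> r v" "r v < P" for v
    using e[of v] Pp[of "e v"] by (auto simp: r_def field_simps)
  define box where "box v = nat \<lfloor>log 2 (r v)\<rfloor>" for v
  have lr: "0 \<le> log 2 (r v)" "log 2 (r v) < P" for v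
  proof -
    show "0 \<le> log 2 (r v)" using r[of v] by simp
    have "P \<le> 2 ^ P" by (rule two_power_ge)
    hence "real P \<le> real (2 ^ P)" by (simp only: of_nat_le_iff)
    hence "r v < real (2 ^ P)" using r(2)[of v] by linarith
    hence "r v < 2 ^ P" by simp
    hence "log 2 (r v) < log 2 (2 ^ P)" using r[of v] by (subst log_less_cancel_iff) auto
    thus "log 2 (r v) < P" by simp
  qed
  have "box ` {..P} \<subseteq> {..<P}" using lr PQ by (auto simp: box_def nat_less_iff floor_less_iff)
  hence "card (box ` {..P}) \<le> card {..<P}" by (intro card_mono) auto
  hence "\<not> inj_on box {..P}" using card_image[of box "{..P}"] by auto
  then obtain a b where ab: "a \<le> P" "b \<le> P" "a < b" "box a = box b"
  proof -
    assume *: "\<And>a b. a \<le> P \<Longrightarrow> b \<le> P \<Longrightarrow> a < b \<Longrightarrow> box a = box b \<Longrightarrow> thesis"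
    obtain a b where "a \<le> P" "b \<le> P" "a \<noteq> b" "box a = box b"
      using \<open>\<not> inj_on box {..P}\<close> unfolding inj_on_def by auto
    thus thesis using *[of a b] *[of b a] by linarith
  qed
  have diff: "\<bar>log 2 (r a) - log 2 (r b)\<bar> < 1"
  proof -
    have "\<bar>x - y\<bar> < 1" if "nat \<lfloor>x\<rfloor> = nat \<lfloor>y\<rfloor>" "0 \<le> x" "0 \<le> y" for x y :: real
      using that by linarith
    thus ?thesis using ab(4) lr unfolding box_def by blast
  qed
  have eab: "e a \<le> e b"
  proof -
    have "Q ^ a \<le> Q ^ b" using ab PQ by (intro power_increasing) auto
    hence "real (Q ^ a) \<le> real (Q ^ b)" by (simp only: of_nat_le_iff)
    hence "real (P ^ e a) < real (P ^ Suc (e b))" using e[of a] e[of b] by linarith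
    hence "P ^ e a < P ^ Suc (e b)" by (simp only: of_nat_less_iff)
    hence "e a < Suc (e b)" by (rule power_less_imp_less_exp[rotated]) (use PQ in simp)
    thus ?thesis by simp
  qed
  define u v where "u = e b - e a" and "v = b - a"
  have v1: "v \<ge> 1" "v \<le> P" using ab by (auto simp: v_def)
  define \<tau> where "\<tau> = real (Q ^ v) / real (P ^ u)"
  have rb: "r b = r a * \<tau>"
  proof -
    have "Q ^ b = Q ^ a * Q ^ v" "P ^ e b = P ^ e a * P ^ u"
      using ab eab by (simp_all add: u_def v_def flip: power_add)
    thus ?thesis by (simp add: r_def \<tau>_def)
  qed
  have \<tau>p: "\<tau> > 0" using PQ by (simp add: \<tau>_def)
  have "log 2 (r b) = log 2 (r a) + log 2 \<tau>" unfolding rb using r[of a] \<tau>p by (subst log_mult) auto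
  hence "\<bar>log 2 \<tau>\<bar> < 1" using diff by linarith
  hence t: "log 2 \<tau> < 1" "- 1 < log 2 \<tau>" by linarith+
  have "\<tau> < 2" using t(1) \<tau>p by (simp add: log_less_iff)
  hence lt1: "Q ^ v < 2 * P ^ u"
  proof -
    have "real (Q ^ v) < real (2 * P ^ u)" using \<open>\<tau> < 2\<close> Pp[of u] by (simp add: \<tau>_def divide_less_eq)
    thus ?thesis by (simp only: of_nat_less_iff)
  qed
  have "1 / 2 < \<tau>" using t(2) \<tau>p by (simp add: less_log_iff powr_minus_divide)
  hence lt2: "P ^ u < 2 * Q ^ v"
  proof -
    have "real (P ^ u) < real (2 * Q ^ v)" using \<open>1 / 2 < \<tau>\<close> Pp[of u] by (simp add: \<tau>_def less_divide_eq)
    thus ?thesis by (simp only: of_nat_less_iff)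
  qed
  have Q2: "2 \<le> Q ^ v" using self_le_power[of Q v] PQ v1 by simp
  have u1: "u \<ge> 1" using lt1 Q2 by (cases u) auto
  have ne: "Q ^ v \<noteq> P ^ u"
  proof
    assume "Q ^ v = P ^ u"
    hence "P ^ u * Q ^ 0 = P ^ 0 * Q ^ v" by simp
    from coprime_power_mult_inj(1)[OF PQ(3,1,2) this] u1 show False by simp
  qed
  have u2: "u \<le> P * Q + 1"
  proof -
    have "2 ^ u \<le> P ^ u" using PQ by (intro power_mono) auto
    also have "\<dots> < 2 * Q ^ v" by (rule lt2)
    also have "Q ^ v \<le> (2 ^ Q) ^ v" using two_power_ge by (intro power_mono) auto
    hence "2 * Q ^ v \<le> 2 ^ (Q * v + 1)" by (simp add: power_mult)
    finally have "u < Q * v + 1" by (rule power_less_imp_less_exp[rotated]) simp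
    also have "\<dots> \<le> Q * P + 1" using v1 by simp
    finally show ?thesis by (simp add: mult.commute)
  qed
  have "P * 1 \<le> P * Q" using PQ by (intro mult_left_mono) auto
  hence "v \<le> P * Q + 1" using v1 by linarith
  moreover have "Q ^ v < P ^ u \<and> P ^ u \<le> 2 * Q ^ v \<or> P ^ u < Q ^ v \<and> Q ^ v \<le> 2 * P ^ u"
    using lt1 lt2 ne by linarith
  ultimately show ?thesis using u1 u2 v1 by blast
qed

section \<open>Distances to the integers along products of powers\<close>

lemma dist_int_add_of_int: "dist_int (x + of_int k) = dist_int x"
proof -
  have "dist_int (x + of_int k) \<le> dist_int x" for x k
    using dist_int_le[of "x + of_int k" "round x + k"] by (simp add: dist_int_def)
  from this[of x k] this[of "x + of_int k" "- k"] show ?thesis by simp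
qed

lemma dist_int_mult:
  assumes "P > 0" "dist_int y < 1 / (2 * real P)"
  shows "dist_int (real P * y) = real P * dist_int y"
proof -
  define k r where "k = round y" and "r = y - of_int k"
  have r: "dist_int y = \<bar>r\<bar>" by (simp add: dist_int_def r_def k_def)
  have "real P * \<bar>r\<bar> < real P * (1 / (2 * real P))" using assms r by (intro mult_strict_left_mono) auto
  hence "\<bar>real P * r\<bar> \<le> 1 / 2" using assms by (simp add: abs_mult)
  moreover have "real P * y = real P * r + of_int (int P * k)" by (simp add: r_def algebra_simps)
  ultimately show ?thesis using dist_int_add_of_int[of "real P * r" "int P * k"] dist_int_eq_abs[of "real P * r"]
    by (simp add: r abs_mult)
qed

text \<open>While the distance is below \<open>1 / (2 * P)\<close>, multiplication by
  \<open>P\<close> scales it exactly; the bound at the last power can thus be divided by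
  \<open>P ^ I\<close>.\<close>

lemma dist_int_small_if_powers_small:
  assumes "P > 0" "\<And>i. i \<le> I \<Longrightarrow> dist_int (real (P ^ i) * y) < 1 / (2 * real P)"
  shows "dist_int y < 1 / (2 * real P ^ Suc I)"
proof -
  have "dist_int (real (P ^ i) * y) = real P ^ i * dist_int y" if "i \<le> I" for i
    using that
  proof (induction i)
    case (Suc i)
    have "dist_int (real (P ^ Suc i) * y) = dist_int (real P * (real (P ^ i) * y))" by (simp add: mult.assoc)
    also have "\<dots> = real P * dist_int (real (P ^ i) * y)" using assms(1) assms(2)[of i] Suc.prems by (intro dist_int_mult) auto
    finally show ?case using Suc by simp
  qed simp
  from this[of I] have "real P ^ I * dist_int y < 1 / (2 * real P)" using assms(2)[of I] by simp
  thus ?thesis using assms(1) by (simp add: field_simps)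
qed

text \<open>Arrange the elements \<open>P ^ i * Q ^ j\<close> in a grid. If every column, or every
  row, has an entry of distance at least \<open>1 / (2 * Z)\<close>, these \<open>K0\<close> entries
  suffice. Otherwise a whole column and a whole row are small, so \<open>Q ^ j * \<theta>\<close>
  and \<open>P ^ i * \<theta>\<close> are very close to integers \<alpha> and \<beta>. Then
  \<open>\<beta> * Q ^ j = \<alpha> * P ^ i\<close>, coprimality makes \<alpha> a multiple of
  \<open>Q ^ j\<close>, and \<theta> is too close to an integer.\<close>

lemma coprime_powers_dist_int_sum:
  fixes P Q K0 Z :: nat and B W \<theta> :: real and A :: "nat set"
  assumes PQ: "P \<ge> 2" "Q \<ge> 2" "coprime P Q" "P \<le> Z" "Q \<le> Z"
    and A: "\<And>i j. P ^ i * Q ^ j \<in> A"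
    and B: "B > 0" "2 * B \<le> 2 ^ K0" and W: "W < real K0 / (4 * (real Z)\<^sup>2)"
    and \<theta>: "1 / (4 * B) \<le> \<theta>" "\<theta> \<le> 1 - 1 / (4 * B)"
  shows "W < (\<Sum>a | a \<in> A \<and> real a \<le> real ((P * Q) ^ K0). (dist_int (real a * \<theta>))\<^sup>2)"
proof -
  define F where "F = {a \<in> A. real a \<le> real ((P * Q) ^ K0)}"
  have finF: "finite F"
    by (rule finite_subset[of _ "{..(P * Q) ^ K0}"]) (auto simp: F_def simp del: of_nat_power of_nat_mult)
  have inF: "P ^ i * Q ^ j \<in> F" if "i \<le> K0" "j \<le> K0" for i j
  proof -
    have "P ^ i * Q ^ j \<le> P ^ K0 * Q ^ K0" using PQ that by (intro mult_mono power_increasing) auto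
    hence "P ^ i * Q ^ j \<le> (P * Q) ^ K0" by (simp add: power_mult_distrib)
    thus ?thesis unfolding F_def using A by (simp only: mem_Collect_eq of_nat_le_iff)
  qed
  have Zp: "real Z > 0" using PQ by simp
  have large: "W < (\<Sum>a\<in>F. (dist_int (real a * \<theta>))\<^sup>2)"
    if g: "inj_on g {..<K0}" "g ` {..<K0} \<subseteq> F" "\<And>j. j < K0 \<Longrightarrow> 1 / (2 * real Z) \<le> dist_int (real (g j) * \<theta>)" for g
  proof -
    have "real K0 / (4 * (real Z)\<^sup>2) = (\<Sum>j<K0. (1 / (2 * real Z))\<^sup>2)" by (simp add: power_divide power_mult_distrib)
    also have "\<dots> \<le> (\<Sum>j<K0. (dist_int (real (g j) * \<theta>))\<^sup>2)"
      using g(3) Zp by (intro sum_mono power_mono) auto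
    also have "\<dots> = (\<Sum>a\<in>g ` {..<K0}. (dist_int (real a * \<theta>))\<^sup>2)"
      using g(1) by (simp add: sum.reindex)
    also have "\<dots> \<le> (\<Sum>a\<in>F. (dist_int (real a * \<theta>))\<^sup>2)"
      using g(2) by (intro sum_mono2 finF) auto
    finally show ?thesis using W by simp
  qed
  have inv: "1 / (2 * real Z) \<le> 1 / (2 * real P)" "1 / (2 * real Z) \<le> 1 / (2 * real Q)"
    using PQ by (auto intro!: frac_le)
  have "W < (\<Sum>a\<in>F. (dist_int (real a * \<theta>))\<^sup>2)"
  proof (cases "\<forall>j<K0. \<exists>i\<le>K0. 1 / (2 * real P) \<le> dist_int (real (P ^ i * Q ^ j) * \<theta>)")
    case True
    then obtain i where i: "\<And>j. j < K0 \<Longrightarrow> i j \<le> K0 \<and> 1 / (2 * real P) \<le> dist_int (real (P ^ i j * Q ^ j) * \<theta>)" by metis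
    show ?thesis
    proof (rule large[of "\<lambda>j. P ^ i j * Q ^ j"])
      show "inj_on (\<lambda>j. P ^ i j * Q ^ j) {..<K0}"
        using coprime_power_mult_inj(2)[OF PQ(3,1,2)] by (intro inj_onI) blast
      show "(\<lambda>j. P ^ i j * Q ^ j) ` {..<K0} \<subseteq> F" using i inF by auto
    qed (use i inv in \<open>blast intro: order_trans\<close>)
  next
    case False
    then obtain j where j0: "j < K0" "\<not> (\<exists>i\<le>K0. 1 / (2 * real P) \<le> dist_int (real (P ^ i * Q ^ j) * \<theta>))" by blast
    have j: "j < K0" "\<And>i. i \<le> K0 \<Longrightarrow> dist_int (real (P ^ i * Q ^ j) * \<theta>) < 1 / (2 * real P)"
      using j0 by (blast, meson not_le)
    show ?thesis
    proof (cases "\<forall>i<K0. \<exists>j\<le>K0. 1 / (2 * real Q) \<le> dist_int (real (P ^ i * Q ^ j) * \<theta>)")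
      case True
      then obtain j where j: "\<And>i. i < K0 \<Longrightarrow> j i \<le> K0 \<and> 1 / (2 * real Q) \<le> dist_int (real (P ^ i * Q ^ j i) * \<theta>)" by metis
      show ?thesis
      proof (rule large[of "\<lambda>i. P ^ i * Q ^ j i"])
        show "inj_on (\<lambda>i. P ^ i * Q ^ j i) {..<K0}"
          using coprime_power_mult_inj(1)[OF PQ(3,1,2)] by (intro inj_onI) blast
        show "(\<lambda>i. P ^ i * Q ^ j i) ` {..<K0} \<subseteq> F" using j inF by auto
      qed (use j inv in \<open>blast intro: order_trans\<close>)
    next
      case False
      then obtain i where i0: "i < K0" "\<not> (\<exists>j\<le>K0. 1 / (2 * real Q) \<le> dist_int (real (P ^ i * Q ^ j) * \<theta>))" by blast
      have i: "i < K0" "\<And>j. j \<le> K0 \<Longrightarrow> dist_int (real (P ^ i * Q ^ j) * \<theta>) < 1 / (2 * real Q)"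
        using i0 by (blast, meson not_le)
      have dj: "dist_int (real (Q ^ j) * \<theta>) < 1 / (2 * real P ^ Suc K0)"
        using j PQ by (intro dist_int_small_if_powers_small) (auto simp: mult.assoc)
      have di: "dist_int (real (P ^ i) * \<theta>) < 1 / (2 * real Q ^ Suc K0)"
        using i PQ by (intro dist_int_small_if_powers_small) (auto simp: mult.assoc mult.left_commute)
      define \<alpha> \<beta> where "\<alpha> = round (real (Q ^ j) * \<theta>)" and "\<beta> = round (real (P ^ i) * \<theta>)"
      define e1 e2 where "e1 = real (Q ^ j) * \<theta> - of_int \<alpha>" and "e2 = real (P ^ i) * \<theta> - of_int \<beta>"
      have Pp: "real P ^ k > 0" "real Q ^ k > 0" for k using PQ by simp_all
      have e1: "\<bar>e1\<bar> < 1 / (2 * real P ^ Suc K0)" using dj by (simp only: dist_int_def e1_def \<alpha>_def)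
      have e2: "\<bar>e2\<bar> < 1 / (2 * real Q ^ Suc K0)" using di by (simp only: dist_int_def e2_def \<beta>_def)
      have "of_int (\<beta> * int (Q ^ j) - \<alpha> * int (P ^ i)) = real P ^ i * e1 - real Q ^ j * e2"
        by (simp add: e1_def e2_def algebra_simps)
      moreover have "\<bar>real P ^ i * e1\<bar> < 1 / 2"
      proof -
        have "real P ^ i * \<bar>e1\<bar> < real P ^ i * (1 / (2 * real P ^ Suc K0))"
          using e1 Pp by (intro mult_strict_left_mono) auto
        also have "\<dots> \<le> real P ^ Suc K0 * (1 / (2 * real P ^ Suc K0))"
          using PQ i Pp by (intro mult_right_mono power_increasing) auto
        also have "\<dots> = 1 / 2" using PQ by simp
        finally show ?thesis by (simp add: abs_mult)
      qed
      moreover have "\<bar>real Q ^ j * e2\<bar> < 1 / 2"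
      proof -
        have "real Q ^ j * \<bar>e2\<bar> < real Q ^ j * (1 / (2 * real Q ^ Suc K0))"
          using e2 Pp by (intro mult_strict_left_mono) auto
        also have "\<dots> \<le> real Q ^ Suc K0 * (1 / (2 * real Q ^ Suc K0))"
          using PQ j Pp by (intro mult_right_mono power_increasing) auto
        also have "\<dots> = 1 / 2" using PQ by simp
        finally show ?thesis by (simp add: abs_mult)
      qed
      ultimately have "\<bar>real_of_int (\<beta> * int (Q ^ j) - \<alpha> * int (P ^ i))\<bar> < 1" by linarith
      hence "\<beta> * int (Q ^ j) = \<alpha> * int (P ^ i)" by linarith
      hence "int (Q ^ j) dvd \<alpha> * int (P ^ i)" by (metis dvd_triv_right)
      moreover have "coprime (int (Q ^ j)) (int (P ^ i))" using PQ(3) by (simp add: coprime_commute)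
      ultimately have "int (Q ^ j) dvd \<alpha>" by (simp add: coprime_dvd_mult_left_iff)
      then obtain \<gamma> where \<gamma>: "\<alpha> = int (Q ^ j) * \<gamma>" by (auto simp: dvd_def)
      have "\<theta> - of_int \<gamma> = e1 / real Q ^ j" using PQ by (simp add: e1_def \<gamma> field_simps)
      moreover have "\<bar>e1 / real Q ^ j\<bar> \<le> \<bar>e1\<bar> / 1" unfolding abs_divide
        using PQ by (intro divide_left_mono) (auto simp: one_le_power)
      moreover have "1 / (2 * real P ^ Suc K0) \<le> 1 / (4 * B)"
      proof (intro frac_le)
        have "(2::real) ^ K0 \<le> real P ^ K0" using PQ by (intro power_mono) auto
        hence "2 * 2 ^ K0 \<le> real P * real P ^ K0" using PQ by (intro mult_mono) auto
        thus "4 * B \<le> 2 * real P ^ Suc K0" using B by simp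
      qed (use B in auto)
      ultimately have "\<bar>\<theta> - of_int \<gamma>\<bar> < 1 / (4 * B)" using e1 by linarith
      moreover have "0 < 1 / (4 * B)" using B by simp
      ultimately have "0 < real_of_int \<gamma> \<and> real_of_int \<gamma> < 1" using \<theta> by linarith
      hence "0 < \<gamma>" "\<gamma> < 1" by simp_all
      hence False by linarith
      thus ?thesis ..
    qed
  qed
  thus ?thesis by (simp add: F_def)
qed

section \<open>Explicit constants for two prime squares\<close>

lemma walk_constant_le:
  fixes Y Z w :: nat
  assumes "Y \<le> Z" "w \<le> Z\<^sup>2" "Z \<ge> 2"
  shows "Y * (w * Y ^ Suc w + 1) \<le> Z ^ (Z\<^sup>2 + 5)"
proof -
  have "Y * (w * Y ^ Suc w + 1) \<le> Z * (Z\<^sup>2 * Z ^ Suc (Z\<^sup>2) + 1)"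
  proof (intro mult_mono add_mono)
    have "Y ^ Suc w \<le> Z ^ Suc w" using assms by (intro power_mono) auto
    also have "\<dots> \<le> Z ^ Suc (Z\<^sup>2)" using assms by (intro power_increasing) auto
    finally show "Y ^ Suc w \<le> Z ^ Suc (Z\<^sup>2)" .
  qed (use assms in auto)
  also have "Z\<^sup>2 * Z ^ Suc (Z\<^sup>2) = Z ^ (Z\<^sup>2 + 3)"
    by (simp add: power_add eval_nat_numeral)
  also have "Z * (Z ^ (Z\<^sup>2 + 3) + 1) \<le> Z * (Z * Z ^ (Z\<^sup>2 + 3))"
  proof (rule mult_left_mono)
    have "1 \<le> Z ^ (Z\<^sup>2 + 3)" using assms by (intro one_le_power) auto
    moreover have "2 * Z ^ (Z\<^sup>2 + 3) \<le> Z * Z ^ (Z\<^sup>2 + 3)" using assms by (intro mult_right_mono) auto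
    ultimately show "Z ^ (Z\<^sup>2 + 3) + 1 \<le> Z * Z ^ (Z\<^sup>2 + 3)" by linarith
  qed simp
  also have "\<dots> = Z ^ (Z\<^sup>2 + 5)" by (simp add: power_add eval_nat_numeral)
  finally show ?thesis .
qed

lemma two_prime_squares_cover:
  fixes p q n :: nat and A :: "nat set"
  assumes pq: "prime p" "prime q" "3 \<le> p" "p < q"
    and A: "\<And>i j. (p\<^sup>2) ^ i * (q\<^sup>2) ^ j \<in> A"
    and n: "real n > 2 ^ (2 ^ (2 ^ (q ^ (4 * p\<^sup>2))))"
  shows "\<exists>T\<subseteq>A. finite T \<and> \<Sum>T = n"
proof -
  define P Q where "P = p\<^sup>2" and "Q = q\<^sup>2"
  define Z where "Z = Q"
  have cop: "coprime P Q" using pq by (simp add: P_def Q_def primes_coprime)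
  have PlQ: "P < Q" unfolding P_def Q_def using pq by (intro power_strict_mono) auto
  have "(3::nat)\<^sup>2 \<le> p\<^sup>2" using pq by (intro power_mono) auto
  hence P9: "P \<ge> 9" by (simp add: P_def)
  \<comment> \<open>\<open>q \<ge> 5\<close> gives \<open>Z \<ge> 25\<close>, on which the numerical
    estimate \<open>2 ^ 50 \<le> Z ^ 11\<close> below relies.\<close>
  have "(5::nat)\<^sup>2 \<le> q\<^sup>2"
  proof (rule power_mono)
    have "q \<noteq> 4"
    proof
      assume "q = 4"
      hence "prime (4::nat)" using pq by simp
      moreover have "\<not> prime (4::nat)" by (simp add: prime_nat_iff) (auto intro!: exI[of _ 2])
      ultimately show False by contradiction
    qed
    thus "5 \<le> q" using pq by linarith
  qed simp
  hence Z25: "Z \<ge> 25" by (simp add: Z_def Q_def)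
  have PQ2: "P \<ge> 2" "Q \<ge> 2" using P9 PlQ by auto
  have PQZ: "P * Q + 1 \<le> Z\<^sup>2"
  proof -
    have "Suc P * Q \<le> Q * Q" using PlQ by (intro mult_right_mono) auto
    thus ?thesis using PQ2 by (simp add: Z_def power2_eq_square)
  qed
  have A': "P ^ i * Q ^ j \<in> A" for i j using A by (simp add: P_def Q_def)
  define D where "D = Z ^ (Z\<^sup>2 + 5)"
  have D1: "D \<ge> 1" using Z25 by (simp add: D_def)
  have count: "log 2 x / real D - 2 \<le> real (card {a\<in>A. x < real a \<and> real a \<le> 2 * x})" if x: "x \<ge> 1" for x
  proof -
    have mono: "log 2 x / real D - 2 \<le> log 2 x / real (Y * (w * Y ^ Suc w + 1)) - 2"
      if "Y \<le> Z" "w \<le> Z\<^sup>2" "Y > 0" for Y w :: nat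
    proof -
      have "Y * (w * Y ^ Suc w + 1) \<le> D" unfolding D_def using that Z25 by (intro walk_constant_le) auto
      hence "real (Y * (w * Y ^ Suc w + 1)) \<le> real D" by (simp only: of_nat_le_iff)
      moreover have "0 < real (Y * (w * Y ^ Suc w + 1))" using that by (simp only: of_nat_0_less_iff) simp
      ultimately show ?thesis using x by (intro diff_right_mono divide_left_mono) (auto intro: mult_pos_pos)
    qed
    obtain u v where uv: "u \<ge> 1" "v \<ge> 1" "u \<le> P * Q + 1" "v \<le> P * Q + 1"
      "Q ^ v < P ^ u \<and> P ^ u \<le> 2 * Q ^ v \<or> P ^ u < Q ^ v \<and> Q ^ v \<le> 2 * P ^ u"
      using coprime_powers_close[OF PQ2 cop] by blast
    from uv(5) show ?thesis
    proof
      assume h: "Q ^ v < P ^ u \<and> P ^ u \<le> 2 * Q ^ v"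
      have "log 2 x / real (Q * (v * Q ^ Suc v + 1)) - 2 \<le> real (card {a\<in>A. x < real a \<and> real a \<le> 2 * x})"
        by (rule coprime_powers_count[OF PQ2 cop uv(2,1)]) (use h A' x in auto)
      with mono[of Q v] show ?thesis using uv PQZ PQ2 by (simp only: Z_def) linarith
    next
      assume h: "P ^ u < Q ^ v \<and> Q ^ v \<le> 2 * P ^ u"
      have "log 2 x / real (P * (u * P ^ Suc u + 1)) - 2 \<le> real (card {a\<in>A. x < real a \<and> real a \<le> 2 * x})"
        by (rule coprime_powers_count[OF PQ2(2,1) _ uv(1,2)]) (use h A' x cop in \<open>auto simp: coprime_commute mult.commute[of "Q ^ _"]\<close>)
      with mono[of P u] show ?thesis using uv PQZ PQ2 PlQ by (simp only: Z_def) linarith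
    qed
  qed
  \<comment> \<open>The threshold of \<open>loglog_less\<close>; \<open>log 2 x\<close> reaches it
    for all \<open>x \<ge> B\<close>.\<close>
  define b where "b = 2 ^ 50 * D\<^sup>2"
  define B where "B = (2::real) ^ b"
  \<comment> \<open>Makes \<open>K0 / (4 * Z\<^sup>2)\<close> equal to \<open>2 * b + 51\<close>,
    just above the required \<open>2 * log 2 B + 50\<close>.\<close>
  define K0 where "K0 = 4 * Z\<^sup>2 * (2 * b + 51)"
  define C where "C = real ((P * Q) ^ K0)"
  have b40: "2 ^ 40 \<le> b"
  proof -
    have "2 ^ 40 * 1 \<le> (2 ^ 50 :: nat) * D\<^sup>2" using D1 by (intro mult_mono) auto
    thus ?thesis by (simp add: b_def)
  qed
  have logB: "log 2 B = real b" by (simp add: B_def log_nat_power)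
  have B1: "B \<ge> 1" by (simp add: B_def)
  have bK: "b + 1 \<le> K0"
  proof -
    have "1 * (b + 1) \<le> 4 * Z\<^sup>2 * (2 * b + 51)" using Z25 by (intro mult_mono) auto
    thus ?thesis by (simp add: K0_def)
  qed
  show ?thesis
  proof (rule subset_sums_cover[of B A C n])
    show "2 ^ (2 ^ 40) \<le> B" unfolding B_def using b40 by (rule power_increasing) simp
    show "2 ^ 20 * log 2 (log 2 x) < real (card {a\<in>A. x < real a \<and> real a \<le> 2 * x})" if x: "B \<le> x" for x
    proof -
      have x1: "x \<ge> 1" using x B1 by simp
      have "real b \<le> log 2 x" unfolding logB[symmetric] using x x1 B1 by (subst log_le_cancel_iff) auto
      hence "2 ^ 50 * (real D)\<^sup>2 \<le> log 2 x" by (simp add: b_def)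
      hence "2 ^ 20 * log 2 (log 2 x) < log 2 x / real D - 2" using D1 by (intro loglog_less) auto
      thus ?thesis using count[OF x1] by linarith
    qed
    show "B \<le> C"
    proof -
      have "(2::nat) ^ b \<le> 2 ^ K0" using bK by (intro power_increasing) auto
      also have "\<dots> \<le> (P * Q) ^ K0"
      proof (rule power_mono)
        have "2 * 1 \<le> P * Q" using PQ2 by (intro mult_mono) auto
        thus "2 \<le> P * Q" by simp
      qed simp
      finally have "real (2 ^ b) \<le> C" unfolding C_def by (simp only: of_nat_le_iff)
      thus ?thesis by (simp add: B_def)
    qed
    show "2 * log 2 B + 50 < (\<Sum>a | a \<in> A \<and> real a \<le> C. (dist_int (real a * \<theta>))\<^sup>2)"
      if th: "1 / (4 * B) \<le> \<theta>" "\<theta> \<le> 1 - 1 / (4 * B)" for \<theta>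
      unfolding C_def
    proof (rule coprime_powers_dist_int_sum[OF PQ2 cop _ _ A' _ _ _ th, of Z])
      show "P \<le> Z" "Q \<le> Z" using PlQ by (auto simp: Z_def)
      show "B > 0" using B1 by simp
      have "(2::real) ^ (b + 1) \<le> 2 ^ K0" using bK by (intro power_increasing) auto
      thus "2 * B \<le> 2 ^ K0" by (simp add: B_def)
      have "real K0 / (4 * (real Z)\<^sup>2) = 2 * real b + 51" using Z25 by (simp add: K0_def)
      thus "2 * log 2 B + 50 < real K0 / (4 * (real Z)\<^sup>2)" by (simp add: logB)
    qed
    show "C ^ 10 < real n"
    proof -
      have ZZ: "Z \<le> 2 ^ Z" by (rule two_power_ge)
      have "P * Q \<le> Z * Z" using PlQ by (intro mult_mono) (auto simp: Z_def)
      also have "\<dots> \<le> 2 ^ Z * 2 ^ Z" using ZZ by (intro mult_mono) auto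
      finally have "P * Q \<le> 2 ^ (2 * Z)" by (simp add: power_add mult_2)
      hence "((P * Q) ^ K0) ^ 10 \<le> ((2 ^ (2 * Z)) ^ K0) ^ 10" by (intro power_mono) auto
      also have "\<dots> = 2 ^ (20 * Z * K0)" by (simp add: mult_ac flip: power_mult)
      \<comment> \<open>The exponent is a polynomial in \<open>Z\<close> times
        \<open>D\<^sup>2\<close>, hence at most \<open>Z ^ (2 * Z\<^sup>2 + 26)\<close>, which is
        below \<open>2 ^ (Z ^ 4)\<close> with \<open>Z ^ 4 = q ^ 8\<close>.\<close>
      also have "\<dots> \<le> 2 ^ (2 ^ (2 ^ (q ^ (4 * p\<^sup>2))))"
      proof (intro power_increasing)
        have Z3: "Z ^ k * Z ^ l = Z ^ (k + l)" for k l by (simp add: power_add)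
        have c1: "240 \<le> Z ^ 2" using power_mono[of 25 Z 2] Z25 by simp
        have c2: "2 ^ 50 \<le> Z ^ 11" using power_mono[of 25 Z 11] Z25 by simp
        have "51 \<le> b" using b40 by (rule order_trans[rotated]) simp
        hence "20 * Z * K0 \<le> 20 * Z * (4 * Z\<^sup>2 * (3 * b))" unfolding K0_def by (intro mult_left_mono) auto
        also have "\<dots> = 240 * Z ^ 3 * b" by (simp add: power2_eq_square power3_eq_cube)
        also have "\<dots> \<le> Z ^ 2 * Z ^ 3 * b" using c1 by (intro mult_right_mono) auto
        also have "\<dots> \<le> Z ^ 2 * Z ^ 3 * (Z ^ 11 * D\<^sup>2)" unfolding b_def using c2 by (intro mult_left_mono mult_right_mono) auto
        also have "\<dots> = Z ^ (2 * Z\<^sup>2 + 26)" by (simp add: D_def mult.commute add.commute flip: power_add power_mult)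
        also have "\<dots> \<le> (2 ^ Z) ^ (2 * Z\<^sup>2 + 26)" using ZZ by (intro power_mono) auto
        also have "\<dots> = 2 ^ (Z * (2 * Z\<^sup>2 + 26))" by (simp flip: power_mult)
        also have "\<dots> \<le> 2 ^ (Z ^ 4)"
        proof (intro power_increasing)
          have "26 \<le> Z ^ 2" using c1 by simp
          hence "2 * Z\<^sup>2 + 26 \<le> 3 * Z\<^sup>2" by simp
          also have "\<dots> \<le> Z * Z\<^sup>2" using Z25 by (intro mult_right_mono) auto
          finally have "Z * (2 * Z\<^sup>2 + 26) \<le> Z * (Z * Z\<^sup>2)" by (intro mult_left_mono) auto
          thus "Z * (2 * Z\<^sup>2 + 26) \<le> Z ^ 4" by (simp add: eval_nat_numeral)
        qed simp
        also have "\<dots> \<le> 2 ^ (2 ^ (q ^ (4 * p\<^sup>2)))"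
        proof (intro power_increasing)
          have "Z ^ 4 = q ^ 8" by (simp add: Z_def Q_def flip: power_mult)
          also have "\<dots> \<le> q ^ (4 * p\<^sup>2)" using pq P9 by (intro power_increasing) (auto simp: P_def)
          also have "\<dots> \<le> 2 ^ (q ^ (4 * p\<^sup>2))" by (rule two_power_ge)
          finally show "Z ^ 4 \<le> 2 ^ (q ^ (4 * p\<^sup>2))" .
        qed simp
        finally show "20 * Z * K0 \<le> 2 ^ (2 ^ (q ^ (4 * p\<^sup>2)))" .
      qed simp
      finally have "real (((P * Q) ^ K0) ^ 10) \<le> real (2 ^ (2 ^ (2 ^ (q ^ (4 * p\<^sup>2)))))" by (simp only: of_nat_le_iff)
      also have "\<dots> < real n" using n by simp
      finally show ?thesis by (simp only: C_def of_nat_power)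
    qed
  qed
qed

section \<open>Sums of distinct square \<open>\<pi>\<close>-numbers\<close>

text \<open>\<open>enumerate\<close> is increasing and exhausts \<open>A\<close>, so the indices of
  the elements up to \<open>x\<close> form an initial segment, starting at 0, whose size is the
  number of these elements.\<close>

lemma enumerate_le_iff_less_card:
  fixes A :: "nat set"
  assumes inf: "infinite A"
  shows "real (enumerate A k) \<le> x \<longleftrightarrow> k < card {a\<in>A. real a \<le> x}"
proof -
  define F where "F = {a\<in>A. real a \<le> x}"
  have finF: "finite F" by (rule finite_subset[of _ "{..nat \<lfloor>x\<rfloor>}"]) (auto simp: F_def le_nat_floor)
  define I where "I = {k. real (enumerate A k) \<le> x}"
  have sm: "strict_mono (enumerate A)" using enumerate_mono[OF _ inf] by (simp add: strict_mono_def)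
  have img: "enumerate A ` I = F"
    using enumerate_in_set[OF inf] enumerate_Ex[OF inf] unfolding F_def I_def by (auto simp: image_iff)
  have inj: "inj_on (enumerate A) I" by (rule inj_on_subset[OF strict_mono_imp_inj_on[OF sm] subset_UNIV])
  have c: "card I = card F" using card_image[OF inj] img by simp
  have finI: "finite I" by (rule finite_imageD[OF _ inj]) (simp add: img finF)
  have down: "j \<in> I" if "i \<in> I" "j \<le> i" for i j
  proof -
    have "enumerate A j \<le> enumerate A i" using that(2) sm by (simp add: strict_mono_less_eq)
    hence "real (enumerate A j) \<le> real (enumerate A i)" by (simp only: of_nat_le_iff)
    thus ?thesis using that(1) unfolding I_def mem_Collect_eq by (rule order_trans)
  qed
  have "I = {..<card I}"
  proof (cases "I = {}")
    case False
    have "Max I \<in> I" using finI False by simp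
    hence I: "I = {..Max I}" using down Max_ge[OF finI] by blast
    have "card {..Max I} = Suc (Max I)" by simp
    hence "card I = Suc (Max I)" by (subst I)
    thus ?thesis using I lessThan_Suc_atMost by simp
  qed simp
  hence "k \<in> I \<longleftrightarrow> k < card F" unfolding c by blast
  thus ?thesis by (simp add: I_def F_def)
qed

lemma power_mult_square_in_pi_squares:
  assumes "prime p" "prime q" "p \<in> \<pi>" "q \<in> \<pi>"
  shows "(p\<^sup>2) ^ i * (q\<^sup>2) ^ j \<in> pi_squares \<pi>"
proof -
  have "p > 0" "q > 0" using assms by (auto intro: prime_gt_0_nat)
  moreover have "r \<in> {p, q}" if "prime r" "r dvd (p\<^sup>2) ^ i * (q\<^sup>2) ^ j" for r
  proof -
    have "r dvd p \<or> r dvd q"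
      using that by (auto simp: prime_dvd_mult_iff dest!: prime_dvd_power[rotated])
    thus ?thesis using assms that(1) primes_dvd_imp_eq by blast
  qed
  ultimately have "pi_number \<pi> ((p\<^sup>2) ^ i * (q\<^sup>2) ^ j)"
    using assms unfolding pi_number_def by (auto simp: prime_factors_dvd)
  moreover have "(p\<^sup>2) ^ i * (q\<^sup>2) ^ j = (p ^ i * q ^ j)\<^sup>2"
    by (simp add: power_mult_distrib mult.commute flip: power_mult)
  ultimately show ?thesis unfolding pi_squares_def by blast
qed

lemma infinite_pi_squares:
  assumes "prime p" "p \<in> \<pi>"
  shows "infinite (pi_squares \<pi>)"
proof
  assume fin: "finite (pi_squares \<pi>)"
  have "range (\<lambda>i. (p\<^sup>2) ^ i) \<subseteq> pi_squares \<pi>"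
    using power_mult_square_in_pi_squares[OF assms(1,1) assms(2,2), of _ 0] by auto
  moreover have "inj (\<lambda>i. (p\<^sup>2) ^ i)"
  proof -
    have "1 < p\<^sup>2" using prime_gt_1_nat[OF assms(1)] by (intro one_less_power) auto
    thus ?thesis by (intro injI) (simp only: power_inject_exp)
  qed
  ultimately show False using fin finite_subset range_inj_infinite by blast
qed

lemma sum_pi_square_seq:
  assumes "infinite (pi_squares \<pi>)"
  shows "(\<Sum>s = 1..S \<pi> x. f (pi_square_seq \<pi> s)) = (\<Sum>a | a \<in> pi_squares \<pi> \<and> real a \<le> x. f a)"
proof -
  define g where "g = enumerate (pi_squares \<pi>)"
  have "(\<Sum>s = 1..S \<pi> x. f (pi_square_seq \<pi> s)) = (\<Sum>k<S \<pi> x. f (g k))"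
    by (rule sum.reindex_bij_witness[of _ Suc "\<lambda>s. s - 1"]) (auto simp: pi_square_seq_def g_def)
  also have "\<dots> = (\<Sum>a\<in>g ` {..<S \<pi> x}. f a)"
  proof -
    have "strict_mono g" using enumerate_mono[OF _ assms] by (simp add: strict_mono_def g_def)
    hence "inj_on g {..<S \<pi> x}" using inj_on_subset strict_mono_imp_inj_on subset_UNIV by blast
    thus ?thesis by (simp add: sum.reindex)
  qed
  also have "g ` {..<S \<pi> x} = {a \<in> pi_squares \<pi>. real a \<le> x}"
  proof (intro equalityI subsetI)
    fix a assume "a \<in> g ` {..<S \<pi> x}"
    thus "a \<in> {a \<in> pi_squares \<pi>. real a \<le> x}"
      using enumerate_in_set[OF assms] enumerate_le_iff_less_card[OF assms] by (auto simp: g_def S_def)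
  next
    fix a assume a: "a \<in> {a \<in> pi_squares \<pi>. real a \<le> x}"
    then obtain k where k: "g k = a" using enumerate_Ex[OF assms, of a] by (auto simp: g_def)
    hence "k < S \<pi> x" using a enumerate_le_iff_less_card[OF assms, of k x] by (simp add: g_def S_def)
    thus "a \<in> g ` {..<S \<pi> x}" using k by blast
  qed
  finally show ?thesis by simp
qed

lemma S_diff:
  assumes "x \<ge> 0"
  shows "real (S \<pi> (2 * x)) - real (S \<pi> x) = real (card {a \<in> pi_squares \<pi>. x < real a \<and> real a \<le> 2 * x})"
proof -
  have fin: "finite {a \<in> pi_squares \<pi>. real a \<le> y}" for y
    by (rule finite_subset[of _ "{..nat \<lfloor>y\<rfloor>}"]) (auto simp: le_nat_floor)
  have "{a \<in> pi_squares \<pi>. real a \<le> 2 * x} =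
    {a \<in> pi_squares \<pi>. real a \<le> x} \<union> {a \<in> pi_squares \<pi>. x < real a \<and> real a \<le> 2 * x}"
    using assms by auto
  hence "S \<pi> (2 * x) = S \<pi> x + card {a \<in> pi_squares \<pi>. x < real a \<and> real a \<le> 2 * x}"
    unfolding S_def using fin[of x] finite_subset[OF _ fin[of "2 * x"]]
    by (subst card_Un_disjoint[symmetric]) auto
  thus ?thesis by simp
qed

text \<open>Exceeding the minimum means exceeding \<open>N_plus\<close> or \<open>N_minus\<close>
  for an admissible pair. The first case uses powers of the two largest primes, whence the shape of
  \<open>Omega\<close>; in the second the given \<open>B\<close> and \<open>C\<close> enter the
  covering theorem directly. The summand \<open>p t\<close> in both bounds pays for
  \<open>k\<close>.\<close>

lemma sum_distinct_pi_squares: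
  fixes t n k :: nat and p :: "nat \<Rightarrow> nat" and N :: real
  assumes t: "t \<ge> 2"
    and p: "\<And>i. i \<in> {1..t} \<Longrightarrow> prime (p i) \<and> odd (p i)"
    and mono: "strict_mono_on {1..t} p"
    and N: "is_N p t N" "real n > N"
    and k: "k \<le> p t"
  shows "k \<le> n \<and> (\<exists>T\<subseteq>pi_squares (p ` {1..t}). finite T \<and> \<Sum>T = n - k)"
proof -
  define \<pi> where "\<pi> = p ` {1..t}"
  have i: "t - 1 \<in> {1..t}" "t \<in> {1..t}" "t - 1 < t" using t by auto
  have lt: "p (t - 1) < p t" using mono i unfolding strict_mono_on_def by blast
  have mem: "p (t - 1) \<in> \<pi>" "p t \<in> \<pi>" using i by (auto simp: \<pi>_def)
  have pr: "prime (p (t - 1))" "prime (p t)" using p i by auto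
  have "odd (p (t - 1))" using p i by auto
  hence p3: "3 \<le> p (t - 1)" using prime_ge_2_nat[OF pr(1)] by (cases "p (t - 1) = 2") auto
  have inf: "infinite (pi_squares \<pi>)" by (rule infinite_pi_squares[OF pr(2) mem(2)])
  consider "real n > N_plus p t"
    | B C where "admissible_B \<pi> B" "admissible_C \<pi> B C" "real n > N_minus p t C"
    using N unfolding is_N_def Let_def \<pi>_def by (auto simp: min_def split: if_splits)
  thus ?thesis
  proof cases
    case 1
    have gt: "real n > real (p t) + 2 ^ (2 ^ (2 ^ Omega p t))" using 1 by (simp only: N_plus_def)
    moreover have "0 < (2::real) ^ (2 ^ (2 ^ Omega p t))" by simp
    ultimately have "real (p t) < real n" by linarith
    hence kn: "k \<le> n" using k by simp
    hence "real (n - k) > 2 ^ (2 ^ (2 ^ (p t ^ (4 * (p (t - 1))\<^sup>2))))"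
      using gt k unfolding Omega_def by (simp only: of_nat_diff)
    with two_prime_squares_cover[OF pr p3 lt power_mult_square_in_pi_squares[OF pr mem]] kn
    show ?thesis unfolding \<pi>_def by blast
  next
    case 2
    have BC: "B \<ge> 2 ^ (2 ^ 40)" "C \<ge> B" using 2 by (simp_all only: admissible_B_def admissible_C_def)
    have "(0::real) \<le> 2 ^ (2 ^ 40)" by (rule zero_le_power) simp
    hence B0: "B \<ge> 0" using BC(1) by (rule order_trans)
    have gt: "real n > real (p t) + max (C ^ 10) (2 ^ (2 ^ (2 ^ 400)))" using 2(3) by (simp only: N_minus_def)
    have "C ^ 10 \<le> max (C ^ 10) (2 ^ (2 ^ (2 ^ 400)))" by (rule max.cobounded1)
    hence gt: "real (p t) + C ^ 10 < real n" using gt by (rule le_less_trans[OF add_left_mono])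
    have "0 \<le> C ^ 10" using B0 BC(2) by simp
    hence "real (p t) < real n" using gt by linarith
    hence kn: "k \<le> n" using k by simp
    hence nk: "C ^ 10 < real (n - k)" using gt k by (simp only: of_nat_diff)
    have "\<exists>T\<subseteq>pi_squares \<pi>. finite T \<and> \<Sum>T = n - k"
    proof (rule subset_sums_cover[OF BC(1) _ BC(2) _ nk])
      fix x assume x: "B \<le> x"
      hence "2 ^ 20 * log 2 (log 2 x) < real (S \<pi> (2 * x)) - real (S \<pi> x)"
        using 2(1) unfolding admissible_B_def by (elim conjE) (rule allE, assumption, simp only: simp_thms)
      thus "2 ^ 20 * log 2 (log 2 x) < real (card {a \<in> pi_squares \<pi>. x < real a \<and> real a \<le> 2 * x})"
        using S_diff[of x \<pi>] x B0 by (simp only: order_trans[OF B0 x])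
    next
      fix \<theta> assume "1 / (4 * B) \<le> \<theta>" "\<theta> \<le> 1 - 1 / (4 * B)"
      hence "2 * log 2 B + 50 < (\<Sum>s = 1..S \<pi> C. (dist_int (real (pi_square_seq \<pi> s) * \<theta>))\<^sup>2)"
        using 2(2) unfolding admissible_C_def by blast
      thus "2 * log 2 B + 50 < (\<Sum>a | a \<in> pi_squares \<pi> \<and> real a \<le> C. (dist_int (real a * \<theta>))\<^sup>2)"
        using sum_pi_square_seq[OF inf, of "\<lambda>a. (dist_int (real a * \<theta>))\<^sup>2" C] by simp
    qed
    thus ?thesis using kn by (simp add: \<pi>_def)
  qed
qed

section \<open>Gauss sums\<close>

lemma rat_adjoin_add: "x \<in> rat_adjoin Y \<Longrightarrow> y \<in> rat_adjoin Y \<Longrightarrow> x + y \<in> rat_adjoin Y"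
  and rat_adjoin_mult: "x \<in> rat_adjoin Y \<Longrightarrow> y \<in> rat_adjoin Y \<Longrightarrow> x * y \<in> rat_adjoin Y"
  using generate_field.eng_add[of x ring_of_type_algebra "\<rat> \<union> Y" y]
    generate_field.eng_mult[of x ring_of_type_algebra "\<rat> \<union> Y" y]
  by (simp_all add: rat_adjoin_def ring_of_type_algebra_def)

lemma rat_adjoin_Rats: "x \<in> \<rat> \<Longrightarrow> x \<in> rat_adjoin Y"
  and rat_adjoin_incl: "x \<in> Y \<Longrightarrow> x \<in> rat_adjoin Y"
  unfolding rat_adjoin_def by (auto intro: generate_field.incl)

lemma rat_adjoin_of_int_mult: "x \<in> rat_adjoin Y \<Longrightarrow> of_int k * x \<in> rat_adjoin Y"
  by (rule rat_adjoin_mult[OF rat_adjoin_Rats]) auto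

lemma rat_adjoin_uminus: "x \<in> rat_adjoin Y \<Longrightarrow> - x \<in> rat_adjoin Y"
  using rat_adjoin_of_int_mult[of x Y "-1"] by simp

lemma rat_adjoin_diff: "x \<in> rat_adjoin Y \<Longrightarrow> y \<in> rat_adjoin Y \<Longrightarrow> x - y \<in> rat_adjoin Y"
  using rat_adjoin_add[of x Y "- y"] rat_adjoin_uminus by simp

lemma rat_adjoin_sum: "(\<And>i. i \<in> A \<Longrightarrow> f i \<in> rat_adjoin Y) \<Longrightarrow> sum f A \<in> rat_adjoin Y"
  by (induction A rule: infinite_finite_induct) (auto intro: rat_adjoin_add rat_adjoin_Rats)

lemma rat_adjoin_of_nat: "of_nat k \<in> rat_adjoin Y"
  by (rule rat_adjoin_Rats) simp

lemma rat_adjoin_mono: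
  assumes "Y \<subseteq> rat_adjoin Y'"
  shows "rat_adjoin Y \<subseteq> rat_adjoin Y'"
proof
  fix x assume "x \<in> rat_adjoin Y"
  hence "x \<in> generate_field (ring_of_type_algebra :: complex ring) (\<rat> \<union> Y)" by (simp add: rat_adjoin_def)
  thus "x \<in> rat_adjoin Y'"
  proof induction
    case (incl h)
    thus ?case using assms rat_adjoin_Rats by auto
  qed (auto simp: rat_adjoin_def intro: generate_field.intros)
qed

lemma root_of_unity_pow_mod:
  fixes z :: complex
  assumes "z ^ m = 1"
  shows "z ^ (n mod m) = z ^ n"
proof -
  have "z ^ n = z ^ (m * (n div m) + n mod m)" by simp
  also have "\<dots> = z ^ (n mod m)" by (simp only: power_add power_mult assms power_one mult_1_left)
  finally show ?thesis by simp
qed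

lemma root_of_unity_pow_cong:
  fixes z :: complex
  assumes "z ^ m = 1" "[a = b] (mod m)"
  shows "z ^ a = z ^ b"
  using root_of_unity_pow_mod[OF assms(1), of a] root_of_unity_pow_mod[OF assms(1), of b] assms(2)
  by (simp add: cong_def)

lemma prime_root_of_unity_pow_neq_1:
  fixes z :: complex
  assumes "prime p" "z ^ p = 1" "z \<noteq> 1" "\<not> p dvd j"
  shows "z ^ j \<noteq> 1"
proof
  assume j: "z ^ j = 1"
  have "coprime j p" using assms prime_imp_coprime coprime_commute by blast
  then obtain x where "[j * x = Suc 0] (mod p)" using cong_solve_coprime_nat by blast
  hence "z ^ (j * x) = z ^ Suc 0" by (rule root_of_unity_pow_cong[OF assms(2)])
  thus False using j assms(3) by (simp add: power_mult)
qed

lemma sum_powers_root_of_unity: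
  fixes w :: complex
  assumes "w ^ n = 1"
  shows "(\<Sum>s<n. w ^ s) = (if w = 1 then of_nat n else 0)"
  using geometric_sum[of w n] assms by auto

lemma sum_shift_periodic:
  fixes f :: "nat \<Rightarrow> 'a::ab_group_add"
  assumes "\<And>n. f (n + m) = f n"
  shows "(\<Sum>d<m. f (k + d)) = (\<Sum>d<m. f d)"
proof (induction k)
  case (Suc k)
  have "(\<Sum>d<m. f (Suc k + d)) + f k = (\<Sum>d<Suc m. f (k + d))"
    by (subst sum.lessThan_Suc_shift) (simp add: add.commute)
  also have "\<dots> = (\<Sum>d<m. f (k + d)) + f (k + m)" by simp
  finally show ?case using Suc assms[of k] by simp
qed simp

lemma sum_lessThan_add: "(\<Sum>j<m + n. f j) = (\<Sum>j<m. f j) + (\<Sum>j<n. f (m + j))"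
  for f :: "nat \<Rightarrow> 'a::comm_monoid_add"
  by (induction n) (auto simp: add_ac)

lemma sum_units_primroot:
  fixes f :: "nat \<Rightarrow> complex"
  assumes p: "prime p" "residue_primroot p g" and f: "\<And>n. f (n mod p) = f n"
  shows "(\<Sum>i<p - 1. f (g ^ i)) = (\<Sum>l\<in>{1..<p}. f l)"
proof -
  have p1: "1 < p" using prime_gt_1_nat p by blast
  have "totatives p = {1..<p}"
    using p(1) by (auto simp: totatives_prime prime_gt_0_nat)
  hence "bij_betw (\<lambda>i. g ^ i mod p) {..<p - 1} {1..<p}"
    using residue_primroot_is_generator[OF p1 p(2)] p(1) by (simp add: totient_prime)
  hence "(\<Sum>l\<in>{1..<p}. f l) = (\<Sum>i<p - 1. f (g ^ i mod p))"
    by (rule sum.reindex_bij_betw[symmetric])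
  thus ?thesis by (simp add: f)
qed

text \<open>\<open>z\<close> is a primitive \<open>p\<close>-th root of unity. The primitive root
  \<open>g\<close> turns the quadratic character into the parity of an exponent, so the arguments
  below are shifts of index ranges.\<close>

locale gauss_sum =
  fixes p g :: nat and z :: complex
  assumes prime_p: "prime p" and odd_p: "odd p" and primroot: "residue_primroot p g"
    and z_pow: "z ^ p = 1" and z_neq: "z \<noteq> 1"
begin

definition G :: "nat \<Rightarrow> complex" where "G k = (\<Sum>l<p. z ^ (k * l\<^sup>2))"

lemma p_gt_1: "p > 1" using prime_p prime_gt_1_nat by blast

lemma g_order: "[g ^ (p - 1) = 1] (mod p)"
proof -
  have "coprime g p" using primroot by (auto simp: residue_primroot_def coprime_commute)
  thus ?thesis using euler_theorem[of g p] totient_prime[OF prime_p] by simp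
qed

lemma pow_g_periodic: "z ^ (a * g ^ (n + (p - 1)) * b) = z ^ (a * g ^ n * b)"
proof (rule root_of_unity_pow_cong[OF z_pow])
  have "[a * (g ^ n * g ^ (p - 1)) * b = a * (g ^ n * 1) * b] (mod p)"
    by (intro cong_mult cong_refl g_order)
  thus "[a * g ^ (n + (p - 1)) * b = a * g ^ n * b] (mod p)" by (simp add: power_add)
qed

lemma mod_periodic: "z ^ (k * (n mod p)\<^sup>2) = z ^ (k * n\<^sup>2)"
  by (rule root_of_unity_pow_cong[OF z_pow]) (intro cong_mult cong_pow cong_refl, simp add: cong_def)

lemma G_primroot: "G k = 1 + (\<Sum>i<p - 1. z ^ (k * g ^ (2 * i)))"
proof -
  have "{..<p} = insert 0 {1..<p}" using p_gt_1 by auto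
  hence "G k = 1 + (\<Sum>l\<in>{1..<p}. z ^ (k * l\<^sup>2))" by (simp add: G_def)
  also have "(\<Sum>l\<in>{1..<p}. z ^ (k * l\<^sup>2)) = (\<Sum>i<p - 1. z ^ (k * (g ^ i)\<^sup>2))"
    by (rule sum_units_primroot[OF prime_p primroot, symmetric]) (rule mod_periodic)
  finally show ?thesis by (simp add: power_mult[symmetric] mult.commute)
qed

lemma even_p1: "even (p - 1)" using odd_p by simp

lemma sum_even_odd: "(\<Sum>i<n. h (2 * i)) + (\<Sum>i<n. h (2 * i + 1)) = (\<Sum>j<2 * n. h j)"
  for h :: "nat \<Rightarrow> complex"
  by (induction n) (auto simp: algebra_simps)

lemma sum_primroot: "(\<Sum>i<p - 1. z ^ (g ^ i)) = - 1"
proof -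
  have "(\<Sum>i<p - 1. z ^ (g ^ i)) = (\<Sum>l\<in>{1..<p}. z ^ l)"
    by (rule sum_units_primroot[OF prime_p primroot]) (rule root_of_unity_pow_mod[OF z_pow])
  moreover have "(\<Sum>l<p. z ^ l) = 0" using sum_powers_root_of_unity[OF z_pow] z_neq by simp
  moreover have "{..<p} = insert 0 {1..<p}" using p_gt_1 by auto
  ultimately show ?thesis by (simp add: eq_neg_iff_add_eq_0 add.commute)
qed

text \<open>The exponents \<open>2 * i\<close> and \<open>2 * i + 1\<close> run twice through a period of \<open>g ^ j\<close> modulo \<open>p\<close>.\<close>

lemma G_neg: "G 1 + G g = 0"
proof -
  define h where "h j = z ^ (g ^ j)" for j
  have per: "h (n + (p - 1)) = h n" for n using pow_g_periodic[of 1 n 1] by (simp add: h_def)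
  have "G 1 + G g = 2 + ((\<Sum>i<p - 1. h (2 * i)) + (\<Sum>i<p - 1. h (2 * i + 1)))"
    by (simp add: G_primroot h_def)
  also have "\<dots> = 2 + (\<Sum>j<2 * (p - 1). h j)" by (simp only: sum_even_odd)
  also have "(\<Sum>j<2 * (p - 1). h j) = (\<Sum>j<p - 1. h j) + (\<Sum>j<p - 1. h ((p - 1) + j))"
    unfolding mult_2 by (rule sum_lessThan_add)
  also have "\<dots> = - 2" using sum_shift_periodic[of h "p - 1" "p - 1"] per sum_primroot by (simp add: h_def)
  finally show ?thesis by simp
qed

lemma G_pow_2: "G (k * g\<^sup>2) = G k"
proof -
  define h where "h i = z ^ (k * g ^ (2 * i))" for i
  have per: "h (n + (p - 1)) = h n" for n
  proof -
    have "z ^ (k * g ^ (2 * n + (p - 1) + (p - 1)) * 1) = z ^ (k * g ^ (2 * n) * 1)"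
      by (simp only: pow_g_periodic)
    thus ?thesis by (simp add: h_def mult_2 add_ac)
  qed
  have "G (k * g\<^sup>2) = 1 + (\<Sum>i<p - 1. h (1 + i))"
    by (simp add: G_primroot h_def mult.assoc power2_eq_square)
  also have "\<dots> = G k" using sum_shift_periodic[of h "p - 1" 1] per by (simp add: G_primroot h_def)
  finally show ?thesis .
qed

lemma G_pow: "G (g ^ j) = (- 1) ^ j * G 1"
proof (induction j rule: nat_less_induct)
  case (1 j)
  consider "j = 0" | "j = 1" | k where "j = k + 2" by (metis One_nat_def add_2_eq_Suc' not0_implies_Suc)
  thus ?case
  proof cases
    case 3
    thus ?thesis using 1 G_pow_2[of "g ^ k"] by (simp add: power_add power2_eq_square mult_ac)
  qed (use G_neg in \<open>auto simp: eq_neg_iff_add_eq_0 add.commute\<close>)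
qed

lemma G_cong: "[a = b] (mod p) \<Longrightarrow> G a = G b"
  unfolding G_def by (intro sum.cong refl root_of_unity_pow_cong[OF z_pow] cong_mult) auto

text \<open>\<open>p - 1\<close> stands for -1 in natural exponents. It is congruent to
  \<open>g ^ ((p - 1) div 2)\<close>, whose square is 1 and which is not 1 because \<open>g\<close>
  has order \<open>p - 1\<close>.\<close>

lemma G_minus: "G (p - 1) = (- 1) ^ ((p - 1) div 2) * G 1"
proof -
  define h where "h = g ^ ((p - 1) div 2)"
  have "h\<^sup>2 = g ^ (p - 1)" using even_p1 by (simp add: h_def flip: power_mult)
  hence "[h\<^sup>2 = 1] (mod p)" using g_order by simp
  hence "[(int h)\<^sup>2 = 1] (mod int p)" by (metis cong_int_iff of_nat_1 of_nat_power)
  hence "int p dvd (int h - 1) * (int h + 1)" by (simp add: cong_iff_dvd_diff power2_eq_square algebra_simps)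
  hence "int p dvd int h - 1 \<or> int p dvd int h + 1" using prime_p by (simp add: prime_dvd_mult_iff)
  moreover have "\<not> int p dvd int h - 1"
  proof
    assume "int p dvd int h - 1"
    hence "[h = 1] (mod p)" by (metis cong_iff_dvd_diff cong_int_iff of_nat_1)
    hence "ord p g dvd (p - 1) div 2" using ord_divides[of g "(p - 1) div 2" p] by (simp add: h_def)
    moreover have "ord p g = p - 1" using primroot totient_prime[OF prime_p] by (simp add: residue_primroot_def)
    ultimately have "p - 1 dvd (p - 1) div 2" by simp
    moreover have "0 < (p - 1) div 2" using p_gt_1 odd_p by presburger
    ultimately have "p - 1 \<le> (p - 1) div 2" by (rule dvd_imp_le)
    thus False using p_gt_1 by linarith
  qed
  ultimately have "int p dvd int h + 1" by blast
  hence "[int h = int (p - 1)] (mod int p)" using p_gt_1 by (simp add: cong_iff_dvd_diff of_nat_diff) (metis diff_diff_eq2 dvd_diff_right_iff dvd_refl add.commute)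
  hence "[h = p - 1] (mod p)" by (simp only: cong_int_iff)
  thus ?thesis using G_cong G_pow by (metis h_def)
qed

text \<open>Substituting \<open>l = k + d\<close> turns the exponent
  \<open>l\<^sup>2 - k\<^sup>2\<close> into \<open>d\<^sup>2 + 2 * d * k\<close>; the geometric sum
  over \<open>k\<close> vanishes unless \<open>d = 0\<close>.\<close>

lemma G_mult: "G 1 * G (p - 1) = of_nat p"
proof -
  have "G 1 * G (p - 1) = (\<Sum>k<p. (\<Sum>l<p. z ^ (1 * l\<^sup>2)) * z ^ ((p - 1) * k\<^sup>2))"
    by (simp add: G_def sum_distrib_left)
  also have "\<dots> = (\<Sum>k<p. \<Sum>d<p. z ^ d\<^sup>2 * (z ^ (2 * d)) ^ k)"
  proof (rule sum.cong[OF refl])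
    fix k
    have "(\<Sum>l<p. z ^ (1 * l\<^sup>2)) = (\<Sum>d<p. z ^ (1 * (k + d)\<^sup>2))"
    proof (rule sum_shift_periodic[symmetric])
      fix n show "z ^ (1 * (n + p)\<^sup>2) = z ^ (1 * n\<^sup>2)"
        using mod_periodic[of 1 "n + p"] mod_periodic[of 1 n] by simp
    qed
    also have "\<dots> * z ^ ((p - 1) * k\<^sup>2) = (\<Sum>d<p. z ^ ((k + d)\<^sup>2 + (p - 1) * k\<^sup>2))"
      by (simp add: sum_distrib_right power_add)
    also have "\<dots> = (\<Sum>d<p. z ^ d\<^sup>2 * (z ^ (2 * d)) ^ k)"
    proof (rule sum.cong[OF refl])
      fix d
      have "p * k\<^sup>2 = (p - 1) * k\<^sup>2 + k\<^sup>2" using p_gt_1 by (cases p) auto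
      hence "(k + d)\<^sup>2 + (p - 1) * k\<^sup>2 = d\<^sup>2 + 2 * d * k + p * k\<^sup>2"
        by (simp add: power2_eq_square algebra_simps)
      thus "z ^ ((k + d)\<^sup>2 + (p - 1) * k\<^sup>2) = z ^ d\<^sup>2 * (z ^ (2 * d)) ^ k"
        by (simp only: power_add power_mult z_pow power_one mult_1_right)
    qed
    finally show "(\<Sum>l<p. z ^ (1 * l\<^sup>2)) * z ^ ((p - 1) * k\<^sup>2) = (\<Sum>d<p. z ^ d\<^sup>2 * (z ^ (2 * d)) ^ k)" .
  qed
  also have "\<dots> = (\<Sum>d<p. z ^ d\<^sup>2 * (\<Sum>k<p. (z ^ (2 * d)) ^ k))"
    by (subst sum.swap) (simp add: sum_distrib_left)
  also have "\<dots> = (\<Sum>d<p. if d = 0 then of_nat p else 0)"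
  proof (rule sum.cong[OF refl])
    fix d assume d: "d \<in> {..<p}"
    have pw: "(z ^ (2 * d)) ^ p = 1" by (metis power_commutes power_mult power_one z_pow mult.commute)
    have "z ^ (2 * d) = 1 \<longleftrightarrow> d = 0"
    proof
      assume "z ^ (2 * d) = 1"
      hence "p dvd 2 * d" using prime_root_of_unity_pow_neq_1[OF prime_p z_pow z_neq] by blast
      hence "p dvd d" using prime_p odd_p by (metis prime_dvd_mult_iff primes_dvd_imp_eq two_is_prime_nat odd_numeral even_numeral dvd_refl)
      thus "d = 0" using d by (auto dest: dvd_imp_le)
    qed simp
    thus "z ^ d\<^sup>2 * (\<Sum>k<p. (z ^ (2 * d)) ^ k) = (if d = 0 then of_nat p else 0)"
      using sum_powers_root_of_unity[OF pw] by simp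
  qed
  also have "\<dots> = of_nat p" using p_gt_1 by (simp add: sum.delta)
  finally show ?thesis .
qed

lemma G_square: "(G 1)\<^sup>2 = of_int (odd_star p)"
proof -
  define s :: complex where "s = (- 1) ^ ((p - 1) div 2)"
  have ss: "s * s = 1" by (simp add: s_def flip: power_add mult_2)
  have "of_int (odd_star p) = s * of_nat p" by (simp add: odd_star_def s_def)
  also have "\<dots> = s * (G 1 * (s * G 1))" unfolding G_mult[symmetric] G_minus s_def ..
  also have "\<dots> = (s * s) * (G 1)\<^sup>2" by (simp only: power2_eq_square mult_ac)
  finally show ?thesis by (simp add: ss)
qed

lemma G_csqrt: "G 1 = csqrt (of_int (odd_star p)) \<or> G 1 = - csqrt (of_int (odd_star p))"
  using G_square power2_csqrt[of "of_int (odd_star p)"] by (metis power2_eq_iff)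

end

section \<open>Sums over the squares of units modulo an odd number\<close>

abbreviation star_field :: "nat set \<Rightarrow> complex set" where
  "star_field \<pi> \<equiv> rat_adjoin ((\<lambda>p. csqrt (of_int (odd_star p))) ` \<pi>)"

text \<open>\<open>z\<close> need not be primitive: it will be an eigenvalue of a representing
  matrix, whose order may be any divisor of \<open>m\<close>.\<close>

definition unit_square_sum :: "nat \<Rightarrow> complex \<Rightarrow> complex" where
  "unit_square_sum m z = (\<Sum>l\<in>totatives m. z ^ l\<^sup>2)"

lemma totatives_prime_power:
  assumes "prime p" "e > 0"
  shows "totatives (p ^ e) = {l. l < p ^ e \<and> \<not> p dvd l}"
proof -
  have "p ^ e > 1" using prime_gt_1_nat[OF assms(1)] assms(2) by (intro one_less_power) auto
  have "coprime l (p ^ e) \<longleftrightarrow> \<not> p dvd l" for l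
    using assms prime_imp_coprime[of p l] coprime_commute[of l p] by (auto simp: coprime_power_right_iff dest: not_coprimeI)
  moreover have "l \<noteq> p ^ e" if "\<not> p dvd l" for l using that assms by auto
  ultimately show ?thesis unfolding totatives_def
    by (auto simp: le_less intro: gr0I)
qed

lemma unit_square_sum_prime:
  assumes "prime p" "odd p" "p \<in> \<pi>" "z ^ p = 1"
  shows "unit_square_sum p z \<in> star_field \<pi>"
proof (cases "z = 1")
  case True
  thus ?thesis by (auto simp: unit_square_sum_def intro!: rat_adjoin_sum rat_adjoin_Rats)
next
  case False
  obtain g where g: "residue_primroot p g"
    using prime_primitive_root_exists prime_gt_1_nat assms(1) by blast
  interpret gauss_sum p g z by unfold_locales (use assms False g in auto)
  have "totatives p = {1..<p}" using assms(1) by (auto simp: totatives_prime)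
  moreover have "{..<p} = insert 0 {1..<p}" using p_gt_1 by auto
  ultimately have "unit_square_sum p z = G 1 - 1" by (simp add: unit_square_sum_def G_def)
  moreover have "csqrt (of_int (odd_star p)) \<in> star_field \<pi>"
    using assms(3) by (intro rat_adjoin_incl) auto
  hence "G 1 \<in> star_field \<pi>" using G_csqrt rat_adjoin_uminus by metis
  ultimately show ?thesis using rat_adjoin_diff[OF _ rat_adjoin_Rats[OF Rats_1]] by simp
qed

text \<open>For exponents above 1 write \<open>l = a + p ^ e * s\<close>. Modulo
  \<open>p ^ Suc e\<close> only the cross term of the square depends on \<open>s\<close>, so the sum
  over \<open>s\<close> is geometric with ratio \<open>w ^ (2 * a)\<close>. It vanishes unless
  \<open>w = 1\<close>, and then \<open>p\<close> copies of the sum for \<open>p ^ e\<close> remain.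
  Only the sum modulo \<open>p\<close> itself needs a Gauss sum.\<close>

lemma unit_square_sum_prime_power:
  assumes p: "prime p" "odd p" "p \<in> \<pi>" and e: "e > 0" and z: "z ^ (p ^ e) = 1"
  shows "unit_square_sum (p ^ e) z \<in> star_field \<pi>"
  using e z
proof (induction e)
  case (Suc e)
  show ?case
  proof (cases "e = 0")
    case True
    thus ?thesis using unit_square_sum_prime[OF p, of z] Suc.prems by simp
  next
    case False
    define w where "w = z ^ (p ^ e)"
    have wp: "w ^ p = 1" using Suc.prems by (simp add: w_def mult.commute flip: power_mult)
    have p1: "p > 0" using prime_gt_0_nat p by blast
    have p_dvd: "p dvd p ^ e" using False by auto
    have bij: "bij_betw (\<lambda>(a, s). a + p ^ e * s) (totatives (p ^ e) \<times> {..<p}) (totatives (p ^ Suc e))"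
    proof (rule bij_betwI[where g = "\<lambda>l. (l mod p ^ e, l div p ^ e)"])
      show "(\<lambda>(a, s). a + p ^ e * s) \<in> totatives (p ^ e) \<times> {..<p} \<rightarrow> totatives (p ^ Suc e)"
      proof
        fix x assume "x \<in> totatives (p ^ e) \<times> {..<p}"
        then obtain a s where x: "x = (a, s)" "a < p ^ e" "\<not> p dvd a" "s < p"
          using totatives_prime_power[OF p(1), of e] False by auto
        have "a + p ^ e * s < p ^ e * Suc s" using x by simp
        also have "\<dots> \<le> p ^ e * p" using x by (intro mult_left_mono) auto
        finally have "a + p ^ e * s < p ^ Suc e" by (simp add: mult.commute)
        moreover have "\<not> p dvd a + p ^ e * s" using x p_dvd by (simp add: dvd_add_left_iff)
        ultimately show "(case x of (a, s) \<Rightarrow> a + p ^ e * s) \<in> totatives (p ^ Suc e)"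
          unfolding totatives_prime_power[OF p(1) zero_less_Suc] x by simp
      qed
      show "(\<lambda>l. (l mod p ^ e, l div p ^ e)) \<in> totatives (p ^ Suc e) \<rightarrow> totatives (p ^ e) \<times> {..<p}"
      proof
        fix l assume "l \<in> totatives (p ^ Suc e)"
        hence l: "l < p ^ Suc e" "\<not> p dvd l" unfolding totatives_prime_power[OF p(1) zero_less_Suc] by auto
        have "l div p ^ e < p" using l(1) p1 by (simp add: less_mult_imp_div_less mult.commute)
        moreover have "\<not> p dvd l mod p ^ e" using l(2) p_dvd by (simp add: dvd_mod_iff)
        ultimately show "(l mod p ^ e, l div p ^ e) \<in> totatives (p ^ e) \<times> {..<p}"
          using totatives_prime_power[OF p(1), of e] False p1 by simp
      qed
      show "(\<lambda>l. (l mod p ^ e, l div p ^ e)) ((\<lambda>(a, s). a + p ^ e * s) x) = x"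
        if xm: "x \<in> totatives (p ^ e) \<times> {..<p}" for x
      proof -
        obtain a s where x: "x = (a, s)" "a < p ^ e"
          using xm totatives_prime_power[OF p(1), of e] False by auto
        thus ?thesis using p1 by simp
      qed
      show "(\<lambda>(a, s). a + p ^ e * s) ((\<lambda>l. (l mod p ^ e, l div p ^ e)) l) = l" for l by simp
    qed
    have "unit_square_sum (p ^ Suc e) z = (\<Sum>(a, s)\<in>totatives (p ^ e) \<times> {..<p}. z ^ (a + p ^ e * s)\<^sup>2)"
      unfolding unit_square_sum_def using sum.reindex_bij_betw[OF bij, of "\<lambda>l. z ^ l\<^sup>2", symmetric]
      by (simp only: case_prod_unfold)
    also have "\<dots> = (\<Sum>a\<in>totatives (p ^ e). \<Sum>s<p. z ^ (a + p ^ e * s)\<^sup>2)"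
      by (rule sum.cartesian_product[symmetric])
    also have "\<dots> = (\<Sum>a\<in>totatives (p ^ e). z ^ a\<^sup>2 * (\<Sum>s<p. (w ^ (2 * a)) ^ s))"
      unfolding sum_distrib_left
    proof (intro sum.cong refl)
      fix a s :: nat
      have sq: "(a + x * s)\<^sup>2 = a\<^sup>2 + x * (2 * a) * s + (x * x) * s\<^sup>2" for x
        by (simp add: power2_eq_square algebra_simps)
      have "p ^ e * p ^ e = p ^ Suc e * p ^ (e - 1)" using False by (cases e) auto
      hence "(a + p ^ e * s)\<^sup>2 = a\<^sup>2 + p ^ e * (2 * a) * s + p ^ Suc e * (p ^ (e - 1) * s\<^sup>2)"
        by (simp only: sq mult.assoc[of "p ^ Suc e"])
      thus "z ^ (a + p ^ e * s)\<^sup>2 = z ^ a\<^sup>2 * (w ^ (2 * a)) ^ s"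
        by (simp only: power_add power_mult w_def Suc.prems(2) power_one mult_1_right)
    qed
    finally have eq: "unit_square_sum (p ^ Suc e) z = (\<Sum>a\<in>totatives (p ^ e). z ^ a\<^sup>2 * (\<Sum>s<p. (w ^ (2 * a)) ^ s))" .
    show ?thesis
    proof (cases "w = 1")
      case True
      hence "unit_square_sum (p ^ Suc e) z = unit_square_sum (p ^ e) z * of_nat p"
        using eq by (simp add: unit_square_sum_def sum_distrib_right)
      thus ?thesis using Suc.IH False True
        by (auto simp: w_def intro!: rat_adjoin_mult rat_adjoin_of_nat)
    next
      case w: False
      have "(\<Sum>s<p. (w ^ (2 * a)) ^ s) = 0" if "a \<in> totatives (p ^ e)" for a
      proof -
        have "\<not> p dvd a" using that totatives_prime_power[OF p(1), of e] False by auto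
        moreover have "\<not> p dvd 2" using p primes_dvd_imp_eq[of p 2] two_is_prime_nat by auto
        ultimately have "\<not> p dvd 2 * a" using p(1) by (simp add: prime_dvd_mult_iff)
        hence "w ^ (2 * a) \<noteq> 1" by (rule prime_root_of_unity_pow_neq_1[OF p(1) wp w])
        moreover have "(w ^ (2 * a)) ^ p = 1" by (metis wp mult.commute power_mult power_one)
        ultimately show ?thesis using sum_powers_root_of_unity by simp
      qed
      hence "unit_square_sum (p ^ Suc e) z = 0" using eq by simp
      thus ?thesis by (auto intro: rat_adjoin_Rats)
    qed
  qed
qed simp

text \<open>After splitting off a full prime power \<open>a\<close>, the Chinese remainder exponents
  \<open>b * y\<close> and \<open>a * x\<close> factor \<open>z\<close> into an \<open>a\<close>-th
  and a \<open>b\<close>-th root of unity, and the sum over the units modulo \<open>a * b\<close>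
  becomes a product.\<close>

lemma unit_square_sum_in_star_field:
  assumes "m > 0" "odd m" "prime_factors m \<subseteq> \<pi>" "z ^ m = 1"
  shows "unit_square_sum m z \<in> star_field \<pi>"
  using assms
proof (induction m arbitrary: z rule: less_induct)
  case (less m)
  show ?case
  proof (cases "m = 1")
    case True
    thus ?thesis using less.prems by (auto simp: unit_square_sum_def intro: rat_adjoin_Rats)
  next
    case False
    then obtain p where p: "prime p" "p dvd m" using prime_factor_nat by blast
    define e where "e = multiplicity p m"
    define a b where "a = p ^ e" and "b = m div p ^ e"
    have m: "m = a * b" by (simp add: a_def b_def e_def multiplicity_dvd)
    have e: "e > 0" using p less.prems(1) by (simp add: e_def prime_multiplicity_gt_zero_iff)
    have "\<not> p dvd b" using less.prems(1) p(1) unfolding b_def e_def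
      by (intro multiplicity_decompose) auto
    hence cop: "coprime a b" using p(1) by (simp add: a_def prime_imp_coprime)
    have pp: "odd p" "p \<in> \<pi>" using p less.prems by (auto simp: prime_factors_dvd)
    have a1: "a > 1" using prime_gt_1_nat[OF p(1)] e unfolding a_def by (intro one_less_power) auto
    show ?thesis
    proof (cases "b = 1")
      case True
      thus ?thesis using unit_square_sum_prime_power[OF p(1) pp e, of z] less.prems m by (simp add: a_def)
    next
      case b: False
      hence b1: "b > 1" using less.prems(1) m by (cases b) auto
      obtain x where x: "[a * x = Suc 0] (mod b)" using cong_solve_coprime_nat[OF cop] by blast
      obtain y where y: "[b * y = Suc 0] (mod a)" using cong_solve_coprime_nat cop coprime_commute by blast
      define z1 z2 where "z1 = z ^ (b * y)" and "z2 = z ^ (a * x)"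
      have za: "z1 ^ a = 1"
      proof -
        have "z1 ^ a = (z ^ m) ^ y" by (simp add: z1_def m mult_ac flip: power_mult)
        thus ?thesis using less.prems by simp
      qed
      have zb: "z2 ^ b = 1"
      proof -
        have "z2 ^ b = (z ^ m) ^ x" by (simp add: z2_def m mult_ac flip: power_mult)
        thus ?thesis using less.prems by simp
      qed
      have "[b * y + a * x = 1] (mod a)" using cong_add[OF y, of "a * x" 0] by (simp add: cong_0_iff)
      moreover have "[b * y + a * x = 1] (mod b)" using cong_add[OF _ x, of "b * y" 0] by (simp add: cong_0_iff)
      ultimately have "[b * y + a * x = 1] (mod m)" unfolding m using cop by (rule coprime_cong_mult_nat)
      hence z12: "z1 * z2 = z"
        using root_of_unity_pow_cong[OF less.prems(4), of "b * y + a * x" 1] by (simp add: z1_def z2_def power_add)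
      have sq: "w ^ (l mod k)\<^sup>2 = w ^ l\<^sup>2" if "w ^ k = 1" for w :: complex and l k
        by (rule root_of_unity_pow_cong[OF that]) (intro cong_pow, simp add: cong_def)
      have "unit_square_sum m z = (\<Sum>l\<in>totatives (a * b). (case (l mod a, l mod b) of (i, j) \<Rightarrow> z1 ^ i\<^sup>2 * z2 ^ j\<^sup>2))"
        unfolding unit_square_sum_def m
        by (intro sum.cong refl) (simp add: sq za zb z12 flip: power_mult_distrib)
      also have "\<dots> = (\<Sum>(i, j)\<in>totatives a \<times> totatives b. z1 ^ i\<^sup>2 * z2 ^ j\<^sup>2)"
        by (rule sum.reindex_bij_betw[OF bij_betw_totatives[OF a1 b1 cop]])
      also have "\<dots> = unit_square_sum a z1 * unit_square_sum b z2"
        by (simp add: unit_square_sum_def sum_product sum.cartesian_product)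
      finally have eq: "unit_square_sum m z = unit_square_sum a z1 * unit_square_sum b z2" .
      have "unit_square_sum a z1 \<in> star_field \<pi>"
        using unit_square_sum_prime_power[OF p(1) pp e] za by (simp add: a_def)
      moreover have "unit_square_sum b z2 \<in> star_field \<pi>"
      proof (rule less.IH)
        show "b < m" using a1 b1 m by simp
        show "prime_factors b \<subseteq> \<pi>" using less.prems m by (auto simp: prime_factors_dvd)
      qed (use b1 less.prems m zb in auto)
      ultimately show ?thesis unfolding eq by (rule rat_adjoin_mult)
    qed
  qed
qed

section \<open>Characters of alternating groups\<close>

lemma upper_triangular_mult:
  fixes A B :: "'a::comm_ring_1 mat"
  assumes "A \<in> carrier_mat n n" "B \<in> carrier_mat n n" "upper_triangular A" "upper_triangular B"
  shows "upper_triangular (A * B)" "i < n \<Longrightarrow> (A * B) $$ (i, i) = A $$ (i, i) * B $$ (i, i)"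
proof -
  have entry: "(A * B) $$ (i, j) = (\<Sum>k<n. A $$ (i, k) * B $$ (k, j))" if "i < n" "j < n" for i j
    using assms(1,2) that by (auto simp: scalar_prod_def lessThan_atLeast0 intro!: sum.cong)
  have zero: "A $$ (i, k) * B $$ (k, j) = 0" if "i < n" "j \<le> i" "k < n" "k \<noteq> i \<or> j < i" for i j k
  proof -
    have "k < i \<or> j < k" using that by linarith
    thus ?thesis using that assms unfolding upper_triangular_def by auto
  qed
  show "upper_triangular (A * B)"
  proof (rule upper_triangularI)
    fix i j assume "j < i" "i < dim_row (A * B)"
    thus "(A * B) $$ (i, j) = 0" using assms(1) entry[of i j] zero[of i j] by auto
  qed
  assume i: "i < n"
  have "(\<Sum>k<n. A $$ (i, k) * B $$ (k, i)) = (\<Sum>k\<in>{i}. A $$ (i, k) * B $$ (k, i))"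
    using i zero[of i i] by (intro sum.mono_neutral_right) auto
  thus "(A * B) $$ (i, i) = A $$ (i, i) * B $$ (i, i)" using entry[OF i i] by simp
qed

lemma upper_triangular_pow:
  fixes B :: "'a::comm_ring_1 mat"
  assumes "B \<in> carrier_mat n n" "upper_triangular B"
  shows "upper_triangular (B ^\<^sub>m k) \<and> (\<forall>i<n. (B ^\<^sub>m k) $$ (i, i) = (B $$ (i, i)) ^ k)"
proof (induction k)
  case (Suc k)
  have c: "B ^\<^sub>m k \<in> carrier_mat n n" using assms by simp
  show ?case using upper_triangular_mult[OF c assms(1) _ assms(2)] Suc by (auto simp: mult.commute)
qed (use assms in \<open>auto intro!: upper_triangularI\<close>)

lemma mat_trace_mult_comm:
  fixes A B :: "'a::comm_ring_1 mat"
  assumes "A \<in> carrier_mat n n" "B \<in> carrier_mat n n"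
  shows "mat_trace (A * B) = mat_trace (B * A)"
proof -
  have "mat_trace (A * B) = (\<Sum>i<n. \<Sum>k<n. A $$ (i, k) * B $$ (k, i))" if "A \<in> carrier_mat n n" "B \<in> carrier_mat n n" for A B :: "'a mat"
    unfolding mat_trace_def using that by (auto simp: scalar_prod_def lessThan_atLeast0 intro!: sum.cong)
  from this[OF assms] this[OF assms(2,1)] show ?thesis
    by (subst (asm) (2) sum.swap) (simp add: mult.commute)
qed

text \<open>One triangular form serves all powers, since the diagonal of a power of a triangular
  matrix consists of the powers of its diagonal. The same numbers \<open>e i\<close> for all
  \<open>k\<close> are what allows averaging a character over powers of an element.\<close>

lemma mat_trace_pow_root_of_unity:
  fixes A :: "complex mat"
  assumes A: "A \<in> carrier_mat d d" and m: "A ^\<^sub>m m = 1\<^sub>m d"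
  shows "\<exists>e. (\<forall>i<d. e i ^ m = 1) \<and> (\<forall>k. mat_trace (A ^\<^sub>m k) = (\<Sum>i<d. e i ^ k))"
proof -
  obtain as where "char_poly A = (\<Prod>a\<leftarrow>as. [:- a, 1:])" using char_poly_factorized[OF A] by blast
  from schur_decomposition_exists[OF A this] obtain B where
    B: "B \<in> carrier_mat d d" "upper_triangular B" "similar_mat A B" by blast
  then obtain P Q where w: "similar_mat_wit A B P Q" by (auto simp: similar_mat_def)
  have PQ: "P \<in> carrier_mat d d" "Q \<in> carrier_mat d d" "P * Q = 1\<^sub>m d" "Q * P = 1\<^sub>m d"
    using w A unfolding similar_mat_wit_def Let_def by auto
  have tr: "mat_trace (A ^\<^sub>m k) = (\<Sum>i<d. (B $$ (i, i)) ^ k)" for k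
  proof -
    have Bk: "B ^\<^sub>m k \<in> carrier_mat d d" using B by simp
    have "mat_trace (A ^\<^sub>m k) = mat_trace (P * B ^\<^sub>m k * Q)" using similar_mat_wit_pow_id[OF w] by simp
    also have "\<dots> = mat_trace (Q * (P * B ^\<^sub>m k))" by (rule mat_trace_mult_comm[of _ d]) (use PQ Bk in auto)
    also have "Q * (P * B ^\<^sub>m k) = (Q * P) * B ^\<^sub>m k" by (rule assoc_mult_mat[OF PQ(2,1) Bk, symmetric])
    also have "\<dots> = B ^\<^sub>m k" unfolding PQ(4) by (rule left_mult_one_mat[OF Bk])
    also have "mat_trace (B ^\<^sub>m k) = (\<Sum>i<d. (B $$ (i, i)) ^ k)"
      using upper_triangular_pow[OF B(1,2), of k] Bk by (auto simp: mat_trace_def intro!: sum.cong)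
    finally show ?thesis .
  qed
  have "B ^\<^sub>m m = 1\<^sub>m d"
  proof -
    have "B ^\<^sub>m m = Q * A ^\<^sub>m m * P"
      using similar_mat_wit_pow_id[OF similar_mat_wit_sym[OF w]] .
    thus ?thesis using PQ by (simp add: m)
  qed
  hence "(B $$ (i, i)) ^ m = 1" if "i < d" for i using upper_triangular_pow[OF B(1,2), of m] that by force
  with tr show ?thesis by (intro exI[of _ "\<lambda>i. B $$ (i, i)"]) auto
qed

section \<open>Conjugating a permutation to a coprime power\<close>

lemma funpow_eq_mult:
  fixes f :: "'a \<Rightarrow> 'a"
  assumes "(f ^^ a) y = (f ^^ b) y"
  shows "(f ^^ (k * a)) y = (f ^^ (k * b)) y"
proof (induction k)
  case (Suc k)
  have add: "(f ^^ (i + j)) x = (f ^^ i) ((f ^^ j) x)" for i j x by (simp add: funpow_add)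
  have "(f ^^ (Suc k * a)) y = (f ^^ a) ((f ^^ (k * a)) y)" by (simp add: add)
  also have "\<dots> = (f ^^ (a + k * b)) y" by (simp add: Suc add)
  also have "a + k * b = k * b + a" by simp
  also have "(f ^^ (k * b + a)) y = (f ^^ (k * b + b)) y" by (simp only: add assms)
  also have "k * b + b = Suc k * b" by simp
  finally show ?case .
qed simp

lemma funpow_cong:
  fixes f :: "'a \<Rightarrow> 'a"
  assumes "f ^^ m = id" "[a = b] (mod m)"
  shows "f ^^ a = f ^^ b"
proof -
  have "f ^^ a = f ^^ (a mod m)" for a
  proof -
    have "f ^^ a = f ^^ (m * (a div m) + a mod m)" by simp
    also have "\<dots> = ((f ^^ m) ^^ (a div m)) \<circ> f ^^ (a mod m)" by (simp only: funpow_add funpow_mult)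
    finally show ?thesis by (simp add: assms)
  qed
  from this[of a] this[of b] show ?thesis using assms(2) by (simp add: cong_def)
qed

text \<open>In every orbit with chosen start \<open>r x\<close>, the point reached after
  \<open>i\<close> steps is sent to the one reached after \<open>l * i\<close> steps. The index
  \<open>i\<close> is determined only modulo the orbit length, and \<open>funpow_eq_mult\<close>
  makes its choice harmless. An inverse of \<open>l\<close> modulo \<open>m\<close> yields
  injectivity.\<close>

lemma permutes_funpow_conjugate:
  fixes \<sigma> :: "'a \<Rightarrow> 'a"
  assumes perm: "\<sigma> permutes A" "finite A" and m: "m > 0" "\<sigma> ^^ m = id" and l: "coprime l m"
  shows "\<exists>\<tau>. \<tau> permutes A \<and> \<tau> \<circ> \<sigma> = (\<sigma> ^^ l) \<circ> \<tau>"
proof -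
  define orb where "orb x = {y. \<exists>i. (\<sigma> ^^ i) x = y}" for x
  define r where "r x = (SOME y. y \<in> orb x)" for x
  have add: "(\<sigma> ^^ (i + j)) x = (\<sigma> ^^ i) ((\<sigma> ^^ j) x)" for i j x by (simp add: funpow_add)
  have sym: "x \<in> orb y" if "y \<in> orb x" for x y
  proof -
    obtain i where i: "(\<sigma> ^^ i) x = y" using \<open>y \<in> orb x\<close> by (auto simp: orb_def)
    \<comment> \<open>\<open>m * i - i\<close> serves as the exponent -i.\<close>
    have "m * i - i + i = m * i" using m(1) by simp
    hence "(\<sigma> ^^ (m * i - i)) y = (\<sigma> ^^ (m * i)) x" unfolding i[symmetric] by (simp only: add[symmetric])
    also have "\<dots> = x" by (simp only: funpow_mult[symmetric] m(2) id_funpow id_apply)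
    finally show ?thesis by (auto simp: orb_def)
  qed
  have trans: "z \<in> orb x" if yz: "y \<in> orb x" "z \<in> orb y" for x y z
  proof -
    obtain i j where "(\<sigma> ^^ i) x = y" "(\<sigma> ^^ j) y = z" using yz by (auto simp: orb_def)
    hence "(\<sigma> ^^ (j + i)) x = z" by (simp add: add)
    thus ?thesis by (auto simp: orb_def)
  qed
  have orb_eq: "orb x = orb y" if "y \<in> orb x" for x y
  proof (intro equalityI subsetI)
    show "u \<in> orb y" if "u \<in> orb x" for u by (rule trans[OF sym[OF \<open>y \<in> orb x\<close>] that])
    show "u \<in> orb x" if "u \<in> orb y" for u by (rule trans[OF \<open>y \<in> orb x\<close> that])
  qed
  have refl: "x \<in> orb x" for x unfolding orb_def by (auto intro: exI[of _ 0])
  have r_orb: "r x \<in> orb x" for x unfolding r_def using refl by (rule someI)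
  have r_eq: "r x = r y" if "y \<in> orb x" for x y using orb_eq[OF that] by (simp add: r_def)
  have "\<exists>i. (\<sigma> ^^ i) (r x) = x" for x using sym[OF r_orb] by (auto simp: orb_def)
  hence "\<exists>idx. \<forall>x. (\<sigma> ^^ idx x) (r x) = x" by (intro choice allI)
  then obtain idx where idx: "\<And>x. (\<sigma> ^^ idx x) (r x) = x" by blast
  define \<tau> where "\<tau> x = (\<sigma> ^^ (l * idx x)) (r x)" for x
  have comm: "\<tau> \<circ> \<sigma> = (\<sigma> ^^ l) \<circ> \<tau>"
  proof
    fix x
    have "\<sigma> x \<in> orb x" unfolding orb_def by (auto intro: exI[of _ 1])
    hence rx: "r (\<sigma> x) = r x" by (rule r_eq[symmetric])
    have "(\<sigma> ^^ idx (\<sigma> x)) (r x) = \<sigma> x" using idx[of "\<sigma> x"] by (simp add: rx)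
    also have "\<dots> = (\<sigma> ^^ Suc (idx x)) (r x)" by (simp add: idx)
    finally have "(\<sigma> ^^ (l * idx (\<sigma> x))) (r x) = (\<sigma> ^^ (l * Suc (idx x))) (r x)" by (rule funpow_eq_mult)
    thus "(\<tau> \<circ> \<sigma>) x = ((\<sigma> ^^ l) \<circ> \<tau>) x" by (simp add: \<tau>_def rx funpow_add)
  qed
  have pow_perm: "\<sigma> ^^ k permutes A" for k using perm(1) by (rule permutes_funpow)
  have fix_out: "\<tau> x = x" if "x \<notin> A" for x
  proof -
    have "(\<sigma> ^^ k) x = x" for k by (rule permutes_not_in[OF pow_perm that])
    hence "orb x = {x}" by (auto simp: orb_def)
    hence "r x = x" by (simp add: r_def)
    thus ?thesis using \<open>\<And>k. (\<sigma> ^^ k) x = x\<close> by (simp add: \<tau>_def)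
  qed
  obtain l' where l': "[l * l' = Suc 0] (mod m)" using cong_solve_coprime_nat[OF l] by blast
  have inj: "inj \<tau>"
  proof
    fix x y assume eq: "\<tau> x = \<tau> y"
    have orbt: "\<tau> u \<in> orb u" for u
    proof -
      have "\<tau> u \<in> orb (r u)" unfolding orb_def \<tau>_def by blast
      thus ?thesis by (rule trans[OF r_orb])
    qed
    have "orb x = orb y" using orb_eq[OF orbt[of x]] orb_eq[OF orbt[of y]] eq by simp
    hence rxy: "r x = r y" by (simp add: r_def)
    have "(\<sigma> ^^ (l * idx x)) (r x) = (\<sigma> ^^ (l * idx y)) (r x)" using eq by (simp add: \<tau>_def rxy)
    hence "(\<sigma> ^^ (l' * (l * idx x))) (r x) = (\<sigma> ^^ (l' * (l * idx y))) (r x)" by (rule funpow_eq_mult)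
    moreover have "\<sigma> ^^ (l' * (l * i)) = \<sigma> ^^ i" for i
    proof (rule funpow_cong[OF m(2)])
      have "[l * l' * i = Suc 0 * i] (mod m)" by (intro cong_mult l' cong_refl)
      thus "[l' * (l * i) = i] (mod m)" by (simp add: mult_ac)
    qed
    ultimately have "(\<sigma> ^^ idx x) (r x) = (\<sigma> ^^ idx y) (r x)" by (simp only:)
    thus "x = y" unfolding idx unfolding rxy idx .
  qed
  have "\<tau> ` A \<subseteq> A"
  proof
    fix y assume "y \<in> \<tau> ` A"
    then obtain x where x: "x \<in> A" "y = \<tau> x" by auto
    show "y \<in> A"
    proof (rule ccontr)
      assume "y \<notin> A"
      hence "\<tau> y = y" by (rule fix_out)
      hence "y = x" using x(2) injD[OF inj] by blast
      thus False using x \<open>y \<notin> A\<close> by simp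
    qed
  qed
  moreover have "inj_on \<tau> A" using inj by (rule inj_on_subset) simp
  ultimately have "bij_betw \<tau> A A" using endo_inj_surj[OF perm(2)] by (simp only: bij_betw_def)
  hence "\<tau> permutes A" using fix_out by (rule bij_imp_permutes)
  thus ?thesis using comm by blast
qed

lemma alt_group_pow: "\<sigma> [^]\<^bsub>alt_group n\<^esub> (k::nat) = \<sigma> ^^ k"
proof (induction k)
  case (Suc k)
  have "\<sigma> [^]\<^bsub>alt_group n\<^esub> Suc k = (\<sigma> ^^ k) \<circ> \<sigma>"
    by (simp only: nat_pow_Suc Suc alt_group_mult)
  also have "\<dots> = \<sigma> ^^ Suc k" by (simp only: funpow_Suc_right)
  finally show ?case .
qed (simp add: alt_group_one)

lemma group_GL: "group (GL d)"
  unfolding GL_def by (rule monoid.units_group[OF ring.is_monoid[OF ring_mat]])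

lemma GL_simps: "x \<otimes>\<^bsub>GL d\<^esub> y = x * y" "\<one>\<^bsub>GL d\<^esub> = 1\<^sub>m d"
  by (simp_all add: GL_def units_of_def ring_mat_def)

lemma carrier_GL: "carrier (GL d) \<subseteq> carrier_mat d d"
  by (auto simp: GL_def units_of_def Units_def ring_mat_def)

lemma hom_GL:
  assumes "\<rho> \<in> hom (alt_group n) (GL d)"
  shows "x \<in> carrier (alt_group n) \<Longrightarrow> \<rho> x \<in> carrier_mat d d"
    and "x \<in> carrier (alt_group n) \<Longrightarrow> y \<in> carrier (alt_group n) \<Longrightarrow> \<rho> (x \<circ> y) = \<rho> x * \<rho> y"
    and "\<rho> id = 1\<^sub>m d"
    and "x \<in> carrier (alt_group n) \<Longrightarrow> \<rho> (x ^^ k) = \<rho> x ^\<^sub>m k"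
proof -
  interpret group_hom "alt_group n" "GL d" \<rho>
    using assms alt_group_is_group group_GL by (simp add: group_hom_def group_hom_axioms_def)
  show car: "\<rho> x \<in> carrier_mat d d" if "x \<in> carrier (alt_group n)" for x
    using hom_closed[OF that] carrier_GL by blast
  show mult: "\<rho> (x \<circ> y) = \<rho> x * \<rho> y" if "x \<in> carrier (alt_group n)" "y \<in> carrier (alt_group n)" for x y
    using hom_mult[OF that] by (simp add: GL_simps alt_group_mult)
  show one: "\<rho> id = 1\<^sub>m d" using hom_one by (simp add: GL_simps alt_group_one)
  show "\<rho> (x ^^ k) = \<rho> x ^\<^sub>m k" if x: "x \<in> carrier (alt_group n)"
  proof (induction k)
    case (Suc k)
    have "x ^^ k \<in> carrier (alt_group n)"
      using monoid.nat_pow_closed[OF group.is_monoid[OF alt_group_is_group] x, of k] by (simp only: alt_group_pow)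
    thus ?case using Suc mult[OF _ x] by (simp only: funpow_Suc_right pow_mat.simps)
  qed (use one car[OF x] in \<open>simp add: id_def\<close>)
qed

lemma character_in_star_field:
  assumes \<pi>: "\<And>p. p \<in> \<pi> \<Longrightarrow> prime p \<and> odd p"
    and \<chi>: "is_character (alt_group n) \<chi>" and \<sigma>: "\<sigma> \<in> carrier (alt_group n)"
    and ord: "pi_number \<pi> (group.ord (alt_group n) \<sigma>)"
  shows "\<chi> \<sigma> \<in> star_field \<pi>"
proof -
  define m where "m = group.ord (alt_group n) \<sigma>"
  interpret A: group "alt_group n" by (rule alt_group_is_group)
  have m: "m > 0" "prime_factors m \<subseteq> \<pi>" using ord by (auto simp: m_def pi_number_def)
  have odd_m: "odd m"
  proof
    assume "even m"
    hence "2 \<in> prime_factors m" using m(1) by (simp add: prime_factors_dvd)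
    thus False using m(2) \<pi>[of 2] by auto
  qed
  have \<sigma>m: "\<sigma> ^^ m = id"
    using A.pow_ord_eq_1[OF \<sigma>] by (simp add: m_def alt_group_pow alt_group_one)
  obtain d \<rho> where \<rho>: "\<rho> \<in> hom (alt_group n) (GL d)" and tr: "\<And>x. x \<in> carrier (alt_group n) \<Longrightarrow> \<chi> x = mat_trace (\<rho> x)"
    using \<chi> unfolding is_character_def by blast
  note hom = hom_GL[OF \<rho>]
  have pow_closed: "\<sigma> ^^ k \<in> carrier (alt_group n)" for k
    using A.nat_pow_closed[OF \<sigma>, of k] by (simp only: alt_group_pow)
  have "\<rho> \<sigma> ^\<^sub>m m = 1\<^sub>m d" using hom(4)[OF \<sigma>, of m] \<sigma>m hom(3) by simp
  from mat_trace_pow_root_of_unity[OF hom(1)[OF \<sigma>] this] obtain e where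
    e: "\<And>i. i < d \<Longrightarrow> e i ^ m = 1" "\<And>k. mat_trace (\<rho> \<sigma> ^\<^sub>m k) = (\<Sum>i<d. e i ^ k)" by blast
  have \<chi>_pow: "\<chi> (\<sigma> ^^ k) = (\<Sum>i<d. e i ^ k)" for k
    using tr[OF pow_closed] hom(4)[OF \<sigma>] e(2) by simp
  have \<chi>_sq: "\<chi> (\<sigma> ^^ l\<^sup>2) = \<chi> \<sigma>" if l: "coprime l m" for l
  proof -
    have \<sigma>p: "\<sigma> permutes {1..n}" using \<sigma> by (simp add: alt_group_carrier)
    obtain \<tau> where \<tau>: "\<tau> permutes {1..n}" "\<tau> \<circ> \<sigma> = (\<sigma> ^^ l) \<circ> \<tau>"
      using permutes_funpow_conjugate[OF \<sigma>p _ m(1) \<sigma>m l] by auto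
    have "\<tau> \<circ> (\<sigma> ^^ k) = (\<sigma> ^^ (l * k)) \<circ> \<tau>" for k
    proof (induction k)
      case (Suc k)
      have "\<tau> \<circ> (\<sigma> ^^ Suc k) = (\<tau> \<circ> \<sigma>) \<circ> (\<sigma> ^^ k)" by (simp add: o_assoc)
      also have "\<dots> = (\<sigma> ^^ l) \<circ> (\<tau> \<circ> (\<sigma> ^^ k))" by (simp only: \<tau>(2) o_assoc)
      also have "\<dots> = (\<sigma> ^^ (l * Suc k)) \<circ> \<tau>" by (simp only: Suc funpow_add mult_Suc_right o_assoc)
      finally show ?case .
    qed simp
    hence \<tau>l: "\<tau> \<circ> (\<sigma> ^^ l) = (\<sigma> ^^ (l * l)) \<circ> \<tau>" .
    have "(\<tau> \<circ> \<tau>) \<circ> \<sigma> = \<tau> \<circ> (\<tau> \<circ> \<sigma>)" by (rule comp_assoc)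
    also have "\<dots> = (\<tau> \<circ> (\<sigma> ^^ l)) \<circ> \<tau>" unfolding \<tau>(2) by (rule o_assoc)
    also have "\<dots> = (\<sigma> ^^ (l * l)) \<circ> (\<tau> \<circ> \<tau>)" unfolding \<tau>l by (rule comp_assoc)
    finally have "(\<tau> \<circ> \<tau>) \<circ> \<sigma> = (\<sigma> ^^ (l * l)) \<circ> (\<tau> \<circ> \<tau>)" .
    hence conj: "\<sigma> ^^ l\<^sup>2 = (\<tau> \<circ> \<tau>) \<circ> \<sigma> \<circ> inv' (\<tau> \<circ> \<tau>)"
    proof -
      assume *: "(\<tau> \<circ> \<tau>) \<circ> \<sigma> = (\<sigma> ^^ (l * l)) \<circ> (\<tau> \<circ> \<tau>)"
      have "(\<tau> \<circ> \<tau>) \<circ> inv' (\<tau> \<circ> \<tau>) = id" using permutes_inv_o(1)[OF permutes_compose[OF \<tau>(1,1)]] .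
      thus ?thesis unfolding * by (simp add: power2_eq_square comp_assoc)
    qed
    define g where "g = \<tau> \<circ> \<tau>"
    have "permutation \<tau>" using \<tau>(1) permutation_permutes by blast
    hence g: "g \<in> carrier (alt_group n)"
      using \<tau>(1) by (simp add: g_def alt_group_carrier permutes_compose evenperm_comp)
    hence gi: "inv' g \<in> carrier (alt_group n)" by (rule alt_group_inv_closed)
    have "g \<circ> \<sigma> \<in> carrier (alt_group n)" using A.m_closed[OF g \<sigma>] by (simp add: alt_group_mult)
    hence "\<chi> (\<sigma> ^^ l\<^sup>2) = mat_trace (\<rho> (g \<circ> \<sigma>) * \<rho> (inv' g))"
      using tr[OF pow_closed, of "l\<^sup>2"] hom(2)[OF _ gi, of "g \<circ> \<sigma>"] unfolding conj g_def by (simp only:)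
    also have "\<dots> = mat_trace (\<rho> (inv' g) * \<rho> (g \<circ> \<sigma>))"
      using hom(1)[OF gi] hom(1)[OF \<open>g \<circ> \<sigma> \<in> _\<close>] by (intro mat_trace_mult_comm)
    also have "\<dots> = mat_trace (\<rho> (inv' g \<circ> (g \<circ> \<sigma>)))" using hom(2)[OF gi \<open>g \<circ> \<sigma> \<in> _\<close>] by simp
    also have "inv' g \<circ> (g \<circ> \<sigma>) = \<sigma>"
    proof -
      have "inv' g \<circ> g = id" using g by (intro permutes_inv_o(2)[of _ "{1..n}"]) (simp add: alt_group_carrier)
      thus ?thesis by (simp add: o_assoc)
    qed
    finally show ?thesis using tr[OF \<sigma>] by simp
  qed
  have "of_nat (totient m) * \<chi> \<sigma> = (\<Sum>l\<in>totatives m. \<chi> (\<sigma> ^^ l\<^sup>2))"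
    by (simp add: totient_def \<chi>_sq totatives_def)
  also have "\<dots> = (\<Sum>l\<in>totatives m. \<Sum>i<d. e i ^ l\<^sup>2)" by (simp add: \<chi>_pow)
  also have "\<dots> = (\<Sum>i<d. unit_square_sum m (e i))"
    unfolding unit_square_sum_def by (rule sum.swap)
  also have "\<dots> \<in> star_field \<pi>"
    using e(1) by (intro rat_adjoin_sum unit_square_sum_in_star_field m odd_m) auto
  finally have "inverse (of_nat (totient m)) * (of_nat (totient m) * \<chi> \<sigma>) \<in> star_field \<pi>"
    by (rule rat_adjoin_mult[OF rat_adjoin_Rats, rotated]) auto
  moreover have "totient m \<noteq> 0" using m(1) by simp
  ultimately show ?thesis by (simp flip: mult.assoc)
qed

section \<open>Signs of multiplication maps\<close>

text \<open>Induction on the blocks: \<open>F\<close> is the permutation of one block, transported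
  along \<open>e t\<close>, composed with the part of \<open>F\<close> on the others. It is applied
  both to digits in base \<open>b\<close> and to the cycles of a permutation.\<close>

lemma sign_blocks:
  fixes F :: "'b \<Rightarrow> 'b" and e :: "'t \<Rightarrow> 'a \<Rightarrow> 'b" and f :: "'t \<Rightarrow> 'a \<Rightarrow> 'a"
  assumes "finite T" "\<And>t. t \<in> T \<Longrightarrow> finite (D t)" "\<And>t. t \<in> T \<Longrightarrow> f t permutes D t"
    and "\<And>t. t \<in> T \<Longrightarrow> inj_on (e t) (D t)"
    and "\<And>t u. t \<in> T \<Longrightarrow> u \<in> T \<Longrightarrow> t \<noteq> u \<Longrightarrow> e t ` D t \<inter> e u ` D u = {}"
    and "\<And>t s. t \<in> T \<Longrightarrow> s \<in> D t \<Longrightarrow> F (e t s) = e t (f t s)"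
    and "\<And>y. y \<notin> (\<Union>t\<in>T. e t ` D t) \<Longrightarrow> F y = y"
  shows "F permutes (\<Union>t\<in>T. e t ` D t) \<and> sign F = (\<Prod>t\<in>T. sign (f t))"
  using assms
proof (induction T arbitrary: F rule: finite_induct)
  case empty
  hence "F = id" by (auto simp: fun_eq_iff)
  thus ?case by (simp only: UN_empty prod.empty permutes_id sign_id simp_thms)
next
  case (insert t T)
  define V where "V = (\<Union>u\<in>T. e u ` D u)"
  define F' where "F' y = (if y \<in> V then F y else y)" for y
  define H where "H = map_permutation (D t) (e t) (f t)"
  have IH: "F' permutes V \<and> sign F' = (\<Prod>u\<in>T. sign (f u))"
    unfolding V_def
  proof (rule insert.IH)
    show "F' (e u s) = e u (f u s)" if "u \<in> T" "s \<in> D u" for u s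
      using that insert.prems(5)[of u s] by (auto simp: F'_def V_def)
    show "F' y = y" if "y \<notin> (\<Union>u\<in>T. e u ` D u)" for y using that by (simp add: F'_def V_def)
  qed (use insert.prems in auto)
  have Hp: "H permutes (e t ` D t)" unfolding H_def
    by (rule map_permutation_permutes) (use insert.prems in \<open>auto simp: bij_betw_def\<close>)
  have HF: "H (e t s) = e t (f t s)" if "s \<in> D t" for s
    unfolding H_def using insert.prems that by (intro map_permutation_apply) auto
  have disj: "e t ` D t \<inter> V = {}" using insert.prems(4)[of t] insert.hyps by (auto simp: V_def)
  have eq: "F = H \<circ> F'"
  proof
    fix y
    show "F y = (H \<circ> F') y"
    proof (cases "y \<in> V")
      case True
      hence "F' y \<in> V" using IH by (simp add: permutes_in_image)
      hence "F' y \<notin> e t ` D t" using disj by blast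
      hence "H (F' y) = F' y" by (rule permutes_not_in[OF Hp])
      thus ?thesis using True by (simp add: F'_def)
    next
      case False
      hence F': "F' y = y" by (simp add: F'_def)
      show ?thesis
      proof (cases "y \<in> e t ` D t")
        case True
        then obtain s where "s \<in> D t" "y = e t s" by blast
        thus ?thesis using F' HF insert.prems(5)[of t s] by simp
      next
        case no: False
        hence "F y = y" using False by (intro insert.prems(6)) (auto simp: V_def)
        moreover have "H y = y" by (rule permutes_not_in[OF Hp no])
        ultimately show ?thesis using F' by simp
      qed
    qed
  qed
  have fin: "finite V" "finite (e t ` D t)" using insert by (auto simp: V_def)
  have "F permutes e t ` D t \<union> V" unfolding eq
    using permutes_compose permutes_subset[OF Hp] permutes_subset[of F' V] IH by (metis sup_ge1 sup_ge2)
  moreover have "sign F = sign H * sign F'" unfolding eq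
    using Hp IH fin by (intro sign_compose) (auto simp: permutation_permutes)
  moreover have "sign H = sign (f t)" unfolding H_def
    using insert.prems by (intro sign_map_permutation) auto
  ultimately show ?case using insert.hyps IH by (simp add: V_def)
qed

lemma sign_funpow:
  assumes "permutation f"
  shows "sign (f ^^ k) = sign f ^ k"
proof (induction k)
  case (Suc k)
  have "sign (f \<circ> f ^^ k) = sign f * sign (f ^^ k)"
    using assms permutation_funpow[OF assms] by (intro sign_compose)
  thus ?case using Suc by (simp only: funpow.simps power_Suc)
qed simp

lemma sign_odd_order:
  assumes "permutation f" "f ^^ m = id" "odd m"
  shows "sign f = 1"
proof -
  have "sign f ^ m = 1" using sign_funpow[OF assms(1), of m] assms(2) by simp
  thus ?thesis using assms(3) by (cases f rule: sign_cases) auto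
qed

section \<open>Zolotarev's lemma for primes and for square moduli\<close>

definition mulperm :: "nat \<Rightarrow> nat \<Rightarrow> nat \<Rightarrow> nat" where
  "mulperm N k x = (if x < N then (k * x) mod N else x)"

definition addperm :: "nat \<Rightarrow> nat \<Rightarrow> nat \<Rightarrow> nat" where
  "addperm N c x = (if x < N then (x + c) mod N else x)"

lemma permutes_lessThan_if_inj:
  fixes f :: "nat \<Rightarrow> nat"
  assumes "\<And>x. x < N \<Longrightarrow> f x < N" "\<And>x. x \<ge> N \<Longrightarrow> f x = x" "inj_on f {..<N}"
  shows "f permutes {..<N}"
proof (rule bij_imp_permutes)
  have "f ` {..<N} = {..<N}" using assms by (intro endo_inj_surj) auto
  thus "bij_betw f {..<N} {..<N}" using assms(3) by (simp add: bij_betw_def)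
qed (use assms in auto)

lemma mulperm_permutes:
  assumes "coprime k N"
  shows "mulperm N k permutes {..<N}"
proof (rule permutes_lessThan_if_inj)
  show "inj_on (mulperm N k) {..<N}"
  proof
    fix x y assume xy: "x \<in> {..<N}" "y \<in> {..<N}" "mulperm N k x = mulperm N k y"
    hence "[k * x = k * y] (mod N)" by (simp add: mulperm_def cong_def)
    hence "[x = y] (mod N)" using assms cong_mult_lcancel_nat by blast
    thus "x = y" using xy by (simp add: cong_def)
  qed
qed (auto simp: mulperm_def)

lemma addperm_permutes: "addperm N c permutes {..<N}"
proof (rule permutes_lessThan_if_inj)
  show "inj_on (addperm N c) {..<N}"
  proof
    fix x y assume xy: "x \<in> {..<N}" "y \<in> {..<N}" "addperm N c x = addperm N c y"
    hence "[x + c = y + c] (mod N)" by (simp add: addperm_def cong_def)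
    hence "[x = y] (mod N)" by (simp add: cong_add_rcancel_nat)
    thus "x = y" using xy by (simp add: cong_def)
  qed
qed (auto simp: addperm_def)

lemma permutation_mulperm: "coprime k N \<Longrightarrow> permutation (mulperm N k)"
  using mulperm_permutes permutation_permutes by blast

lemma addperm_funpow: "addperm N c ^^ j = addperm N (j * c)"
proof (induction j)
  case (Suc j)
  have "addperm N c (addperm N (j * c) x) = addperm N (Suc j * c) x" for x
    by (auto simp: addperm_def mod_simps add_ac)
  thus ?case using Suc by (simp add: fun_eq_iff)
qed (auto simp: addperm_def fun_eq_iff)

lemma sign_addperm:
  assumes "odd N"
  shows "sign (addperm N c) = 1"
proof (rule sign_odd_order[OF _ _ assms])
  show "permutation (addperm N c)" using addperm_permutes permutation_permutes by blast
  show "addperm N c ^^ N = id" unfolding addperm_funpow by (auto simp: addperm_def fun_eq_iff)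
qed

lemma mulperm_mult: "mulperm N (k * l) = mulperm N k \<circ> mulperm N l"
  by (auto simp: mulperm_def fun_eq_iff mod_simps mult.assoc)

lemma mulperm_mod: "mulperm N (k mod N) = mulperm N k"
  by (auto simp: mulperm_def fun_eq_iff mod_simps)

lemma sign_mulperm_mult:
  assumes "coprime k N" "coprime l N"
  shows "sign (mulperm N (k * l)) = sign (mulperm N k) * sign (mulperm N l)"
  unfolding mulperm_mult using assms permutation_mulperm by (intro sign_compose)

text \<open>Multiplication modulo \<open>b\<^sup>2\<close> is composed of two maps that both have
  sign \<open>s ^ b\<close>, where \<open>s\<close> is the sign of multiplication modulo
  \<open>b\<close>, so the signs cancel. Oddness of \<open>b\<close> makes the addition of carries
  even.\<close>

lemma sign_mulperm_square:
  assumes b: "odd b" and k: "coprime k b"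
  shows "sign (mulperm (b\<^sup>2) k) = 1"
proof -
  have b0: "b > 0" using b by (cases b) auto
  obtain k' where k': "[k * k' = Suc 0] (mod b)" using cong_solve_coprime_nat[OF k] by blast
  \<comment> \<open>The second map sees only the new digit \<open>a\<close>, so the old one is
    recovered by the inverse \<open>k'\<close> before its carry is computed.\<close>
  define c where "c a = (k * ((k' * a) mod b)) div b" for a
  (* For x = a + b * y, F1 multiplies the digit a, and F2 multiplies y and adds the carry c. Both act
     on b blocks of size b by a permutation of the sign of multiplication by k modulo b. *)
  define F1 where "F1 x = (if x < b * b then (k * (x mod b)) mod b + b * (x div b) else x)" for x
  define F2 where "F2 x = (if x < b * b then x mod b + b * ((k * (x div b) + c (x mod b)) mod b) else x)" for x
  have un1: "(\<Union>y\<in>{..<b}. (\<lambda>a. a + b * y) ` {..<b}) = {..<b * b}"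
  proof (intro equalityI subsetI)
    fix x assume "x \<in> {..<b * b}"
    hence "x mod b < b" "x div b < b" using b0 by (auto simp: less_mult_imp_div_less)
    moreover have "x = x mod b + b * (x div b)" by simp
    ultimately show "x \<in> (\<Union>y\<in>{..<b}. (\<lambda>a. a + b * y) ` {..<b})" by blast
  next
    fix x assume "x \<in> (\<Union>y\<in>{..<b}. (\<lambda>a. a + b * y) ` {..<b})"
    then obtain a y where "a < b" "y < b" "x = a + b * y" by auto
    moreover have "b * y + b \<le> b * b" using \<open>y < b\<close> by (metis Suc_leI add.commute mult_Suc_right mult_le_mono2)
    ultimately show "x \<in> {..<b * b}" by simp
  qed
  hence un2: "(\<Union>a\<in>{..<b}. (\<lambda>y. a + b * y) ` {..<b}) = {..<b * b}" by blast
  have lt: "a + b * y < b * b" if "a < b" "y < b" for a y using that un1 by blast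
  have div_mod: "(a + b * y) mod b = a" "(a + b * y) div b = y" if "a < b" for a y
    using that by auto
  have uniq: "a = a' \<and> y = y'" if "a + b * y = a' + b * y'" "a < b" "a' < b" for a y a' y'
    using div_mod[OF that(2), of y] div_mod[OF that(3), of y'] that(1) by simp
  have F1: "F1 permutes {..<b * b} \<and> sign F1 = (\<Prod>y\<in>{..<b}. sign (mulperm b k))"
    unfolding un1[symmetric]
  proof (rule sign_blocks)
    show "mulperm b k permutes {..<b}" by (rule mulperm_permutes[OF k])
    show "(\<lambda>a. a + b * t) ` {..<b} \<inter> (\<lambda>a. a + b * u) ` {..<b} = {}" if "t \<noteq> u" for t u
      using that by (auto dest: uniq)
    show "F1 (s + b * t) = mulperm b k s + b * t" if "t \<in> {..<b}" "s \<in> {..<b}" for s t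
      using lt[of s t] div_mod[of s t] that by (simp add: F1_def mulperm_def)
    show "F1 y = y" if "y \<notin> (\<Union>y\<in>{..<b}. (\<lambda>a. a + b * y) ` {..<b})" for y
      using that unfolding un1 by (simp add: F1_def)
  qed (auto simp: inj_on_def)
  have F2: "F2 permutes {..<b * b} \<and> sign F2 = (\<Prod>a\<in>{..<b}. sign (addperm b (c a) \<circ> mulperm b k))"
    unfolding un2[symmetric]
  proof (rule sign_blocks)
    show "addperm b (c t) \<circ> mulperm b k permutes {..<b}" for t
      by (intro permutes_compose mulperm_permutes[OF k] addperm_permutes)
    show "(\<lambda>y. t + b * y) ` {..<b} \<inter> (\<lambda>y. u + b * y) ` {..<b} = {}" if "t \<in> {..<b}" "u \<in> {..<b}" "t \<noteq> u" for t u
      using that by (auto dest: uniq)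
    show "F2 (t + b * s) = t + b * (addperm b (c t) \<circ> mulperm b k) s" if "t \<in> {..<b}" "s \<in> {..<b}" for s t
      using lt[of t s] div_mod[of t s] that b0 by (simp add: F2_def mulperm_def addperm_def mod_simps)
    show "F2 y = y" if "y \<notin> (\<Union>a\<in>{..<b}. (\<lambda>y. a + b * y) ` {..<b})" for y
      using that unfolding un2 by (simp add: F2_def)
  qed (use b0 in \<open>auto simp: inj_on_def\<close>)
  have eq: "mulperm (b\<^sup>2) k = F2 \<circ> F1"
  proof
    fix x
    show "mulperm (b\<^sup>2) k x = (F2 \<circ> F1) x"
    proof (cases "x < b * b")
      case True
      define a y where "a = x mod b" and "y = x div b"
      have x: "x = a + b * y" by (simp add: a_def y_def)
      have ay: "a < b" "y < b" using True b0 by (auto simp: a_def y_def less_mult_imp_div_less)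
      have kab: "(k * a) mod b < b" using b0 by simp
      have "F1 x = (k * a) mod b + b * y" using True by (simp add: F1_def a_def y_def)
      moreover have "(k * a) mod b + b * y < b * b" using lt[OF kab ay(2)] .
      moreover have "c ((k * a) mod b) = (k * a) div b"
      proof -
        have "[k' * ((k * a) mod b) = a] (mod b)"
        proof -
          have "[k * k' * a = Suc 0 * a] (mod b)" by (intro cong_mult k' cong_refl)
          thus ?thesis by (simp add: cong_def mod_simps mult_ac)
        qed
        hence "(k' * ((k * a) mod b)) mod b = a" using ay by (simp add: cong_def)
        thus ?thesis by (simp add: c_def)
      qed
      ultimately have "F2 (F1 x) = (k * a) mod b + b * ((k * y + (k * a) div b) mod b)"
        using div_mod[OF kab, of y] by (simp add: F2_def)
      also have "\<dots> = (k * x) mod (b * b)"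
      proof -
        have kx: "k * x = k * a + b * (k * y)" by (simp add: x algebra_simps)
        have "(k * x) mod (b * b) = b * ((k * x) div b mod b) + (k * x) mod b" by (rule mod_mult2_eq)
        moreover have "(k * x) div b = k * y + (k * a) div b" "(k * x) mod b = (k * a) mod b"
          unfolding kx using b0 by simp_all
        ultimately show ?thesis by simp
      qed
      finally show ?thesis using True by (simp add: mulperm_def power2_eq_square)
    qed (simp add: mulperm_def F1_def F2_def power2_eq_square)
  qed
  define s where "s = sign (mulperm b k)"
  have "sign (mulperm (b\<^sup>2) k) = sign F2 * sign F1" unfolding eq
    using F1 F2 by (intro sign_compose) (auto simp: permutation_permutes)
  also have "sign F1 = s ^ b" using F1 by (simp add: s_def)
  also have "sign F2 = s ^ b"
  proof -
    have "sign (addperm b (c a) \<circ> mulperm b k) = s" for a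
      using sign_compose[of "addperm b (c a)" "mulperm b k"] permutation_mulperm[OF k] sign_addperm[OF b, of "c a"]
        addperm_permutes[of b "c a"] by (auto simp: permutation_permutes s_def)
    thus ?thesis using F2 by simp
  qed
  also have "s ^ b * s ^ b = (s * s) ^ b" by (simp add: power_mult_distrib)
  finally show ?thesis by (simp add: s_def)
qed

lemma sign_cycle_of_list:
  assumes "distinct cs" "cs \<noteq> []"
  shows "sign (cycle_of_list cs) = (- 1) ^ (length cs - 1)"
  using assms
proof (induction cs rule: cycle_of_list.induct)
  case (1 i j cs)
  have "sign (cycle_of_list (i # j # cs)) = sign (Transposition.transpose i j) * sign (cycle_of_list (j # cs))"
    unfolding cycle_of_list.simps by (intro sign_compose permutation_swap_id permutation_of_cycle)
  moreover have "sign (Transposition.transpose i j) = - 1" using 1 by (simp add: sign_swap_id)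
  moreover have "sign (cycle_of_list (j # cs)) = (- 1) ^ length cs" using 1 by simp
  ultimately have "sign (cycle_of_list (i # j # cs)) = - 1 * (- 1) ^ length cs" by (simp only:)
  thus ?case by (simp only: list.size add_Suc_right add_0_right diff_Suc_1 power_Suc)
qed auto

text \<open>Multiplication by \<open>g\<close> moves the non-zero residues in a single cycle of even
  length \<open>p - 1\<close>, an odd permutation; its powers follow by multiplicativity.\<close>

lemma sign_mulperm_primroot:
  assumes p: "prime p" "odd p" and g: "residue_primroot p g"
  shows "sign (mulperm p (g ^ j)) = (- 1) ^ j"
proof -
  have p1: "p > 1" using prime_gt_1_nat[OF p(1)] .
  have cop: "coprime g p" using g by (auto simp: residue_primroot_def coprime_commute)
  define cs where "cs = map (\<lambda>i. g ^ i mod p) [0..<p - 1]"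
  have bij: "bij_betw (\<lambda>i. g ^ i mod p) {..<p - 1} {1..<p}"
  proof -
    have "totatives p = {1..<p}" using p(1) by (auto simp: totatives_prime)
    thus ?thesis using residue_primroot_is_generator[OF p1 g] p(1) by (simp add: totient_prime)
  qed
  have dist: "distinct cs" using bij by (auto simp: cs_def distinct_map bij_betw_def lessThan_atLeast0)
  have set: "set cs = {1..<p}" using bij by (auto simp: cs_def bij_betw_def lessThan_atLeast0)
  have len: "length cs = p - 1" by (simp add: cs_def)
  have order: "[g ^ (p - 1) = 1] (mod p)" using euler_theorem[OF cop] totient_prime[OF p(1)] by simp
  have "mulperm p g = cycle_of_list cs"
  proof
    fix x
    show "mulperm p g x = cycle_of_list cs x"
    proof (cases "x \<in> set cs")
      case True
      then obtain i where i: "i < p - 1" "x = cs ! i" using len by (auto simp: in_set_conv_nth)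
      have "map (cycle_of_list cs) cs = rotate 1 cs" using cyclic_rotation[OF dist, of 1] by simp
      hence "cycle_of_list cs x = rotate 1 cs ! i" using i len by (metis nth_map)
      also have "\<dots> = cs ! (Suc i mod (p - 1))" using i len by (simp add: nth_rotate1)
      also have "\<dots> = g ^ Suc i mod p"
      proof (cases "Suc i < p - 1")
        case False
        hence e: "Suc i = p - 1" using i by simp
        have "cs ! 0 = 1" using i p1 by (simp add: cs_def)
        moreover have "g ^ (p - 1) mod p = 1" using order p1 by (simp add: cong_def)
        ultimately show ?thesis unfolding e by simp
      qed (simp add: cs_def)
      also have "\<dots> = mulperm p g x" using i p1 by (simp add: cs_def mulperm_def mod_simps)
      finally show ?thesis ..
    next
      case False
      hence "cycle_of_list cs x = x" by (rule id_outside_supp)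
      moreover have "mulperm p g x = x" using False by (cases "x = 0") (auto simp: set mulperm_def)
      ultimately show ?thesis by simp
    qed
  qed
  moreover have "cs \<noteq> []" using len p1 by auto
  ultimately have "sign (mulperm p g) = (- 1) ^ (p - 1 - 1)" using sign_cycle_of_list[OF dist] len by simp
  also have "\<dots> = - 1" using p p1 by (auto elim!: oddE)
  finally have sg: "sign (mulperm p g) = - 1" .
  show ?thesis
  proof (induction j)
    case 0
    have "mulperm p 1 = id" by (auto simp: mulperm_def)
    thus ?case by simp
  next
    case (Suc j)
    thus ?case using sign_mulperm_mult[OF cop, of "g ^ j"] cop sg by simp
  qed
qed

section \<open>A monomial character\<close>

text \<open>\<open>w\<close> is a linear character of \<open>H\<close> extended by zero,
  multiplicative as soon as one factor lies in \<open>H\<close>. The identity is Frobenius' formula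
  for the induced character, multiplied by \<open>card H\<close> so that the sum runs over the group
  instead of coset representatives.\<close>

lemma (in group) induced_character:
  fixes w :: "'a \<Rightarrow> complex"
  assumes fin: "finite (carrier G)" and H: "subgroup H G"
    and w0: "\<And>x. x \<in> carrier G \<Longrightarrow> w x \<noteq> 0 \<longleftrightarrow> x \<in> H"
    and wl: "\<And>x y. x \<in> H \<Longrightarrow> y \<in> carrier G \<Longrightarrow> w (x \<otimes> y) = w x * w y"
    and wr: "\<And>x y. x \<in> carrier G \<Longrightarrow> y \<in> H \<Longrightarrow> w (x \<otimes> y) = w x * w y"
  shows "\<exists>\<chi>. is_character G \<chi> \<and>
    (\<forall>g\<in>carrier G. of_nat (card H) * \<chi> g = (\<Sum>x\<in>carrier G. w (inv x \<otimes> g \<otimes> x)))"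
proof -
  interpret H: subgroup H G by (rule H)
  have HG: "x \<in> H \<Longrightarrow> x \<in> carrier G" for x using H.subset by blast
  \<comment> \<open>Equality of left cosets of \<open>H\<close>; \<open>rep\<close> selects one
    element in each.\<close>
  define rel where "rel x y \<longleftrightarrow> inv x \<otimes> y \<in> H" for x y
  have rel_refl: "rel x x" if "x \<in> carrier G" for x using that by (simp add: rel_def)
  have rel_sym: "rel y x" if "x \<in> carrier G" "y \<in> carrier G" "rel x y" for x y
  proof -
    have "inv (inv x \<otimes> y) \<in> H" using that by (simp add: rel_def)
    thus ?thesis using that by (simp add: rel_def inv_mult_group)
  qed
  have rel_trans: "rel x z" if "x \<in> carrier G" "y \<in> carrier G" "z \<in> carrier G" "rel x y" "rel y z" for x y z
  proof -
    have "(inv x \<otimes> y) \<otimes> (inv y \<otimes> z) \<in> H"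
      using H.m_closed[of "inv x \<otimes> y" "inv y \<otimes> z"] that by (simp add: rel_def)
    moreover have "y \<otimes> (inv y \<otimes> z) = z" using that by (simp add: m_assoc[symmetric])
    hence "(inv x \<otimes> y) \<otimes> (inv y \<otimes> z) = inv x \<otimes> z" using that by (simp add: m_assoc)
    ultimately show ?thesis by (simp add: rel_def)
  qed
  define rep where "rep x = (SOME y. y \<in> carrier G \<and> rel x y)" for x
  have rep: "rep x \<in> carrier G" "rel x (rep x)" if "x \<in> carrier G" for x
  proof -
    have "rep x \<in> carrier G \<and> rel x (rep x)"
      unfolding rep_def by (rule someI[of _ x]) (use that rel_refl in simp)
    thus "rep x \<in> carrier G" "rel x (rep x)" by auto
  qed
  have rep_eq: "rep x = rep y" if "x \<in> carrier G" "y \<in> carrier G" "rel x y" for x y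
  proof -
    have "(z \<in> carrier G \<and> rel x z) \<longleftrightarrow> (z \<in> carrier G \<and> rel y z)" for z
      using rel_trans[OF that(1,2), of z] rel_trans[OF that(2,1), of z] rel_sym[OF that] that(3) by blast
    thus ?thesis by (simp add: rep_def)
  qed
  define d where "d = card (rep ` carrier G)"
  obtain t where t: "bij_betw t {0..<d} (rep ` carrier G)"
    unfolding d_def using ex_bij_betw_nat_finite[OF finite_imageI[OF fin]] by blast
  have tG: "t i \<in> carrier G" if "i < d" for i
  proof -
    have "t i \<in> rep ` carrier G" by (rule bij_betw_apply[OF t]) (use that in simp)
    then obtain a where "a \<in> carrier G" "t i = rep a" by (rule imageE)
    thus ?thesis using rep(1) by simp
  qed
  have ex: "\<exists>i<d. rel (t i) g" if g: "g \<in> carrier G" for g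
  proof -
    have "rep g \<in> t ` {0..<d}" using t g by (simp add: bij_betw_def)
    then obtain i where "i < d" "t i = rep g" by auto
    moreover have "rel (rep g) g" by (rule rel_sym[OF g rep(1)[OF g] rep(2)[OF g]])
    ultimately show ?thesis by (intro exI[of _ i]) simp
  qed
  have unique: "i = j" if ij: "i < d" "j < d" "g \<in> carrier G" "rel (t i) g" "rel (t j) g" for i j g
  proof -
    have "t i \<in> rep ` carrier G" by (rule bij_betw_apply[OF t]) (use ij(1,2) in simp)
    then obtain a where a: "a \<in> carrier G" "t i = rep a" by blast
    have "t j \<in> rep ` carrier G" by (rule bij_betw_apply[OF t]) (use ij(1,2) in simp)
    then obtain b where b: "b \<in> carrier G" "t j = rep b" by blast
    have "rel a g" using rel_trans[OF a(1) rep(1)[OF a(1)] ij(3) rep(2)[OF a(1)]] ij a by simp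
    moreover have "rel b g" using rel_trans[OF b(1) rep(1)[OF b(1)] ij(3) rep(2)[OF b(1)]] ij b by simp
    ultimately have "rep a = rep b" using rep_eq[OF a(1) ij(3)] rep_eq[OF b(1) ij(3)] by simp
    hence "t i = t j" using a b by simp
    thus ?thesis using t ij unfolding bij_betw_def inj_on_def by auto
  qed
  (* The monomial matrices of the induced representation in the coset representatives t i. *)
  define \<rho> where "\<rho> g = mat d d (\<lambda>(i, j). w (inv (t i) \<otimes> g \<otimes> t j))" for g
  have car: "\<rho> g \<in> carrier_mat d d" for g by (simp add: \<rho>_def)
  have mult: "\<rho> (g \<otimes> g') = \<rho> g * \<rho> g'" if g: "g \<in> carrier G" "g' \<in> carrier G" for g g'
  proof (rule eq_matI)
    fix i k assume "i < dim_row (\<rho> g * \<rho> g')" "k < dim_col (\<rho> g * \<rho> g')"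
    hence ik: "i < d" "k < d" by (auto simp: \<rho>_def)
    \<comment> \<open>\<open>g' \<otimes> t k\<close> lies in exactly one coset, so a single summand
      of the matrix product survives.\<close>
    obtain j where j: "j < d" "rel (t j) (g' \<otimes> t k)" using ex[of "g' \<otimes> t k"] g tG[OF ik(2)] by auto
    have assoc: "inv (t l) \<otimes> g' \<otimes> t k = inv (t l) \<otimes> (g' \<otimes> t k)" if "l < d" for l
      using tG[OF that] tG[OF ik(2)] g by (simp add: m_assoc)
    have zero: "w (inv (t l) \<otimes> g' \<otimes> t k) = 0" if l: "l < d" "l \<noteq> j" for l
    proof (rule ccontr)
      assume "w (inv (t l) \<otimes> g' \<otimes> t k) \<noteq> 0"
      hence "rel (t l) (g' \<otimes> t k)" using w0 tG[OF l(1)] tG[OF ik(2)] g by (simp add: rel_def assoc[OF l(1)])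
      hence "l = j" using unique[of l j "g' \<otimes> t k"] l j g tG[OF ik(2)] by simp
      thus False using l by simp
    qed
    have "(\<rho> g * \<rho> g') $$ (i, k) = (\<Sum>l<d. w (inv (t i) \<otimes> g \<otimes> t l) * w (inv (t l) \<otimes> g' \<otimes> t k))"
      using ik by (auto simp: \<rho>_def scalar_prod_def lessThan_atLeast0 intro!: sum.cong)
    also have "\<dots> = (\<Sum>l\<in>{j}. w (inv (t i) \<otimes> g \<otimes> t l) * w (inv (t l) \<otimes> g' \<otimes> t k))"
      using j zero by (intro sum.mono_neutral_right) auto
    also have "\<dots> = w ((inv (t i) \<otimes> g \<otimes> t j) \<otimes> (inv (t j) \<otimes> g' \<otimes> t k))"
      using j g tG ik assoc[OF j(1)] by (subst wr) (auto simp: rel_def)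
    also have "(inv (t i) \<otimes> g \<otimes> t j) \<otimes> (inv (t j) \<otimes> g' \<otimes> t k) = inv (t i) \<otimes> (g \<otimes> g') \<otimes> t k"
    proof -
      have "t j \<otimes> (inv (t j) \<otimes> u) = u" if "u \<in> carrier G" for u
        using that tG[OF j(1)] by (simp add: m_assoc[symmetric])
      thus ?thesis using tG[OF j(1)] tG[OF ik(1)] tG[OF ik(2)] g by (simp add: m_assoc)
    qed
    finally show "\<rho> (g \<otimes> g') $$ (i, k) = (\<rho> g * \<rho> g') $$ (i, k)" using ik by (simp add: \<rho>_def)
  qed (auto simp: \<rho>_def)
  have w1: "w \<one> = 1"
  proof -
    have "w \<one> * w \<one> = w \<one>" using wl[of \<one> \<one>] by simp
    moreover have "w \<one> \<noteq> 0" using w0 by simp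
    ultimately show ?thesis by simp
  qed
  have one: "\<rho> \<one> = 1\<^sub>m d"
  proof (rule eq_matI)
    fix i k assume "i < dim_row (1\<^sub>m d)" "k < dim_col (1\<^sub>m d)"
    hence ik: "i < d" "k < d" by auto
    have "w (inv (t i) \<otimes> t k) = 0" if "i \<noteq> k"
    proof (rule ccontr)
      assume "w (inv (t i) \<otimes> t k) \<noteq> 0"
      hence "rel (t i) (t k)" using w0 tG ik by (simp add: rel_def)
      thus False using unique[OF ik tG[OF ik(2)]] rel_refl[OF tG[OF ik(2)]] that by simp
    qed
    thus "\<rho> \<one> $$ (i, k) = 1\<^sub>m d $$ (i, k)" using ik tG w1 by (auto simp: \<rho>_def)
  qed (auto simp: \<rho>_def)
  have hom: "\<rho> \<in> hom G (GL d)"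
  proof (rule homI)
    fix x assume x: "x \<in> carrier G"
    have "\<rho> x * \<rho> (inv x) = 1\<^sub>m d" "\<rho> (inv x) * \<rho> x = 1\<^sub>m d"
      using mult[of x "inv x"] mult[of "inv x" x] x one by simp_all
    thus "\<rho> x \<in> carrier (GL d)" using car
      by (auto simp: GL_def units_of_def Units_def ring_mat_def intro!: bexI[of _ "\<rho> (inv x)"])
  next
    fix x y assume "x \<in> carrier G" "y \<in> carrier G"
    thus "\<rho> (x \<otimes> y) = \<rho> x \<otimes>\<^bsub>GL d\<^esub> \<rho> y" using mult by (simp add: GL_simps)
  qed
  define \<chi> where "\<chi> g = mat_trace (\<rho> g)" for g
  have "is_character G \<chi>" unfolding is_character_def \<chi>_def using hom by blast
  moreover have "of_nat (card H) * \<chi> g = (\<Sum>x\<in>carrier G. w (inv x \<otimes> g \<otimes> x))" if g: "g \<in> carrier G" for g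
  proof -
    have bij: "bij_betw (\<lambda>(i, h). t i \<otimes> h) ({..<d} \<times> H) (carrier G)"
      unfolding bij_betw_def
    proof
      show "inj_on (\<lambda>(i, h). t i \<otimes> h) ({..<d} \<times> H)"
      proof
        fix x y assume x: "x \<in> {..<d} \<times> H" and y: "y \<in> {..<d} \<times> H"
          and eq: "(case x of (i, h) \<Rightarrow> t i \<otimes> h) = (case y of (i, h) \<Rightarrow> t i \<otimes> h)"
        obtain i h where xi: "x = (i, h)" "i < d" "h \<in> H" using x by auto
        obtain j h' where yj: "y = (j, h')" "j < d" "h' \<in> H" using y by auto
        have e: "t i \<otimes> h = t j \<otimes> h'" using eq xi yj by simp
        have rel: "rel (t l) (t l \<otimes> k)" if "l < d" "k \<in> H" for l k
          using that tG HG by (simp add: rel_def m_assoc[symmetric])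
        have "i = j" using unique[of i j "t i \<otimes> h"] rel[of i h] rel[of j h'] xi yj tG HG e by simp
        moreover from this have "h = h'" using e xi yj tG HG by simp
        ultimately show "x = y" using xi yj by simp
      qed
      show "(\<lambda>(i, h). t i \<otimes> h) ` ({..<d} \<times> H) = carrier G"
      proof (intro equalityI subsetI)
        fix y assume "y \<in> (\<lambda>(i, h). t i \<otimes> h) ` ({..<d} \<times> H)"
        thus "y \<in> carrier G" using tG HG by auto
      next
        fix y assume y: "y \<in> carrier G"
        obtain i where i: "i < d" "rel (t i) y" using ex[OF y] by blast
        have "y = t i \<otimes> (inv (t i) \<otimes> y)" using i tG y by (simp add: m_assoc[symmetric])
        moreover have "inv (t i) \<otimes> y \<in> H" using i by (simp add: rel_def)
        ultimately show "y \<in> (\<lambda>(i, h). t i \<otimes> h) ` ({..<d} \<times> H)"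
          using i(1) by (intro image_eqI[of _ _ "(i, inv (t i) \<otimes> y)"]) auto
      qed
    qed
    \<comment> \<open>The \<open>card H\<close> elements of a coset give equal summands, as
      \<open>w (inv h) * w h = 1\<close>.\<close>
    have conj: "w (inv (t i \<otimes> h) \<otimes> g \<otimes> (t i \<otimes> h)) = w (inv (t i) \<otimes> g \<otimes> t i)" if i: "i < d" "h \<in> H" for i h
    proof -
      define y where "y = inv (t i) \<otimes> g \<otimes> t i"
      have y: "y \<in> carrier G" using tG i g by (simp add: y_def)
      have hG: "h \<in> carrier G" and hi: "inv h \<in> H" using i HG by auto
      have "inv (t i \<otimes> h) \<otimes> g \<otimes> (t i \<otimes> h) = inv h \<otimes> (y \<otimes> h)"
        using tG[OF i(1)] hG g by (simp add: y_def inv_mult_group m_assoc)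
      hence "w (inv (t i \<otimes> h) \<otimes> g \<otimes> (t i \<otimes> h)) = w (inv h) * (w y * w h)"
        using wl[OF hi, of "y \<otimes> h"] wr[OF y i(2)] y hG by simp
      also have "\<dots> = w (inv h) * w h * w y" by simp
      also have "w (inv h) * w h = 1" using wl[OF hi hG] hG w1 by simp
      finally show ?thesis by (simp add: y_def)
    qed
    have "(\<Sum>x\<in>carrier G. w (inv x \<otimes> g \<otimes> x)) = (\<Sum>(i, h)\<in>{..<d} \<times> H. w (inv (t i \<otimes> h) \<otimes> g \<otimes> (t i \<otimes> h)))"
      using sum.reindex_bij_betw[OF bij, of "\<lambda>x. w (inv x \<otimes> g \<otimes> x)", symmetric] by (simp only: case_prod_unfold)
    also have "\<dots> = (\<Sum>i<d. \<Sum>h\<in>H. w (inv (t i \<otimes> h) \<otimes> g \<otimes> (t i \<otimes> h)))"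
      by (rule sum.cartesian_product[symmetric])
    also have "\<dots> = (\<Sum>i<d. \<Sum>h\<in>H. w (inv (t i) \<otimes> g \<otimes> t i))"
      using conj by (intro sum.cong refl) auto
    also have "\<dots> = of_nat (card H) * (\<Sum>i<d. w (inv (t i) \<otimes> g \<otimes> t i))" by (simp add: sum_distrib_left)
    also have "(\<Sum>i<d. w (inv (t i) \<otimes> g \<otimes> t i)) = \<chi> g" by (simp add: \<chi>_def mat_trace_def \<rho>_def)
    finally show ?thesis ..
  qed
  ultimately show ?thesis by blast
qed

section \<open>Conjugacy in the alternating group for distinct odd cycle lengths\<close>

locale odd_cycle_type =
  fixes \<Lambda> :: "nat set" and n :: nat
  assumes fin_\<Lambda>: "finite \<Lambda>" and odd_\<Lambda>: "\<And>l. l \<in> \<Lambda> \<Longrightarrow> odd l" and sum_\<Lambda>: "\<Sum>\<Lambda> = n"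
begin

text \<open>The points \<open>{1..n}\<close> are labelled by the cells \<open>(l, x)\<close> with \<open>l \<in> \<Lambda>\<close> and \<open>x < l\<close>; the permutation \<open>\<sigma>\<close> below
  increases \<open>x\<close> by one modulo \<open>l\<close>, and \<open>\<tau> k\<close> multiplies \<open>x\<close> by \<open>k\<close>.\<close>

definition cells :: "(nat \<times> nat) set" where "cells = Sigma \<Lambda> (\<lambda>l. {..<l})"

definition label :: "nat \<times> nat \<Rightarrow> nat" where "label = (SOME f. bij_betw f cells {1..n})"

lemma bij_label: "bij_betw label cells {1..n}"
proof -
  have "card cells = card {1..n}" using fin_\<Lambda> sum_\<Lambda> by (simp add: cells_def card_SigmaI)
  moreover have "finite cells" using fin_\<Lambda> by (simp add: cells_def)
  ultimately have "\<exists>f. bij_betw f cells {1..n}" by (intro finite_same_card_bij) auto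
  thus ?thesis unfolding label_def by (rule someI_ex)
qed

lemma label_inj:
  assumes "l \<in> \<Lambda>" "x < l" "l' \<in> \<Lambda>" "x' < l'" "label (l, x) = label (l', x')"
  shows "l = l' \<and> x = x'"
proof -
  have "inj_on label cells" using bij_label by (simp add: bij_betw_def)
  from inj_onD[OF this assms(5)] assms show ?thesis by (simp add: cells_def)
qed

lemma label_in: "l \<in> \<Lambda> \<Longrightarrow> x < l \<Longrightarrow> label (l, x) \<in> {1..n}"
  using bij_betw_apply[OF bij_label, of "(l, x)"] by (simp add: cells_def)

lemma label_cases:
  assumes "y \<in> {1..n}"
  obtains l x where "l \<in> \<Lambda>" "x < l" "y = label (l, x)"
proof -
  have "y \<in> label ` cells" using assms bij_label by (simp add: bij_betw_def)
  thus thesis using that by (auto simp: cells_def)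
qed

definition blockwise :: "(nat \<Rightarrow> nat \<Rightarrow> nat) \<Rightarrow> nat \<Rightarrow> nat" where
  "blockwise f y = (if y \<in> {1..n} then (case inv_into cells label y of (l, x) \<Rightarrow> label (l, f l x)) else y)"

lemma blockwise_label: "l \<in> \<Lambda> \<Longrightarrow> x < l \<Longrightarrow> blockwise f (label (l, x)) = label (l, f l x)"
proof -
  assume lx: "l \<in> \<Lambda>" "x < l"
  have "inv_into cells label (label (l, x)) = (l, x)"
    using bij_label lx by (intro inv_into_f_f) (auto simp: bij_betw_def cells_def)
  thus ?thesis using label_in[OF lx] by (simp add: blockwise_def)
qed

lemma blockwise_permutes_sign:
  assumes "\<And>l. l \<in> \<Lambda> \<Longrightarrow> f l permutes {..<l}"
  shows "blockwise f permutes {1..n}" "sign (blockwise f) = (\<Prod>l\<in>\<Lambda>. sign (f l))"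
proof -
  have un: "(\<Union>l\<in>\<Lambda>. (\<lambda>x. label (l, x)) ` {..<l}) = {1..n}"
  proof (intro equalityI subsetI)
    fix y assume "y \<in> {1..n}"
    then obtain l x where "l \<in> \<Lambda>" "x < l" "y = label (l, x)" by (rule label_cases)
    thus "y \<in> (\<Union>l\<in>\<Lambda>. (\<lambda>x. label (l, x)) ` {..<l})" by blast
  qed (use label_in in auto)
  have "blockwise f permutes (\<Union>l\<in>\<Lambda>. (\<lambda>x. label (l, x)) ` {..<l}) \<and> sign (blockwise f) = (\<Prod>l\<in>\<Lambda>. sign (f l))"
  proof (rule sign_blocks[OF fin_\<Lambda>])
    show "inj_on (\<lambda>x. label (l, x)) {..<l}" if "l \<in> \<Lambda>" for l
      using label_inj[of l _ l] that by (auto simp: inj_on_def)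
    show "(\<lambda>x. label (l, x)) ` {..<l} \<inter> (\<lambda>x. label (u, x)) ` {..<u} = {}"
      if "l \<in> \<Lambda>" "u \<in> \<Lambda>" "l \<noteq> u" for l u
      using label_inj[of l _ u] that by auto
    show "blockwise f y = y" if "y \<notin> (\<Union>l\<in>\<Lambda>. (\<lambda>x. label (l, x)) ` {..<l})" for y
    proof -
      have "y \<notin> {1..n}" using that unfolding un .
      thus ?thesis unfolding blockwise_def by (rule if_not_P)
    qed
  qed (use assms blockwise_label in auto)
  thus "blockwise f permutes {1..n}" "sign (blockwise f) = (\<Prod>l\<in>\<Lambda>. sign (f l))" unfolding un by auto
qed

definition \<sigma> :: "nat \<Rightarrow> nat" where "\<sigma> = blockwise (\<lambda>l. addperm l 1)"

definition \<tau> :: "nat \<Rightarrow> nat \<Rightarrow> nat" where "\<tau> k = blockwise (\<lambda>l. mulperm l k)"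

abbreviation "m \<equiv> group.ord (alt_group n) \<sigma>"

lemma \<sigma>_permutes: "\<sigma> permutes {1..n}"
  unfolding \<sigma>_def by (rule blockwise_permutes_sign(1)) (rule addperm_permutes)

lemma \<sigma>_alt: "\<sigma> \<in> carrier (alt_group n)"
proof -
  have "sign \<sigma> = (\<Prod>l\<in>\<Lambda>. sign (addperm l 1))"
    unfolding \<sigma>_def by (rule blockwise_permutes_sign(2)) (rule addperm_permutes)
  also have "\<dots> = 1" using odd_\<Lambda> sign_addperm by simp
  finally have "evenperm \<sigma>" by (simp add: sign_def split: if_splits)
  thus ?thesis using \<sigma>_permutes by (simp add: alt_group_carrier)
qed

lemma \<sigma>_funpow: "l \<in> \<Lambda> \<Longrightarrow> x < l \<Longrightarrow> (\<sigma> ^^ k) (label (l, x)) = label (l, (x + k) mod l)"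
proof (induction k)
  case (Suc k)
  have "(x + k) mod l < l" using Suc.prems by simp
  thus ?case using Suc by (simp add: \<sigma>_def blockwise_label addperm_def mod_simps)
qed simp

lemma fun_eq_on_labels:
  assumes "f permutes {1..n}" "g permutes {1..n}"
    "\<And>l x. l \<in> \<Lambda> \<Longrightarrow> x < l \<Longrightarrow> f (label (l, x)) = g (label (l, x))"
  shows "f = g"
proof
  fix y
  show "f y = g y"
  proof (cases "y \<in> {1..n}")
    case True
    then obtain l x where "l \<in> \<Lambda>" "x < l" "y = label (l, x)" by (rule label_cases)
    thus ?thesis using assms(3) by simp
  next
    case False
    thus ?thesis using permutes_not_in[OF assms(1)] permutes_not_in[OF assms(2)] by simp
  qed
qed

lemma \<sigma>_funpow_permutes: "\<sigma> ^^ k permutes {1..n}"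
  by (rule permutes_funpow[OF \<sigma>_permutes])

lemma \<sigma>_funpow_eq_iff: "\<sigma> ^^ i = \<sigma> ^^ j \<longleftrightarrow> (\<forall>l\<in>\<Lambda>. i mod l = j mod l)"
proof
  assume eq: "\<sigma> ^^ i = \<sigma> ^^ j"
  show "\<forall>l\<in>\<Lambda>. i mod l = j mod l"
  proof
    fix l assume l: "l \<in> \<Lambda>"
    hence l0: "0 < l" using odd_\<Lambda>[OF l] by (cases l) auto
    have "label (l, i mod l) = label (l, j mod l)"
      using eq \<sigma>_funpow[OF l l0, of i] \<sigma>_funpow[OF l l0, of j] by simp
    thus "i mod l = j mod l" using label_inj[OF l _ l] l0 by simp
  qed
next
  assume "\<forall>l\<in>\<Lambda>. i mod l = j mod l"
  hence "(x + i) mod l = (x + j) mod l" if "l \<in> \<Lambda>" for x l using that by (metis mod_add_right_eq)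
  thus "\<sigma> ^^ i = \<sigma> ^^ j"
    by (intro fun_eq_on_labels \<sigma>_funpow_permutes) (simp add: \<sigma>_funpow)
qed

lemma m_dvd_iff: "m dvd k \<longleftrightarrow> (\<forall>l\<in>\<Lambda>. l dvd k)"
proof -
  have "m dvd k \<longleftrightarrow> \<sigma> ^^ k = id"
    using group.pow_eq_id[OF alt_group_is_group \<sigma>_alt, of k] by (simp add: alt_group_pow alt_group_one)
  also have "\<dots> \<longleftrightarrow> \<sigma> ^^ k = \<sigma> ^^ 0" by (simp add: id_def)
  also have "\<dots> \<longleftrightarrow> (\<forall>l\<in>\<Lambda>. l dvd k)" by (simp only: \<sigma>_funpow_eq_iff mod_0 dvd_eq_mod_eq_0)
  finally show ?thesis .
qed

lemma \<sigma>_pow_m: "\<sigma> ^^ m = id"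
  using group.pow_ord_eq_1[OF alt_group_is_group \<sigma>_alt] by (simp add: alt_group_pow alt_group_one)

lemma m_dvd_prod: "m dvd \<Prod>\<Lambda>" and prod_odd: "odd (\<Prod>\<Lambda>)" and m_pos: "m > 0" and dvd_m: "l \<in> \<Lambda> \<Longrightarrow> l dvd m"
proof -
  show mp: "m dvd \<Prod>\<Lambda>" using fin_\<Lambda> by (auto simp: m_dvd_iff)
  show "odd (\<Prod>\<Lambda>)" using odd_\<Lambda> fin_\<Lambda> by (simp add: even_prod_iff)
  hence "\<Prod>\<Lambda> \<noteq> 0" by (intro notI) simp
  thus "m > 0" using mp by (metis dvd_0_left_iff gr0I)
  show "l dvd m" if "l \<in> \<Lambda>" using m_dvd_iff[of m] that by simp
qed

lemma funpow_m_inj: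
  assumes "i < m" "j < m" "\<sigma> ^^ i = \<sigma> ^^ j"
  shows "i = j"
proof -
  have wlog: "i = j" if "i \<le> j" "j < m" "\<sigma> ^^ i = \<sigma> ^^ j" for i j
  proof -
    have "\<forall>l\<in>\<Lambda>. l dvd j - i" using that(1,3) \<sigma>_funpow_eq_iff by (metis mod_eq_dvd_iff_nat)
    hence "m dvd j - i" by (simp add: m_dvd_iff)
    thus ?thesis using that by (auto dest: dvd_imp_le)
  qed
  show ?thesis using wlog[of i j] wlog[of j i] assms by (cases "i \<le> j") auto
qed

lemma \<tau>_permutes_sign:
  assumes "coprime k m"
  shows "\<tau> k permutes {1..n}" "sign (\<tau> k) = (\<Prod>l\<in>\<Lambda>. sign (mulperm l k))"
proof -
  have "mulperm l k permutes {..<l}" if "l \<in> \<Lambda>" for l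
    using assms dvd_m[OF that] by (intro mulperm_permutes) (metis coprime_divisors dvd_refl)
  thus "\<tau> k permutes {1..n}" "sign (\<tau> k) = (\<Prod>l\<in>\<Lambda>. sign (mulperm l k))"
    unfolding \<tau>_def by (intro blockwise_permutes_sign; simp)+
qed

lemma \<tau>_conj:
  assumes "coprime k m"
  shows "\<tau> k \<circ> \<sigma> = (\<sigma> ^^ k) \<circ> \<tau> k"
proof (rule fun_eq_on_labels)
  fix l x assume l: "l \<in> \<Lambda>" "x < l"
  have "\<tau> k (\<sigma> (label (l, x))) = label (l, (k * ((x + 1) mod l)) mod l)"
    using l \<sigma>_funpow[OF l, of 1] by (simp add: \<tau>_def blockwise_label mulperm_def)
  also have "\<dots> = label (l, ((k * x) mod l + k) mod l)" by (simp add: mod_simps algebra_simps)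
  also have "\<dots> = (\<sigma> ^^ k) (\<tau> k (label (l, x)))"
  proof -
    have "(k * x) mod l < l" using l by simp
    thus ?thesis using l \<sigma>_funpow[OF l(1), of "(k * x) mod l" k] by (simp add: \<tau>_def blockwise_label mulperm_def)
  qed
  finally show "(\<tau> k \<circ> \<sigma>) (label (l, x)) = ((\<sigma> ^^ k) \<circ> \<tau> k) (label (l, x))" by simp
qed (intro permutes_compose \<sigma>_permutes \<sigma>_funpow_permutes \<tau>_permutes_sign(1) assms)+

lemma commute_funpow:
  assumes "\<sigma> \<circ> c = c \<circ> (\<sigma> ^^ k)"
  shows "(\<sigma> ^^ j) \<circ> c = c \<circ> (\<sigma> ^^ (k * j))"
proof (induction j)
  case (Suc j)
  have "(\<sigma> ^^ Suc j) \<circ> c = \<sigma> \<circ> ((\<sigma> ^^ j) \<circ> c)" by (simp only: funpow.simps comp_assoc)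
  also have "\<dots> = (\<sigma> \<circ> c) \<circ> (\<sigma> ^^ (k * j))" by (simp only: Suc comp_assoc)
  also have "\<dots> = c \<circ> (\<sigma> ^^ (k * Suc j))" by (simp only: assms comp_assoc funpow_add mult_Suc_right)
  finally show ?case .
qed simp

text \<open>Since the lengths are distinct, a permutation commuting with \<open>\<sigma>\<close>
  maps every cycle to itself, where it is a rotation. So its order divides the odd number
  \<open>\<Prod>\<Lambda>\<close>.\<close>

lemma centralizer_even:
  assumes c: "c permutes {1..n}" "\<sigma> \<circ> c = c \<circ> \<sigma>"
  shows "sign c = 1"
proof (rule sign_odd_order[OF _ _ prod_odd])
  show "permutation c" using c(1) permutation_permutes by blast
  have "\<sigma> \<circ> c = c \<circ> (\<sigma> ^^ 1)" using c(2) by simp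
  from commute_funpow[OF this] have "(\<sigma> ^^ j) \<circ> c = c \<circ> (\<sigma> ^^ j)" for j by simp
  hence comm: "(\<sigma> ^^ j) (c y) = c ((\<sigma> ^^ j) y)" for j y by (metis comp_apply)
  have block: "\<exists>s. \<forall>x<l. c (label (l, x)) = label (l, (x + s) mod l)" if l: "l \<in> \<Lambda>" for l
  proof -
    have l0: "0 < l" using odd_\<Lambda>[OF l] by (cases l) auto
    have "c (label (l, 0)) \<in> {1..n}" using label_in[OF l l0] c(1) by (simp only: permutes_in_image)
    then obtain u s where u: "u \<in> \<Lambda>" "s < u" "c (label (l, 0)) = label (u, s)" by (rule label_cases)
    \<comment> \<open>\<open>\<sigma> ^^ l\<close> fixes the start of the cycle of length
      \<open>l\<close>, hence also its image; the reverse divisibility uses that \<open>c\<close> is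
      injective.\<close>
    have "u dvd l"
    proof -
      have "label (u, (s + l) mod u) = c ((\<sigma> ^^ l) (label (l, 0)))"
        unfolding comm[symmetric] u(3) by (rule \<sigma>_funpow[OF u(1,2), symmetric])
      also have "(\<sigma> ^^ l) (label (l, 0)) = label (l, 0)" using \<sigma>_funpow[OF l l0, of l] by simp
      finally have eq: "label (u, (s + l) mod u) = label (u, s)" unfolding u(3) .
      have "(s + l) mod u < u" using u(2) by simp
      hence "(s + l) mod u = s" using label_inj[OF u(1) _ u(1,2) eq] by blast
      hence "(s + l) mod u = s mod u" using u(2) by simp
      hence "u dvd s + l - s" by (subst mod_eq_dvd_iff_nat[symmetric]) auto
      thus ?thesis by simp
    qed
    moreover have "l dvd u"
    proof -
      have "c (label (l, u mod l)) = c ((\<sigma> ^^ u) (label (l, 0)))" using \<sigma>_funpow[OF l l0, of u] by simp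
      also have "\<dots> = label (u, (s + u) mod u)" unfolding comm[symmetric] u(3) by (rule \<sigma>_funpow[OF u(1,2)])
      also have "(s + u) mod u = s" using u(2) by simp
      also have "label (u, s) = c (label (l, 0))" by (rule u(3)[symmetric])
      finally have eq: "label (l, u mod l) = label (l, 0)" using injD[OF permutes_inj[OF c(1)]] by blast
      have "u mod l < l" using l0 by simp
      hence "u mod l = 0" using label_inj[OF l _ l l0 eq] by blast
      thus ?thesis by (simp only: dvd_eq_mod_eq_0)
    qed
    ultimately have ul: "u = l" by (rule dvd_antisym)
    have "c (label (l, x)) = label (l, (x + s) mod l)" if x: "x < l" for x
    proof -
      have "c (label (l, x)) = c ((\<sigma> ^^ x) (label (l, 0)))" using \<sigma>_funpow[OF l l0, of x] x by simp
      also have "\<dots> = (\<sigma> ^^ x) (label (l, s))" unfolding comm[symmetric] u(3) ul ..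
      also have "\<dots> = label (l, (x + s) mod l)" using \<sigma>_funpow[OF u(1,2), of x] ul by (simp add: add.commute)
      finally show ?thesis .
    qed
    thus ?thesis by blast
  qed
  show "c ^^ \<Prod>\<Lambda> = id"
  proof (rule fun_eq_on_labels)
    show "c ^^ \<Prod>\<Lambda> permutes {1..n}" by (rule permutes_funpow[OF c(1)])
    show "id permutes {1..n}" by (rule permutes_id)
    fix l x assume l: "l \<in> \<Lambda>" "x < l"
    obtain s where s: "\<And>x. x < l \<Longrightarrow> c (label (l, x)) = label (l, (x + s) mod l)" using block[OF l(1)] by blast
    have pow: "(c ^^ j) (label (l, x)) = label (l, (x + j * s) mod l)" for j
    proof (induction j)
      case (Suc j)
      have "(x + j * s) mod l < l" using l by simp
      thus ?case using Suc s by (simp add: mod_simps add_ac)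
    qed (use l in simp)
    have "l dvd \<Prod>\<Lambda>" using l(1) fin_\<Lambda> by auto
    then obtain q where "\<Prod>\<Lambda> = l * q" by blast
    hence "(x + \<Prod>\<Lambda> * s) mod l = x" using l(2) by (simp add: mult.assoc)
    thus "(c ^^ \<Prod>\<Lambda>) (label (l, x)) = id (label (l, x))" unfolding pow by simp
  qed
qed

definition cent :: "(nat \<Rightarrow> nat) set" where
  "cent = {c. c permutes {1..n} \<and> \<sigma> \<circ> c = c \<circ> \<sigma>}"

text \<open>The even \<open>x\<close> whose inverse conjugates \<open>\<sigma>\<close> to
  \<open>\<sigma> ^^ k\<close>, as the induced character formula requires.\<close>

definition conjugators :: "nat \<Rightarrow> (nat \<Rightarrow> nat) set" where
  "conjugators k = {x \<in> carrier (alt_group n). \<sigma> \<circ> x = x \<circ> (\<sigma> ^^ k)}"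

lemma card_cent_pos: "card cent > 0"
proof -
  have "finite cent" unfolding cent_def by (rule finite_subset[OF _ finite_permutations[of "{1..n}"]]) auto
  moreover have "id \<in> cent" by (simp add: cent_def permutes_id)
  ultimately show ?thesis by (auto simp: card_gt_0_iff)
qed

lemma sign_alt: "x \<in> carrier (alt_group n) \<longleftrightarrow> x permutes {1..n} \<and> sign x = 1"
  by (auto simp: alt_group_carrier sign_def)

text \<open>Conjugation preserves the order, but \<open>\<sigma> ^^ k\<close> is already killed by
  the exponent \<open>m div gcd k m\<close>.\<close>

lemma conjugators_noncoprime:
  assumes "\<not> coprime k m"
  shows "conjugators k = {}"
proof (rule ccontr)
  assume "conjugators k \<noteq> {}"
  then obtain x where x: "x permutes {1..n}" "\<sigma> \<circ> x = x \<circ> (\<sigma> ^^ k)"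
    by (auto simp: conjugators_def alt_group_carrier)
  define g where "g = gcd k m"
  have g: "g dvd k" "g dvd m" "g \<noteq> 1" using assms unfolding g_def coprime_iff_gcd_eq_1 by simp_all
  obtain a where a: "k = g * a" using g(1) by (rule dvdE)
  obtain j where j: "m = g * j" using g(2) by (rule dvdE)
  have "k * j = m * a" unfolding a j by (simp only: mult_ac)
  hence "m dvd k * j" by simp
  hence "\<sigma> ^^ (k * j) = id"
    using group.pow_eq_id[OF alt_group_is_group \<sigma>_alt, of "k * j"] by (simp add: alt_group_pow alt_group_one)
  hence "(\<sigma> ^^ j) \<circ> x = x" using commute_funpow[OF x(2), of j] by (simp only: comp_id)
  hence "(\<sigma> ^^ j) \<circ> x \<circ> inv' x = x \<circ> inv' x" by (simp only:)
  hence "\<sigma> ^^ j = id" unfolding comp_assoc permutes_inv_o(1)[OF x(1)] by (simp only: comp_id)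
  hence "m dvd j"
    using group.pow_eq_id[OF alt_group_is_group \<sigma>_alt, of j] by (simp add: alt_group_pow alt_group_one)
  moreover have j0: "j > 0" using m_pos unfolding j by simp
  ultimately have "m \<le> j" by (rule dvd_imp_le)
  hence "g * j \<le> 1 * j" unfolding j by simp
  hence "g \<le> 1" using j0 by simp
  moreover have "g \<noteq> 0" using m_pos unfolding j by (intro notI) simp
  ultimately show False using g(3) by simp
qed

text \<open>Among all permutations the solutions form the coset of the centralizer through the
  inverse of \<open>\<tau> k\<close>. The centralizer being even, they all share the sign of
  \<open>\<tau> k\<close>.\<close>

lemma card_conjugators:
  assumes k: "coprime k m"
  shows "card (conjugators k) = (if sign (\<tau> k) = 1 then card cent else 0)"
proof -
  note \<tau>p = \<tau>_permutes_sign(1)[OF k]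
  have perm: "permutation f" if "f permutes {1..n}" for f :: "nat \<Rightarrow> nat"
    using that permutation_permutes by blast
  have fwd: "x \<circ> \<tau> k \<in> cent" if "x \<in> conjugators k" for x
  proof -
    have x: "x permutes {1..n}" "\<sigma> \<circ> x = x \<circ> (\<sigma> ^^ k)" using that by (auto simp: conjugators_def alt_group_carrier)
    have "\<sigma> \<circ> (x \<circ> \<tau> k) = x \<circ> ((\<sigma> ^^ k) \<circ> \<tau> k)" by (simp only: x(2) o_assoc)
    also have "\<dots> = (x \<circ> \<tau> k) \<circ> \<sigma>" by (simp only: \<tau>_conj[OF k, symmetric] o_assoc)
    finally show ?thesis using permutes_compose[OF \<tau>p x(1)] by (simp add: cent_def)
  qed
  show ?thesis
  proof (cases "sign (\<tau> k) = 1")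
    case True
    have bwd: "c \<circ> inv' (\<tau> k) \<in> conjugators k" if "c \<in> cent" for c
    proof -
      have c: "c permutes {1..n}" "\<sigma> \<circ> c = c \<circ> \<sigma>" using that by (auto simp: cent_def)
      have "inv' (\<tau> k) \<circ> (\<tau> k \<circ> \<sigma>) \<circ> inv' (\<tau> k) = inv' (\<tau> k) \<circ> ((\<sigma> ^^ k) \<circ> \<tau> k) \<circ> inv' (\<tau> k)"
        by (simp only: \<tau>_conj[OF k])
      hence "(inv' (\<tau> k) \<circ> \<tau> k) \<circ> \<sigma> \<circ> inv' (\<tau> k) = inv' (\<tau> k) \<circ> (\<sigma> ^^ k) \<circ> (\<tau> k \<circ> inv' (\<tau> k))"
        by (simp only: comp_assoc)
      hence swap: "\<sigma> \<circ> inv' (\<tau> k) = inv' (\<tau> k) \<circ> (\<sigma> ^^ k)"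
        by (simp only: permutes_inv_o[OF \<tau>p] id_comp comp_id)
      have "\<sigma> \<circ> (c \<circ> inv' (\<tau> k)) = c \<circ> (\<sigma> \<circ> inv' (\<tau> k))" by (simp only: c(2) o_assoc)
      also have "\<dots> = (c \<circ> inv' (\<tau> k)) \<circ> (\<sigma> ^^ k)" by (simp only: swap o_assoc)
      finally have eq: "\<sigma> \<circ> (c \<circ> inv' (\<tau> k)) = (c \<circ> inv' (\<tau> k)) \<circ> (\<sigma> ^^ k)" .
      have "sign (c \<circ> inv' (\<tau> k)) = 1"
        using sign_compose[OF perm[OF c(1)] perm[OF permutes_inv[OF \<tau>p]]] sign_inverse[OF perm[OF \<tau>p]]
          centralizer_even[OF c] True by simp
      moreover have "c \<circ> inv' (\<tau> k) permutes {1..n}" by (rule permutes_compose[OF permutes_inv[OF \<tau>p] c(1)])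
      ultimately show ?thesis using eq by (simp add: conjugators_def sign_alt)
    qed
    have "bij_betw (\<lambda>x. x \<circ> \<tau> k) (conjugators k) cent"
    proof (rule bij_betw_byWitness[of _ "\<lambda>c. c \<circ> inv' (\<tau> k)"])
      show "\<forall>x\<in>conjugators k. x \<circ> \<tau> k \<circ> inv' (\<tau> k) = x"
        by (intro ballI) (simp only: comp_assoc permutes_inv_o[OF \<tau>p] comp_id)
      show "\<forall>c\<in>cent. c \<circ> inv' (\<tau> k) \<circ> \<tau> k = c"
        by (intro ballI) (simp only: comp_assoc permutes_inv_o[OF \<tau>p] comp_id)
    qed (use fwd bwd in auto)
    thus ?thesis using True bij_betw_same_card by auto
  next
    case False
    have "x \<notin> conjugators k" for x
    proof
      assume x: "x \<in> conjugators k"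
      hence xs: "x permutes {1..n}" "sign x = 1" by (auto simp: conjugators_def sign_alt)
      have "sign (x \<circ> \<tau> k) = 1" using fwd[OF x] centralizer_even by (simp add: cent_def)
      hence "sign (\<tau> k) = 1" using sign_compose[OF perm[OF xs(1)] perm[OF \<tau>p]] xs(2) by simp
      thus False using False by contradiction
    qed
    hence "conjugators k = {}" by blast
    thus ?thesis using False by simp
  qed
qed

text \<open>The character sending \<open>\<sigma> ^^ k\<close> to \<open>z ^ k\<close> is induced
  from the cyclic group \<open>H\<close> of \<open>\<sigma>\<close>; it is well defined because the
  cycle length \<open>p\<close> makes \<open>\<sigma> ^^ k\<close> determine \<open>k\<close> modulo
  \<open>p\<close>. Grouping the sum over the group by the power of \<open>\<sigma>\<close> that is
  reached, each admissible \<open>k\<close> occurs \<open>card cent\<close> times.\<close>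

lemma character_value:
  fixes z :: complex
  assumes p: "p \<in> \<Lambda>" and z: "z ^ p = 1" "z \<noteq> 0"
  shows "\<exists>\<chi> c. is_character (alt_group n) \<chi> \<and> c \<in> \<rat> \<and>
    (\<Sum>k | k < m \<and> coprime k m \<and> sign (\<tau> k) = 1. z ^ k) = c * \<chi> \<sigma>"
proof -
  interpret A: group "alt_group n" by (rule alt_group_is_group)
  have finA: "finite (carrier (alt_group n))"
    by (rule finite_subset[OF _ finite_permutations[of "{1..n}"]]) (auto simp: alt_group_carrier)
  have pow_closed: "\<sigma> ^^ k \<in> carrier (alt_group n)" for k
    using A.nat_pow_closed[OF \<sigma>_alt, of k] by (simp only: alt_group_pow)
  define H where "H = range (\<lambda>k. \<sigma> ^^ k)"
  define w where "w x = (if x \<in> H then z ^ (SOME k. x = \<sigma> ^^ k) else 0)" for x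
  have w_pow: "w (\<sigma> ^^ k) = z ^ k" for k
  proof -
    have "\<sigma> ^^ k = \<sigma> ^^ (SOME j. \<sigma> ^^ k = \<sigma> ^^ j)" by (rule someI[of _ k]) (rule refl)
    hence "[k = (SOME j. \<sigma> ^^ k = \<sigma> ^^ j)] (mod p)" using \<sigma>_funpow_eq_iff p unfolding cong_def by blast
    hence "z ^ k = z ^ (SOME j. \<sigma> ^^ k = \<sigma> ^^ j)" by (rule root_of_unity_pow_cong[OF z(1)])
    thus ?thesis by (simp add: w_def H_def)
  qed
  have H_inv: "inv\<^bsub>alt_group n\<^esub> (\<sigma> ^^ k) = \<sigma> ^^ (k * (m - 1))" for k
  proof -
    have "k * (m - 1) + k = m * k" using m_pos by (simp add: algebra_simps)
    hence "\<sigma> ^^ (k * (m - 1)) \<circ> \<sigma> ^^ k = \<sigma> ^^ (m * k)" by (metis funpow_add)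
    also have "\<dots> = id" by (simp only: funpow_mult[symmetric] \<sigma>_pow_m id_funpow)
    finally show ?thesis
      by (intro A.inv_equality pow_closed) (simp add: alt_group_mult alt_group_one)
  qed
  have H: "subgroup H (alt_group n)"
  proof
    show "H \<subseteq> carrier (alt_group n)" using pow_closed by (auto simp: H_def)
    show "x \<otimes>\<^bsub>alt_group n\<^esub> y \<in> H" if "x \<in> H" "y \<in> H" for x y
      using that by (auto simp: H_def alt_group_mult simp flip: funpow_add)
    show "\<one>\<^bsub>alt_group n\<^esub> \<in> H" unfolding H_def alt_group_one by (rule range_eqI[of _ _ 0]) (simp add: id_def)
    show "inv\<^bsub>alt_group n\<^esub> x \<in> H" if "x \<in> H" for x using that H_inv by (auto simp: H_def)
  qed
  interpret H: subgroup H "alt_group n" by (rule H)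
  have "\<exists>\<chi>. is_character (alt_group n) \<chi> \<and>
    (\<forall>g\<in>carrier (alt_group n). of_nat (card H) * \<chi> g =
      (\<Sum>x\<in>carrier (alt_group n). w (inv\<^bsub>alt_group n\<^esub> x \<otimes>\<^bsub>alt_group n\<^esub> g \<otimes>\<^bsub>alt_group n\<^esub> x)))"
  proof (rule A.induced_character[OF finA H])
    show "w x \<noteq> 0 \<longleftrightarrow> x \<in> H" for x using z(2) by (simp add: w_def)
    show "w (x \<otimes>\<^bsub>alt_group n\<^esub> y) = w x * w y" if xy: "x \<in> H" "y \<in> carrier (alt_group n)" for x y
    proof (cases "y \<in> H")
      case True
      obtain i j where "x = \<sigma> ^^ i" "y = \<sigma> ^^ j" using xy(1) True unfolding H_def by blast
      thus ?thesis by (simp only: alt_group_mult funpow_add[symmetric] w_pow power_add)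
    next
      case False
      have "x \<otimes>\<^bsub>alt_group n\<^esub> y \<notin> H"
      proof
        assume "x \<otimes>\<^bsub>alt_group n\<^esub> y \<in> H"
        hence "inv\<^bsub>alt_group n\<^esub> x \<otimes>\<^bsub>alt_group n\<^esub> (x \<otimes>\<^bsub>alt_group n\<^esub> y) \<in> H" using xy by simp
        moreover have "inv\<^bsub>alt_group n\<^esub> x \<otimes>\<^bsub>alt_group n\<^esub> (x \<otimes>\<^bsub>alt_group n\<^esub> y) = y"
          using xy H.mem_carrier by (simp add: A.m_assoc[symmetric])
        ultimately show False using False by simp
      qed
      thus ?thesis using False by (simp add: w_def)
    qed
    show "w (x \<otimes>\<^bsub>alt_group n\<^esub> y) = w x * w y" if xy: "x \<in> carrier (alt_group n)" "y \<in> H" for x y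
    proof (cases "x \<in> H")
      case True
      obtain i j where "x = \<sigma> ^^ i" "y = \<sigma> ^^ j" using xy(2) True unfolding H_def by blast
      thus ?thesis by (simp only: alt_group_mult funpow_add[symmetric] w_pow power_add)
    next
      case False
      have "x \<otimes>\<^bsub>alt_group n\<^esub> y \<notin> H"
      proof
        assume "x \<otimes>\<^bsub>alt_group n\<^esub> y \<in> H"
        hence "(x \<otimes>\<^bsub>alt_group n\<^esub> y) \<otimes>\<^bsub>alt_group n\<^esub> inv\<^bsub>alt_group n\<^esub> y \<in> H" using xy by simp
        moreover have "(x \<otimes>\<^bsub>alt_group n\<^esub> y) \<otimes>\<^bsub>alt_group n\<^esub> inv\<^bsub>alt_group n\<^esub> y = x"
          using xy H.mem_carrier by (simp add: A.m_assoc)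
        ultimately show False using False by simp
      qed
      thus ?thesis using False by (simp add: w_def)
    qed
  qed
  then obtain \<chi> where \<chi>: "is_character (alt_group n) \<chi>"
    "of_nat (card H) * \<chi> \<sigma> =
      (\<Sum>x\<in>carrier (alt_group n). w (inv\<^bsub>alt_group n\<^esub> x \<otimes>\<^bsub>alt_group n\<^esub> \<sigma> \<otimes>\<^bsub>alt_group n\<^esub> x))"
    using \<sigma>_alt by blast
  have w_conj: "w (inv\<^bsub>alt_group n\<^esub> x \<otimes>\<^bsub>alt_group n\<^esub> \<sigma> \<otimes>\<^bsub>alt_group n\<^esub> x) =
    (\<Sum>k<m. if x \<in> conjugators k then z ^ k else 0)" if x: "x \<in> carrier (alt_group n)" for x
  proof -
    define y where "y = inv\<^bsub>alt_group n\<^esub> x \<otimes>\<^bsub>alt_group n\<^esub> \<sigma> \<otimes>\<^bsub>alt_group n\<^esub> x"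
    have iff: "x \<in> conjugators k \<longleftrightarrow> y = \<sigma> ^^ k" for k
    proof -
      have "y = \<sigma> ^^ k \<longleftrightarrow> x \<otimes>\<^bsub>alt_group n\<^esub> y = x \<otimes>\<^bsub>alt_group n\<^esub> (\<sigma> ^^ k)"
        using x \<sigma>_alt pow_closed by (simp add: y_def)
      also have "x \<otimes>\<^bsub>alt_group n\<^esub> y = \<sigma> \<otimes>\<^bsub>alt_group n\<^esub> x"
        using x \<sigma>_alt by (simp add: y_def A.m_assoc[symmetric])
      finally show ?thesis using x unfolding conjugators_def alt_group_mult by blast
    qed
    show ?thesis
    proof (cases "y \<in> H")
      case True
      then obtain j where "y = \<sigma> ^^ j" by (auto simp: H_def)
      also have "\<sigma> ^^ j = \<sigma> ^^ (j mod m)" by (rule funpow_cong[OF \<sigma>_pow_m]) (simp add: cong_def)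
      finally have j: "y = \<sigma> ^^ (j mod m)" .
      have jm: "j mod m < m" using m_pos by simp
      have "x \<in> conjugators k \<longleftrightarrow> k = j mod m" if "k < m" for k
        unfolding iff j using funpow_m_inj[OF jm that] by auto
      hence "(\<Sum>k<m. if x \<in> conjugators k then z ^ k else 0) = (\<Sum>k<m. if k = j mod m then z ^ k else 0)"
        by (intro sum.cong) auto
      also have "\<dots> = z ^ (j mod m)" using jm by (simp add: sum.delta)
      also have "\<dots> = w y" unfolding j w_pow ..
      finally show ?thesis by (simp add: y_def)
    next
      case False
      hence "\<not> x \<in> conjugators k" for k unfolding iff H_def by blast
      thus ?thesis using False by (simp add: w_def y_def)
    qed
  qed
  have "of_nat (card H) * \<chi> \<sigma> = (\<Sum>x\<in>carrier (alt_group n). \<Sum>k<m. if x \<in> conjugators k then z ^ k else 0)"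
    unfolding \<chi>(2) by (intro sum.cong refl w_conj)
  also have "\<dots> = (\<Sum>k<m. \<Sum>x\<in>carrier (alt_group n). if x \<in> conjugators k then z ^ k else 0)"
    by (rule sum.swap)
  also have "\<dots> = (\<Sum>k<m. of_nat (card (conjugators k)) * z ^ k)"
  proof (intro sum.cong refl)
    fix k
    have "carrier (alt_group n) \<inter> conjugators k = conjugators k" by (auto simp: conjugators_def)
    thus "(\<Sum>x\<in>carrier (alt_group n). if x \<in> conjugators k then z ^ k else 0) = of_nat (card (conjugators k)) * z ^ k"
      using finA by (simp add: sum.If_cases)
  qed
  also have "\<dots> = (\<Sum>k<m. if coprime k m \<and> sign (\<tau> k) = 1 then of_nat (card cent) * z ^ k else 0)"
  proof (intro sum.cong refl)
    fix k
    show "of_nat (card (conjugators k)) * z ^ k =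
        (if coprime k m \<and> sign (\<tau> k) = 1 then of_nat (card cent) * z ^ k else 0)"
      by (cases "coprime k m") (simp_all add: card_conjugators conjugators_noncoprime)
  qed
  also have "\<dots> = (\<Sum>k | k < m \<and> coprime k m \<and> sign (\<tau> k) = 1. of_nat (card cent) * z ^ k)"
    by (simp add: sum.inter_filter[symmetric] conj_assoc)
  also have "\<dots> = of_nat (card cent) * (\<Sum>k | k < m \<and> coprime k m \<and> sign (\<tau> k) = 1. z ^ k)"
    by (simp add: sum_distrib_left)
  finally have "(\<Sum>k | k < m \<and> coprime k m \<and> sign (\<tau> k) = 1. z ^ k) =
      (of_nat (card H) / of_nat (card cent)) * \<chi> \<sigma>"
    using card_cent_pos by (simp add: field_simps)
  moreover have "(of_nat (card H) / of_nat (card cent) :: complex) \<in> \<rat>" by simp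
  ultimately show ?thesis using \<chi>(1) by blast
qed

end

section \<open>The field of character values\<close>

text \<open>The factor \<open>(1 + s r) / 2\<close> selects the residues of sign 1. The sum of
  \<open>s r * z ^ r\<close> is \<open>G 1\<close>: along the powers of \<open>g\<close> it is the
  alternating sum of \<open>h\<close>, and \<open>2 * G 1 = G 1 - G g\<close> runs through this sum
  twice.\<close>

lemma (in gauss_sum) sum_quadratic_residues:
  "(\<Sum>r | r \<in> {1..<p} \<and> sign (mulperm p r) = 1. z ^ r) = (G 1 - 1) / 2"
proof -
  define s :: "nat \<Rightarrow> complex" where "s r = of_int (sign (mulperm p r))" for r
  define h where "h j = (- 1) ^ j * z ^ (g ^ j)" for j
  have per: "h (n + (p - 1)) = h n" for n
    using pow_g_periodic[of 1 n 1] even_p1 by (simp add: h_def power_add)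
  have "(\<Sum>r\<in>{1..<p}. s r * z ^ r) = (\<Sum>j<p - 1. s (g ^ j) * z ^ (g ^ j))"
    by (rule sum_units_primroot[OF prime_p primroot, symmetric])
       (simp add: s_def mulperm_mod root_of_unity_pow_mod[OF z_pow])
  also have "\<dots> = (\<Sum>j<p - 1. h j)"
    by (simp add: s_def h_def sign_mulperm_primroot[OF prime_p odd_p primroot])
  finally have T: "(\<Sum>r\<in>{1..<p}. s r * z ^ r) = (\<Sum>j<p - 1. h j)" .
  have "2 * G 1 = G 1 - G g" using G_neg by (simp add: eq_neg_iff_add_eq_0[symmetric])
  also have "\<dots> = (\<Sum>i<p - 1. h (2 * i)) + (\<Sum>i<p - 1. h (2 * i + 1))"
    by (simp add: G_primroot h_def sum_negf)
  also have "\<dots> = (\<Sum>j<2 * (p - 1). h j)" by (rule sum_even_odd)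
  also have "\<dots> = (\<Sum>j<p - 1. h j) + (\<Sum>j<p - 1. h ((p - 1) + j))"
    unfolding mult_2 by (rule sum_lessThan_add)
  also have "\<dots> = 2 * (\<Sum>j<p - 1. h j)" using sum_shift_periodic[of h "p - 1" "p - 1"] per by simp
  finally have G1: "(\<Sum>j<p - 1. h j) = G 1" by simp
  have z1: "(\<Sum>r\<in>{1..<p}. z ^ r) = - 1"
  proof -
    have "(\<Sum>r<p. z ^ r) = 0" using sum_powers_root_of_unity[OF z_pow] z_neq by simp
    moreover have "{..<p} = insert 0 {1..<p}" using p_gt_1 by auto
    ultimately show ?thesis by (simp add: eq_neg_iff_add_eq_0 add.commute)
  qed
  have "(\<Sum>r | r \<in> {1..<p} \<and> sign (mulperm p r) = 1. z ^ r) =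
      (\<Sum>r\<in>{1..<p}. if sign (mulperm p r) = 1 then z ^ r else 0)"
    by (rule sum.inter_filter) simp
  also have "\<dots> = (\<Sum>r\<in>{1..<p}. (z ^ r + s r * z ^ r) / 2)"
  proof (intro sum.cong refl)
    fix r
    show "(if sign (mulperm p r) = 1 then z ^ r else 0) = (z ^ r + s r * z ^ r) / 2"
      by (cases "mulperm p r" rule: sign_cases) (auto simp: s_def)
  qed
  also have "\<dots> = ((\<Sum>r\<in>{1..<p}. z ^ r) + (\<Sum>r\<in>{1..<p}. s r * z ^ r)) / 2"
    by (simp add: sum.distrib flip: sum_divide_distrib)
  finally show ?thesis unfolding z1 T G1 by simp
qed

section \<open>From units modulo the order to units modulo \<open>p\<close>\<close>

lemma coprime_lift:
  fixes p m r :: nat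
  assumes "prime p" "m > 0" "\<not> p dvd r"
  shows "\<exists>u. coprime u m \<and> [u = r] (mod p)"
proof (cases "p dvd m")
  case False
  hence "coprime p m" using assms by (simp add: prime_imp_coprime)
  then obtain u where u: "[u = r] (mod p)" "[u = 1] (mod m)" using binary_chinese_remainder_nat by blast
  have "coprime u m" using cong_imp_coprime[OF cong_sym[OF u(2)]] by simp
  thus ?thesis using u by blast
next
  case True
  \<comment> \<open>The \<open>p\<close>-part of \<open>m\<close> carries the prescribed residue,
    the cofactor gets residue 1.\<close>
  define e where "e = multiplicity p m"
  define b where "b = m div p ^ e"
  have m: "m = p ^ e * b" by (simp add: b_def e_def multiplicity_dvd)
  have e: "e > 0" using True assms by (simp add: e_def prime_multiplicity_gt_zero_iff)
  have "\<not> p dvd b" using assms unfolding b_def e_def by (intro multiplicity_decompose) auto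
  hence "coprime (p ^ e) b" using assms by (simp add: prime_imp_coprime)
  then obtain u where u: "[u = r] (mod p ^ e)" "[u = 1] (mod b)" using binary_chinese_remainder_nat by blast
  have up: "[u = r] (mod p)" by (rule cong_dvd_modulus_nat[OF u(1)]) (use e in simp)
  hence "\<not> p dvd u" using assms(3) cong_dvd_iff by blast
  hence "coprime u (p ^ e)" using assms(1) by (simp add: prime_imp_coprime coprime_commute)
  moreover have "coprime u b" using cong_imp_coprime[OF cong_sym[OF u(2)]] by simp
  ultimately show ?thesis using up m by auto
qed

lemma card_units_fibre_le:
  fixes p m u :: nat
  assumes "p dvd m" "m > 0" "coprime u m" and r: "(r * u) mod p = r'"
  shows "card {k. k < m \<and> coprime k m \<and> k mod p = r} \<le> card {k. k < m \<and> coprime k m \<and> k mod p = r'}"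
proof (rule card_inj_on_le[of "\<lambda>k. (k * u) mod m"])
  show "inj_on (\<lambda>k. (k * u) mod m) {k. k < m \<and> coprime k m \<and> k mod p = r}"
  proof
    fix x y assume xy: "x \<in> {k. k < m \<and> coprime k m \<and> k mod p = r}" "y \<in> {k. k < m \<and> coprime k m \<and> k mod p = r}"
      "(x * u) mod m = (y * u) mod m"
    hence "[x * u = y * u] (mod m)" by (simp add: cong_def)
    hence "[x = y] (mod m)" using assms(3) cong_mult_rcancel_nat by blast
    thus "x = y" using xy by (simp add: cong_def)
  qed
  show "(\<lambda>k. (k * u) mod m) ` {k. k < m \<and> coprime k m \<and> k mod p = r} \<subseteq> {k. k < m \<and> coprime k m \<and> k mod p = r'}"
  proof
    fix y assume "y \<in> (\<lambda>k. (k * u) mod m) ` {k. k < m \<and> coprime k m \<and> k mod p = r}"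
    then obtain k where k: "k < m" "coprime k m" "k mod p = r" "y = (k * u) mod m" by auto
    have "y mod p = (k * u) mod p" unfolding k(4) using assms(1) by (rule mod_mod_cancel)
    also have "\<dots> = r'" using r k(3) by (metis mod_mult_left_eq)
    finally have "y mod p = r'" .
    moreover have "coprime y m" unfolding k(4) using k(2) assms(2,3) by (simp add: coprime_mod_left_iff)
    ultimately show "y \<in> {k. k < m \<and> coprime k m \<and> k mod p = r'}" using assms(2) k(4) by simp
  qed
qed simp

text \<open>All fibres of the reduction from units modulo \<open>m\<close> to units modulo
  \<open>p\<close> have the same size: a lift \<open>u\<close> of \<open>r\<close> moves the fibre
  over 1 into the one over \<open>r\<close>, and its inverse moves it back. As \<open>z ^ k\<close>
  and \<open>P k\<close> depend only on \<open>k mod p\<close>, the sum is the common size times a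
  sum over residues.\<close>

lemma sum_units_fibres:
  fixes z :: complex
  assumes p: "prime p" "p dvd m" "m > 0" and z: "z ^ p = 1"
    and P: "\<And>k. P (k mod p) = P k"
  shows "\<exists>c::nat. c > 0 \<and> (\<Sum>k | k < m \<and> coprime k m \<and> P k. z ^ k) = of_nat c * (\<Sum>r | r \<in> {1..<p} \<and> P r. z ^ r)"
proof -
  define U where "U r = {k. k < m \<and> coprime k m \<and> k mod p = r}" for r
  have p1: "p > 1" using prime_gt_1_nat[OF p(1)] .
  have card_U: "card (U r) = card (U 1)" if r: "r \<in> {1..<p}" for r
  proof -
    have nd: "\<not> p dvd r" using r by (auto dest: dvd_imp_le)
    obtain u where u: "coprime u m" "[u = r] (mod p)" using coprime_lift[OF p(1,3) nd] by blast
    have "(1 * u) mod p = r" using u(2) r by (simp add: cong_def)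
    hence le1: "card (U 1) \<le> card (U r)" unfolding U_def by (rule card_units_fibre_le[OF p(2,3) u(1)])
    obtain u' where u': "[u * u' = Suc 0] (mod m)" using cong_solve_coprime_nat[OF u(1)] by blast
    have "coprime (u * u') m" using cong_imp_coprime[OF cong_sym[OF u']] by simp
    hence cu': "coprime u' m" by simp
    have "[r * u' = u * u'] (mod p)" by (intro cong_mult cong_sym[OF u(2)] cong_refl)
    moreover have "[u * u' = Suc 0] (mod p)" by (rule cong_dvd_modulus_nat[OF u' p(2)])
    ultimately have "[r * u' = Suc 0] (mod p)" by (rule cong_trans)
    hence "(r * u') mod p = 1" using p1 by (simp add: cong_def)
    hence "card (U r) \<le> card (U 1)" unfolding U_def by (rule card_units_fibre_le[OF p(2,3) cu'])
    with le1 show ?thesis by simp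
  qed
  have fin: "finite {k. k < m \<and> coprime k m \<and> P k}" by simp
  have maps: "(\<lambda>k. k mod p) ` {k. k < m \<and> coprime k m \<and> P k} \<subseteq> {r. r \<in> {1..<p} \<and> P r}"
  proof
    fix r assume "r \<in> (\<lambda>k. k mod p) ` {k. k < m \<and> coprime k m \<and> P k}"
    then obtain k where k: "k < m" "coprime k m" "P k" "r = k mod p" by auto
    have "\<not> p dvd k"
    proof
      assume "p dvd k"
      from coprime_common_divisor[OF k(2) this p(2)] show False using p1 by simp
    qed
    hence "k mod p \<noteq> 0" by (simp add: dvd_eq_mod_eq_0)
    hence "1 \<le> r" "r < p" using k(4) p1 by auto
    moreover have "P r" unfolding k(4) P by (rule k(3))
    ultimately show "r \<in> {r. r \<in> {1..<p} \<and> P r}" by simp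
  qed
  have "(\<Sum>k | k < m \<and> coprime k m \<and> P k. z ^ k) =
    (\<Sum>r | r \<in> {1..<p} \<and> P r. \<Sum>k\<in>{k \<in> {k. k < m \<and> coprime k m \<and> P k}. k mod p = r}. z ^ k)"
    by (rule sum.group[symmetric, OF fin _ maps]) simp
  also have "\<dots> = (\<Sum>r | r \<in> {1..<p} \<and> P r. of_nat (card (U 1)) * z ^ r)"
  proof (intro sum.cong refl)
    fix r assume r: "r \<in> {r. r \<in> {1..<p} \<and> P r}"
    have "{k \<in> {k. k < m \<and> coprime k m \<and> P k}. k mod p = r} = U r"
    proof -
      have "P k \<longleftrightarrow> P r" if "k mod p = r" for k using P[of k] unfolding that by (rule sym)
      thus ?thesis using r by (auto simp: U_def)
    qed
    moreover have "(\<Sum>k\<in>U r. z ^ k) = (\<Sum>k\<in>U r. z ^ r)"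
    proof (intro sum.cong refl)
      fix k assume "k \<in> U r"
      hence "k mod p = r" by (simp add: U_def)
      thus "z ^ k = z ^ r" using root_of_unity_pow_mod[OF z, of k] by simp
    qed
    ultimately show "(\<Sum>k\<in>{k \<in> {k. k < m \<and> coprime k m \<and> P k}. k mod p = r}. z ^ k) = of_nat (card (U 1)) * z ^ r"
      using card_U[of r] r by (simp only: sum_constant mem_Collect_eq)
  qed
  also have "\<dots> = of_nat (card (U 1)) * (\<Sum>r | r \<in> {1..<p} \<and> P r. z ^ r)" by (simp add: sum_distrib_left)
  finally have eq: "(\<Sum>k | k < m \<and> coprime k m \<and> P k. z ^ k) = of_nat (card (U 1)) * (\<Sum>r | r \<in> {1..<p} \<and> P r. z ^ r)" .
  have "p \<le> m" using p by (intro dvd_imp_le)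
  hence "1 \<in> U 1" using p1 by (simp add: U_def)
  moreover have "finite (U 1)" by (simp add: U_def)
  ultimately have "card (U 1) > 0" by (auto simp: card_gt_0_iff)
  thus ?thesis using eq by blast
qed

text \<open>A prime is not a square, so \<open>p\<close> is a cycle length different from those in
  \<open>T\<close>. The character value is a rational expression in \<open>G 1\<close>, which can be
  solved for \<open>G 1\<close>; the undetermined sign of the Gauss sum is absorbed by negation in
  the field.\<close>

lemma csqrt_star_in_K:
  assumes \<pi>: "\<And>q. q \<in> \<pi> \<Longrightarrow> prime q \<and> odd q" and p: "p \<in> \<pi>"
    and T: "T \<subseteq> pi_squares \<pi>" "finite T" "\<Sum>T = n - p" "p \<le> n"
  shows "csqrt (of_int (odd_star p)) \<in> K \<pi> n"
proof -
  have pp: "prime p" "odd p" using \<pi>[OF p] by auto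
  have p1: "p > 1" using prime_gt_1_nat[OF pp(1)] .
  have pi_odd: "odd a" if "pi_number \<pi> a" for a
  proof
    assume "even a"
    hence "2 \<in> prime_factors a" using that by (simp add: pi_number_def prime_factors_dvd)
    thus False using that \<pi>[of 2] by (auto simp: pi_number_def)
  qed
  have sq: "\<exists>b. a = b\<^sup>2 \<and> odd b" "pi_number \<pi> a" if a: "a \<in> T" for a
  proof -
    have "a \<in> pi_squares \<pi>" using T(1) a by blast
    then obtain b where b: "pi_number \<pi> a" "a = b\<^sup>2" by (auto simp: pi_squares_def)
    thus "pi_number \<pi> a" by simp
    have "odd b" using pi_odd[OF b(1)] b(2) by simp
    thus "\<exists>b. a = b\<^sup>2 \<and> odd b" using b(2) by blast
  qed
  have pT: "p \<notin> T"
  proof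
    assume "p \<in> T"
    then obtain b where "p = b\<^sup>2" using sq(1) by blast
    thus False using pp(1) by (simp add: prime_power_iff)
  qed
  define \<Lambda> where "\<Lambda> = insert p T"
  interpret C: odd_cycle_type \<Lambda> n
  proof
    show "finite \<Lambda>" using T by (simp add: \<Lambda>_def)
    show "odd l" if "l \<in> \<Lambda>" for l
    proof (cases "l = p")
      case False
      hence "l \<in> T" using that by (simp add: \<Lambda>_def)
      thus ?thesis by (intro pi_odd sq(2))
    qed (use pp in simp)
    show "\<Sum>\<Lambda> = n" using T(2,3,4) pT by (simp add: \<Lambda>_def)
  qed
  have p\<Lambda>: "p \<in> \<Lambda>" by (simp add: \<Lambda>_def)
  have pi_m: "pi_number \<pi> C.m"
  proof -
    have "q \<in> \<pi>" if q: "prime q" "q dvd C.m" for q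
    proof -
      have "q dvd \<Prod>\<Lambda>" using q(2) C.m_dvd_prod by (rule dvd_trans)
      then obtain l where l: "l \<in> \<Lambda>" "q dvd l" using q(1) T(2) by (auto simp: prime_dvd_prod_iff \<Lambda>_def)
      show ?thesis
      proof (cases "l = p")
        case True
        thus ?thesis using l q pp(1) p primes_dvd_imp_eq by blast
      next
        case False
        hence "pi_number \<pi> l" using l sq by (simp add: \<Lambda>_def)
        thus ?thesis using l(2) q(1) by (auto simp: pi_number_def prime_factors_dvd)
      qed
    qed
    thus ?thesis using C.m_pos by (auto simp: pi_number_def prime_factors_dvd)
  qed
  define z where "z = cis (2 * pi / p)"
  have zp: "z ^ p = 1" using p1 by (simp add: z_def DeMoivre)
  have z0: "z \<noteq> 0" by (simp add: z_def)
  have z1: "z \<noteq> 1"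
  proof
    assume "z = 1"
    hence "cos (2 * pi / p) = 1" by (auto simp: z_def complex_eq_iff)
    then obtain k :: int where "2 * pi / p = of_int k * 2 * pi" unfolding cos_one_2pi_int by blast
    hence "1 = real_of_int k * real p" using p1 by (simp add: field_simps)
    hence "real_of_int 1 = real_of_int (k * int p)" by simp
    hence "1 = k * int p" by (simp only: of_int_eq_iff)
    hence "int p dvd 1" by (metis dvd_triv_right)
    thus False using p1 by simp
  qed
  have sign_\<tau>: "sign (C.\<tau> k) = sign (mulperm p k)" if k: "coprime k C.m" for k
  proof -
    have "sign (C.\<tau> k) = sign (mulperm p k) * (\<Prod>l\<in>T. sign (mulperm l k))"
      using C.\<tau>_permutes_sign(2)[OF k] T(2) pT by (simp add: \<Lambda>_def)
    also have "(\<Prod>l\<in>T. sign (mulperm l k)) = 1"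
    proof (rule prod.neutral, rule ballI)
      fix l assume l: "l \<in> T"
      then obtain b where b: "l = b\<^sup>2" "odd b" using sq(1) by blast
      have "b dvd C.m" using C.dvd_m[of l] l by (auto simp: \<Lambda>_def b(1) intro: dvd_trans[of b "b\<^sup>2"])
      hence "coprime k b" using k coprime_divisors[of k k b C.m] by simp
      thus "sign (mulperm l k) = 1" unfolding b(1) by (rule sign_mulperm_square[OF b(2)])
    qed
    finally show ?thesis by simp
  qed
  obtain g where g: "residue_primroot p g" using prime_primitive_root_exists[OF p1 pp(1)] by blast
  interpret gauss_sum p g z by unfold_locales (use pp g zp z1 in auto)
  obtain \<chi> c where \<chi>: "is_character (alt_group n) \<chi>" "c \<in> \<rat>"
    "(\<Sum>k | k < C.m \<and> coprime k C.m \<and> sign (C.\<tau> k) = 1. z ^ k) = c * \<chi> C.\<sigma>"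
    using C.character_value[OF p\<Lambda> zp z0] by blast
  have "\<chi> C.\<sigma> \<in> K \<pi> n" unfolding K_def
    using \<chi>(1) C.\<sigma>_alt pi_m by (intro rat_adjoin_incl) blast
  hence cK: "c * \<chi> C.\<sigma> \<in> K \<pi> n"
    unfolding K_def by (rule rat_adjoin_mult[OF rat_adjoin_Rats[OF \<chi>(2)]])
  obtain f :: nat where f: "f > 0" "(\<Sum>k | k < C.m \<and> coprime k C.m \<and> sign (mulperm p k) = 1. z ^ k) =
      of_nat f * (\<Sum>r | r \<in> {1..<p} \<and> sign (mulperm p r) = 1. z ^ r)"
    using sum_units_fibres[OF pp(1) C.dvd_m[OF p\<Lambda>] C.m_pos zp, of "\<lambda>k. sign (mulperm p k) = 1"]
    by (auto simp: mulperm_mod)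
  have sets: "{k. k < C.m \<and> coprime k C.m \<and> sign (C.\<tau> k) = 1} = {k. k < C.m \<and> coprime k C.m \<and> sign (mulperm p k) = 1}"
    using sign_\<tau> by auto
  have "c * \<chi> C.\<sigma> = of_nat f * ((G 1 - 1) / 2)"
    unfolding \<chi>(3)[symmetric] sets f(2) sum_quadratic_residues ..
  hence "G 1 = (2 / of_nat f) * (c * \<chi> C.\<sigma>) + 1" using f(1) by (simp add: field_simps)
  moreover have "(2 / of_nat f :: complex) \<in> \<rat>" by simp
  ultimately have "G 1 \<in> K \<pi> n"
    using cK unfolding K_def by (simp only: rat_adjoin_add rat_adjoin_mult rat_adjoin_Rats Rats_1)
  moreover from this have "- G 1 \<in> K \<pi> n" unfolding K_def by (rule rat_adjoin_uminus)
  ultimately show ?thesis using G_csqrt by auto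
qed

theorem theorem1p1:
  fixes t n :: nat and p :: "nat \<Rightarrow> nat" and \<pi> :: "nat set" and N :: real
  assumes "t \<ge> 2"
    and "\<And>i. i \<in> {1..t} \<Longrightarrow> prime (p i) \<and> odd (p i)"
    and "strict_mono_on {1..t} p"
    and "\<pi> = p ` {1..t}"
    and "is_N p t N"
    and "real n > N"
  shows "K \<pi> n = rat_adjoin ((\<lambda>i. csqrt (of_int (odd_star (p i)))) ` {1..t})"
proof -
  have \<pi>: "prime q \<and> odd q" if "q \<in> \<pi>" for q using that assms(2,4) by auto
  have field: "rat_adjoin ((\<lambda>i. csqrt (of_int (odd_star (p i)))) ` {1..t}) = star_field \<pi>"
    by (simp add: assms(4) image_image)
  show ?thesis unfolding field
  proof
    show "K \<pi> n \<subseteq> star_field \<pi>"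
      unfolding K_def using character_in_star_field[OF \<pi>] by (intro rat_adjoin_mono) auto
    show "star_field \<pi> \<subseteq> K \<pi> n"
      unfolding K_def
    proof (rule rat_adjoin_mono, fold K_def, rule subsetI)
      fix x assume "x \<in> (\<lambda>p. csqrt (of_int (odd_star p))) ` \<pi>"
      then obtain i where i: "i \<in> {1..t}" "x = csqrt (of_int (odd_star (p i)))" using assms(4) by auto
      have "p i \<le> p t"
      proof (cases "i = t")
        case False
        hence "i < t" using i by simp
        hence "p i < p t" using assms(1,3) i unfolding strict_mono_on_def by auto
        thus ?thesis by simp
      qed simp
      from sum_distinct_pi_squares[OF assms(1,2,3,5,6) this] obtain T where
        "p i \<le> n" "T \<subseteq> pi_squares \<pi>" "finite T" "\<Sum>T = n - p i"
        unfolding assms(4) by blast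
      moreover have "p i \<in> \<pi>" using i assms(4) by blast
      ultimately show "x \<in> K \<pi> n" unfolding i(2) using csqrt_star_in_K[OF \<pi>] by blast
    qed
  qed
qed

end
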